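(* Let $S$ be a mixed subdivision of $C_0+C_1+C_2$ in which an internal point $b_i\in B_i$ (i.e. $b_i\in B_i$ with $b_{iL}<b_i<b_{iR}$), for some $i\in\{0,1,2\}$, defines a $0$-dimensional face $(b_i,2)=(b_i,0)+(0,1)+(0,1)\in L$. Then the point of $N(\phi)$ obtained by $S$ cannot be a vertex of $N(\phi)$, because it is a convex combination of points obtained by other mixed subdivisions, which are defined by points of $B_0,B_1,B_2$ that are either endpoints of the $B_j$'s or are used in defining $S$, excepting $(b_i,2)$.
   Context: Consider $x=P_0(t)/Q(t)$, $y=P_1(t)/Q(t)$ with $P_0,P_1,Q\in\mathbb{C}[t]$ having fixed supports and generic coefficients (the result holds for all coefficient vectors in some open dense subset), $\gcd(P_i,Q)=1$ for $i=0,1$, and parameterization of degree $1$. Let $\phi\in\mathbb{C}[x,y]$ be the implicit equation (generator of the ideal of polynomials vanishing on the parameterization) and $N(\phi)$ its Newton polygon (convex hull of the exponent vectors occurring in $\phi$). Let $B_0,B_1,B_2\subset\mathbb{N}$ be the supports of $P_0,P_1,Q$, with $b_{iL}=\min B_i$, $b_{iR}=\max B_i$, and $u=\max\{b_{0R},b_{1R},b_{2R}\}$. Consider $f_0=xr-P_0(t)$, $f_1=yr-P_1(t)$, $f_2=r-Q(t)$ as polynomials in $(t,r)$. Their supports are $A_i=\{a_{i0}\}\cup\{(b,0):b\in B_i\}\subset\mathbb{N}^2$, where $a_{i0}=(0,1)$ corresponds to the term containing $r$. Put $C_i=\mathrm{CH}(A_i)$ (convex hull), $C=C_0+C_1+C_2$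 (Minkowski sum), and let $L\subset C$ be the segment with endpoints $(0,2),(u,2)$. A Minkowski cell of $C$ is a full-dimensional convex polygon $R=R_0+R_1+R_2$, where each $R_i$ is a convex polytope with vertices in $A_i$. A mixed subdivision of $C$ is a family of Minkowski cells which partition $C$ and intersect properly as Minkowski sums (for two cells $\sum R_i$, $\sum R_i'$, each $R_i\cap R_i'$ is a face of both, and the Minkowski sum descriptions are compatible). Mixed subdivisions here are tight: $\dim R_0+\dim R_1+\dim R_2=2$ for every cell. Each face has a unique description as a Minkowski sum of subpolytopes of the $C_i$. A cell is $i$-mixed, with vertex summand $a_{i0}$, if it is the sum of $a_{i0}$ and of one edge (one-dimensional segment with endpoints in the support) from each of the other two supports. The point obtained by a mixed subdivision is $(e_0,e_1)$, where, for $i=0,1,2$, $e_i$ is the sum of the Euclidean areas of the $i$-mixed cells with vertex summand $a_{i0}$.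
   Formalization: As stated, the point of S can be a vertex of N(φ) (e.g. B_0={0,1,2}, B_1={0,1}, B_2={0}); proved here: it is a convex combination of points of the described other subdivisions, and is not a vertex unless one of those obtains the same point. *)

theory Defs
  imports "HOL-Analysis.Analysis" "HOL-Computational_Algebra.Computational_Algebra"
begin

(* The index type 3 has exactly the elements 0, 1, 2: the indices 0 and 1 belong to the
   numerators P_0 and P_1, the index 2 to the common denominator Q. *)

section \<open>Parameterizations with fixed supports\<close>

definition coeff_space :: "(3 \<Rightarrow> nat set) \<Rightarrow> (3 \<Rightarrow> nat \<Rightarrow> complex) set" where
  "coeff_space B = {c. \<forall>i n. n \<notin> B i \<longrightarrow> c i n = 0}"

definition param_poly :: "(3 \<Rightarrow> nat set) \<Rightarrow> (3 \<Rightarrow> nat \<Rightarrow> complex) \<Rightarrow> 3 \<Rightarrow> complex poly" where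
  "param_poly B c i = (\<Sum>b\<in>B i. monom (c i b) b)"

(* For finite supports, the product topology on functions induces the usual topology
   of the finite-dimensional complex space on coeff_space B. *)
definition generically ::
  "(3 \<Rightarrow> nat set) \<Rightarrow> ((3 \<Rightarrow> nat \<Rightarrow> complex) \<Rightarrow> bool) \<Rightarrow> bool" where
  "generically B Prop \<longleftrightarrow>
     (\<exists>U. openin (top_of_set (coeff_space B)) U \<and> coeff_space B \<subseteq> closure U \<and> (\<forall>c\<in>U. Prop c))"

definition curve_point :: "(3 \<Rightarrow> complex poly) \<Rightarrow> complex \<Rightarrow> complex \<times> complex" where
  "curve_point P t = (poly (P 0) t / poly (P 2) t, poly (P 1) t / poly (P 2) t)"

(* The degree of a parameterization is the number of parameter values in a generic fibre. *)
definition param_degree_one :: "(3 \<Rightarrow> complex poly) \<Rightarrow> bool" where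
  "param_degree_one P \<longleftrightarrow>
     finite {t. poly (P 2) t \<noteq> 0 \<and>
       card {s. poly (P 2) s \<noteq> 0 \<and> curve_point P s = curve_point P t} \<noteq> 1}"

section \<open>Implicit equation and Newton polygon\<close>

(* A bivariate polynomial F is a polynomial in y over polynomials in x:
   coeff (coeff F k) j is the coefficient of x^j * y^k. *)
definition poly2 :: "complex poly poly \<Rightarrow> complex \<Rightarrow> complex \<Rightarrow> complex" where
  "poly2 F x y = poly (poly F [:y:]) x"

definition vanishing_ideal :: "(3 \<Rightarrow> complex poly) \<Rightarrow> complex poly poly set" where
  "vanishing_ideal P =
     {F. \<forall>t. poly (P 2) t \<noteq> 0 \<longrightarrow> poly2 F (fst (curve_point P t)) (snd (curve_point P t)) = 0}"

definition implicit_equation :: "(3 \<Rightarrow> complex poly) \<Rightarrow> complex poly poly \<Rightarrow> bool" where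
  "implicit_equation P \<phi> \<longleftrightarrow> vanishing_ideal P = {F. \<phi> dvd F}"

definition newton_polygon :: "complex poly poly \<Rightarrow> (real \<times> real) set" where
  "newton_polygon F = convex hull {(real j, real k) | j k. coeff (coeff F k) j \<noteq> 0}"

section \<open>Supports of the polynomials in t and r, and mixed subdivisions\<close>

definition apex :: "real \<times> real" where
  "apex = (0, 1)"

definition suppA :: "(3 \<Rightarrow> nat set) \<Rightarrow> 3 \<Rightarrow> (real \<times> real) set" where
  "suppA B i = insert apex {(real b, 0) | b. b \<in> B i}"

definition msum :: "(3 \<Rightarrow> (real \<times> real) set) \<Rightarrow> (real \<times> real) set" where
  "msum R = {x + y + z | x y z. x \<in> R 0 \<and> y \<in> R 1 \<and> z \<in> R 2}"

definition bigC :: "(3 \<Rightarrow> nat set) \<Rightarrow> (real \<times> real) set" where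
  "bigC B = msum (\<lambda>i. convex hull suppA B i)"

definition segL :: "(3 \<Rightarrow> nat set) \<Rightarrow> (real \<times> real) set" where
  "segL B = closed_segment (0, 2) (real (Max (\<Union>i. B i)), 2)"

(* A cell is given by its summands R 0, R 1, R 2, so it carries its description as a
   Minkowski sum. *)
definition minkowski_cell :: "(3 \<Rightarrow> nat set) \<Rightarrow> (3 \<Rightarrow> (real \<times> real) set) \<Rightarrow> bool" where
  "minkowski_cell B R \<longleftrightarrow>
     (\<forall>i. \<exists>V. V \<subseteq> suppA B i \<and> V \<noteq> {} \<and> R i = convex hull V) \<and> aff_dim (msum R) = 2"

definition tight_cell :: "(3 \<Rightarrow> (real \<times> real) set) \<Rightarrow> bool" where
  "tight_cell R \<longleftrightarrow> (\<Sum>i\<in>UNIV. aff_dim (R i)) = 2"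

(* The last conjunct is the compatibility of the two descriptions: the common part of the
   cells is the Minkowski sum of the common parts of their summands. For disjoint cells it
   says that some R i \<inter> R' i is empty, as is the case for the corresponding cells of a
   subdivision of the Cayley polytope. *)
definition intersect_properly ::
  "(3 \<Rightarrow> (real \<times> real) set) \<Rightarrow> (3 \<Rightarrow> (real \<times> real) set) \<Rightarrow> bool" where
  "intersect_properly R R' \<longleftrightarrow>
     (\<forall>i. R i \<inter> R' i face_of R i \<and> R i \<inter> R' i face_of R' i) \<and>
     msum R \<inter> msum R' face_of msum R \<and> msum R \<inter> msum R' face_of msum R' \<and>
     msum R \<inter> msum R' = msum (\<lambda>i. R i \<inter> R' i)"

definition mixed_subdivision ::
  "(3 \<Rightarrow> nat set) \<Rightarrow> (3 \<Rightarrow> (real \<times> real) set) set \<Rightarrow> bool" where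
  "mixed_subdivision B S \<longleftrightarrow>
     finite S \<and>
     (\<forall>R\<in>S. minkowski_cell B R \<and> tight_cell R) \<and>
     (\<Union>R\<in>S. msum R) = bigC B \<and>
     (\<forall>R\<in>S. \<forall>R'\<in>S. R \<noteq> R' \<longrightarrow>
        interior (msum R) \<inter> interior (msum R') = {} \<and> intersect_properly R R')"

definition mixed_cell ::
  "(3 \<Rightarrow> nat set) \<Rightarrow> 3 \<Rightarrow> (3 \<Rightarrow> (real \<times> real) set) \<Rightarrow> bool" where
  "mixed_cell B i R \<longleftrightarrow>
     R i = {apex} \<and>
     (\<forall>j. j \<noteq> i \<longrightarrow>
        (\<exists>p\<in>suppA B j. \<exists>q\<in>suppA B j. p \<noteq> q \<and> R j = closed_segment p q))"

definition mixed_area ::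
  "(3 \<Rightarrow> nat set) \<Rightarrow> (3 \<Rightarrow> (real \<times> real) set) set \<Rightarrow> 3 \<Rightarrow> real" where
  "mixed_area B S i = (\<Sum>R | R \<in> S \<and> mixed_cell B i R. measure lborel (msum R))"

definition obtained_point ::
  "(3 \<Rightarrow> nat set) \<Rightarrow> (3 \<Rightarrow> (real \<times> real) set) set \<Rightarrow> real \<times> real" where
  "obtained_point B S = (mixed_area B S 0, mixed_area B S 1)"

definition internal_point :: "(3 \<Rightarrow> nat set) \<Rightarrow> 3 \<Rightarrow> nat \<Rightarrow> bool" where
  "internal_point B i b \<longleftrightarrow> b \<in> B i \<and> Min (B i) < b \<and> b < Max (B i)"

(* The 0-dimensional face with Minkowski summands {p 0}, {p 1}, {p 2}. *)
definition vertex_face ::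
  "(3 \<Rightarrow> (real \<times> real) set) set \<Rightarrow> (3 \<Rightarrow> real \<times> real) \<Rightarrow> bool" where
  "vertex_face S p \<longleftrightarrow>
     (\<exists>R\<in>S. (\<forall>j. {p j} face_of R j) \<and> {p 0 + p 1 + p 2} face_of msum R)"

definition defines_face_on_L ::
  "(3 \<Rightarrow> nat set) \<Rightarrow> (3 \<Rightarrow> (real \<times> real) set) set \<Rightarrow> 3 \<Rightarrow> nat \<Rightarrow> bool" where
  "defines_face_on_L B S i b \<longleftrightarrow>
     (real b, 2) \<in> segL B \<and> vertex_face S ((\<lambda>_. apex)(i := (real b, 0)))"

definition used_point :: "(3 \<Rightarrow> (real \<times> real) set) set \<Rightarrow> 3 \<Rightarrow> nat \<Rightarrow> bool" where
  "used_point S j b \<longleftrightarrow> (\<exists>R\<in>S. (real b, 0) extreme_point_of R j)"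

(* The mixed subdivisions other than S defined by points of the supports which are endpoints
   or are used in S, the point b of B i being excluded. *)
definition other_subdivisions ::
  "(3 \<Rightarrow> nat set) \<Rightarrow> (3 \<Rightarrow> (real \<times> real) set) set \<Rightarrow> 3 \<Rightarrow> nat \<Rightarrow>
     (3 \<Rightarrow> (real \<times> real) set) set set" where
  "other_subdivisions B S i b =
     {S'. mixed_subdivision B S' \<and> S' \<noteq> S \<and> \<not> used_point S' i b \<and>
        (\<forall>j. \<forall>b'\<in>B j. used_point S' j b' \<longrightarrow>
           b' = Min (B j) \<or> b' = Max (B j) \<or> used_point S j b')}"

end

theory Submission
  imports Defs
begin

text \<open>
  Write \<open>e\<^sub>i\<close> for the sum of the areas of the \<open>i\<close>-mixed cells of a mixed subdivision, and
  \<open>u\<close> for the largest point of the three supports. The triple \<open>(e\<^sub>0, e\<^sub>1, e\<^sub>2)\<close> lies in the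
  triangle \<open>e\<^sub>0 + e\<^sub>1 + e\<^sub>2 = u\<close>, and so do the exponents \<open>(m\<^sub>0, m\<^sub>1, m\<^sub>2)\<close> of the
  implicit equation once it is homogenized in degree \<open>u\<close>. On this triangle every linear functional
  differs by a constant from some \<open>a z\<^sub>i + b z\<^sub>j\<close> with \<open>a, b \<ge> 0\<close>, so a convex set in it is
  known as soon as the minima of these functionals are known. All of them are given by one function,
  the corner support
    \<open>h\<^sub>i\<^sub>j(a, b) = min (a v\<^sub>j) (b v\<^sub>i) + min (a w\<^sub>j) (b w\<^sub>i)\<close>,
  where \<open>v\<^sub>l\<close> is the distance from \<open>0\<close> to the first point of the support \<open>B\<^sub>l\<close> and \<open>w\<^sub>l\<close>
  the distance from its last point to \<open>u\<close>. Interior points of the supports do not occur in it.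

  Three facts about \<open>h\<close> carry the proof. Every mixed subdivision satisfies
  \<open>h\<^sub>i\<^sub>j(a, b) \<le> a e\<^sub>i + b e\<^sub>j\<close> (\<open>mixed_area_lower_bound\<close>). Up to an arbitrarily small error
  the value \<open>h\<^sub>i\<^sub>j(a, b)\<close> is reached by a subdivision that uses only end points of the supports
  (\<open>end_subdivision_bound\<close>). Up to an arbitrarily small error it is also reached by an exponent of the
  implicit equation (\<open>exponent_bound\<close>). By separation of convex sets
  (\<open>in_hull_of_support_bounds\<close>) the point of every mixed subdivision lies in the convex hull of the
  points of the end point subdivisions, and also in the Newton polygon. A subdivision that has an internal
  point on the top edge is not one of the end point subdivisions, and these do not use that internal
  point; so its point is a convex combination of the kind wanted, and all points of the combination lie
  in the Newton polygon.

  The lower bound comes from the horizontal strip between the heights \<open>1\<close> and \<open>2\<close>. Every mixed cell with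
  an apex summand meets it, and the cells that meet it are lined up from left to right. Each passage from
  the left to the right side of such a cell is one of four moves (\<open>cell_step\<close>), and the mixed areas are
  sums of the lengths gained by the moves; the bound is an invariant of this path. For the second fact the
  end points are lifted to generic heights close to \<open>- a\<close>, \<open>- b\<close> and \<open>0\<close>, and the mixed cells of the
  regular subdivision are read off from the crossing of lines. For the third fact the parameterized
  curve is intersected with explicit rational test curves: a general member of a pencil of polynomials has as many
  simple nonzero roots as the length of its exponent interval (\<open>pencil_roots\<close>), so the test curve meets
  the curve often, and the restriction of the implicit equation to the test curve must start with a small
  power. This needs the degree bound \<open>implicit_equation_degree\<close> and that no two of the three polynomials
  have a common nonzero root; for \<open>P\<^sub>0\<close> and \<open>P\<^sub>1\<close> the latter is the genericity of the coefficients.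
\<close>

section \<open>Polygons in the plane\<close>

lemma distinct_3_cases:
  fixes i j k :: 3
  assumes "i \<noteq> j" "j \<noteq> k" "i \<noteq> k"
  shows "l = i \<or> l = j \<or> l = k" "UNIV = {i, j, k}"
proof -
  have card: "card {i, j, k} = 3" using assms by simp
  have "card (UNIV :: 3 set) = 3" by simp
  then show U: "UNIV = {i, j, k}" using card by (metis card_subset_eq finite subset_UNIV)
  then show "l = i \<or> l = j \<or> l = k" by auto
qed

lemma third_index_exists:
  fixes j k :: 3
  assumes "j \<noteq> k"
  obtains i where "i \<noteq> j" "j \<noteq> k" "i \<noteq> k"
proof -
  have "UNIV \<noteq> {j, k}"
  proof
    assume "UNIV = {j, k}"
    then have "card (UNIV :: 3 set) \<le> 2" by (metis card_2_iff assms order_refl)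
    then show False by simp
  qed
  then show ?thesis using that assms by auto
qed

lemma sum_UNIV_3_distinct:
  fixes i j k :: 3 and f :: "3 \<Rightarrow> 'a::comm_monoid_add"
  assumes "i \<noteq> j" "j \<noteq> k" "i \<noteq> k"
  shows "(\<Sum>l\<in>UNIV. f l) = f i + f j + f k"
  using assms by (subst distinct_3_cases(2)[OF assms]) (simp add: add.assoc)

lemma msum_sum: "msum R = {\<Sum>l\<in>UNIV. f l | f. \<forall>l. f l \<in> R l}"
proof -
  have S: "(\<Sum>l\<in>UNIV. f l) = f 0 + f 1 + f 2" for f :: "3 \<Rightarrow> real \<times> real"
    by (rule sum_UNIV_3_distinct) auto
  show ?thesis
  proof (intro set_eqI iffI)
    fix p assume "p \<in> msum R"
    then obtain x y z where *: "p = x + y + z" "x \<in> R 0" "y \<in> R 1" "z \<in> R 2"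
      unfolding msum_def by auto
    define f where "f = (\<lambda>l::3. if l = 0 then x else if l = 1 then y else z)"
    have "f l \<in> R l" for l using distinct_3_cases(1)[of 0 1 2 l] * by (auto simp: f_def)
    moreover have "p = (\<Sum>l\<in>UNIV. f l)" unfolding S using * by (simp add: f_def)
    ultimately show "p \<in> {\<Sum>l\<in>UNIV. f l | f. \<forall>l. f l \<in> R l}" by blast
  next
    fix p assume "p \<in> {\<Sum>l\<in>UNIV. f l | f. \<forall>l. f l \<in> R l}"
    then obtain f where "p = f 0 + f 1 + f 2" "\<forall>l. f l \<in> R l" using S by auto
    then show "p \<in> msum R" unfolding msum_def by blast
  qed
qed

lemma msum_memI:
  assumes "\<And>l. f l \<in> R l" "p = (\<Sum>l\<in>UNIV. f l)"
  shows "p \<in> msum R"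
  unfolding msum_sum using assms by blast

lemma msum_memE:
  assumes "p \<in> msum R"
  obtains f where "\<And>l. f l \<in> R l" "p = (\<Sum>l\<in>UNIV. f l)"
  using assms unfolding msum_sum by blast

lemma msum_distinct_iff:
  assumes "i \<noteq> j" "j \<noteq> k" "i \<noteq> k"
  shows "p \<in> msum R \<longleftrightarrow> (\<exists>x\<in>R i. \<exists>y\<in>R j. \<exists>z\<in>R k. p = x + y + z)"
proof
  assume "p \<in> msum R"
  then obtain f where "\<And>l. f l \<in> R l" "p = f i + f j + f k"
    using msum_memE sum_UNIV_3_distinct[OF assms] by metis
  then show "\<exists>x\<in>R i. \<exists>y\<in>R j. \<exists>z\<in>R k. p = x + y + z" by blast
next
  assume "\<exists>x\<in>R i. \<exists>y\<in>R j. \<exists>z\<in>R k. p = x + y + z"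
  then obtain x y z where *: "x \<in> R i" "y \<in> R j" "z \<in> R k" "p = x + y + z" by blast
  define f where "f = (\<lambda>l. if l = i then x else if l = j then y else z)"
  show "p \<in> msum R"
  proof (rule msum_memI)
    show "f l \<in> R l" for l using distinct_3_cases(1)[OF assms, of l] * by (auto simp: f_def)
    show "p = sum f UNIV" using assms * by (simp add: sum_UNIV_3_distinct[OF assms] f_def)
  qed
qed

lemma convex_msum:
  assumes "\<And>l. convex (R l)"
  shows "convex (msum R)"
proof (rule convexI)
  fix p q and s t :: real
  assume "p \<in> msum R" "q \<in> msum R" and st: "0 \<le> s" "0 \<le> t" "s + t = 1"
  then obtain f g where f: "\<And>l. f l \<in> R l" "p = sum f UNIV" and g: "\<And>l. g l \<in> R l" "q = sum g UNIV"
    by (metis msum_memE)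
  show "s *\<^sub>R p + t *\<^sub>R q \<in> msum R"
  proof (rule msum_memI)
    show "s *\<^sub>R f l + t *\<^sub>R g l \<in> R l" for l using assms f g st by (simp add: convexD)
    show "s *\<^sub>R p + t *\<^sub>R q = (\<Sum>l\<in>UNIV. s *\<^sub>R f l + t *\<^sub>R g l)"
      by (simp add: f g sum.distrib scaleR_sum_right)
  qed
qed

definition hseg :: "real \<Rightarrow> real \<Rightarrow> (real \<times> real) set" where
  "hseg lo hi = {(x, y). y = 0 \<and> lo \<le> x \<and> x \<le> hi}"

text \<open>The hull of the apex and two points of the base line. For \<open>lo = hi\<close> it is a slanted segment, so
  edges through the apex and triangles are treated alike.\<close>
definition tent :: "real \<Rightarrow> real \<Rightarrow> (real \<times> real) set" where
  "tent lo hi = {(x, y). 0 \<le> y \<and> y \<le> 1 \<and> (1 - y) * lo \<le> x \<and> x \<le> (1 - y) * hi}"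

lemma closed_segment_base:
  assumes "a \<le> b"
  shows "closed_segment (a, 0) (b, 0::real) = hseg a b"
proof (intro set_eqI)
  fix p :: "real \<times> real"
  obtain x y where p: "p = (x, y)" by (cases p)
  have "p \<in> closed_segment (a, 0) (b, 0) \<longleftrightarrow> y = 0 \<and> x \<in> closed_segment a b"
    unfolding p by (auto simp: closed_segment_def)
  also have "\<dots> \<longleftrightarrow> p \<in> hseg a b" 
    using assms unfolding p by (auto simp: hseg_def closed_segment_eq_real_ivl)
  finally show "p \<in> closed_segment (a, 0) (b, 0) \<longleftrightarrow> p \<in> hseg a b" .
qed

lemma convex_hseg: "convex (hseg a b)"
proof -
  have "hseg a b = {a..b} \<times> {0}" by (auto simp: hseg_def)
  then show ?thesis by (simp add: convex_Times)
qed

lemma convex_tent: "convex (tent a b)"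
proof -
  have "tent a b = {p. - snd p \<le> 0} \<inter> {p. snd p \<le> 1} \<inter> {p. (-1, -a) \<bullet> p \<le> -a} \<inter> {p. (1, b) \<bullet> p \<le> b}"
    by (auto simp: tent_def inner_prod_def algebra_simps)
  moreover have "{p::real\<times>real. - snd p \<le> 0} = {p. (0, -1) \<bullet> p \<le> 0}" "{p::real\<times>real. snd p \<le> 1} = {p. (0, 1) \<bullet> p \<le> 1}"
    by (auto simp: inner_prod_def)
  ultimately show ?thesis by (simp add: convex_Int convex_halfspace_le)
qed

lemma hull_base_apex:
  assumes "a \<le> b"
  shows "convex hull {apex, (a, 0), (b, 0)} = tent a b"
proof
  have "apex \<in> tent a b" "(a, 0) \<in> tent a b" "(b, 0) \<in> tent a b" using assms by (auto simp: tent_def apex_def)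
  then show "convex hull {apex, (a, 0), (b, 0)} \<subseteq> tent a b"
    by (intro hull_minimal convex_tent) auto
next
  let ?H = "convex hull {apex, (a, 0), (b, 0)}"
  show "tent a b \<subseteq> ?H"
  proof
    fix p assume "p \<in> tent a b"
    then obtain x y where p: "p = (x, y)" and y: "0 \<le> y" "y \<le> 1" and x: "(1 - y) * a \<le> x" "x \<le> (1 - y) * b"
      by (auto simp: tent_def)
    have ap: "apex \<in> ?H" by (simp add: hull_inc)
    show "p \<in> ?H"
    proof (cases "y = 1")
      case True
      then have "p = apex" using p x by (simp add: apex_def)
      then show ?thesis using ap by simp
    next
      case False
      then have y1: "1 - y > 0" using y by simp
      define x' where "x' = x / (1 - y)"
      have "a \<le> x'" "x' \<le> b" using x y1 by (simp_all add: x'_def field_simps)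
      then have "(x', 0) \<in> closed_segment (a, 0) (b, 0::real)"
        by (simp add: closed_segment_base[OF assms] hseg_def)
      moreover have "closed_segment (a, 0) (b, 0) \<subseteq> ?H"
        unfolding segment_convex_hull by (intro hull_mono) auto
      ultimately have "(x', 0) \<in> ?H" by blast
      then have "(1 - y) *\<^sub>R (x', 0) + y *\<^sub>R apex \<in> ?H"
        using ap y by (intro convexD[OF convex_convex_hull]) auto
      moreover have "(1 - y) *\<^sub>R (x', 0) + y *\<^sub>R apex = p"
        using y1 by (simp add: p apex_def x'_def)
      ultimately show ?thesis by simp
    qed
  qed
qed

lemma tent_degenerate: "tent a a = closed_segment (a, 0) apex"
  unfolding segment_convex_hull using hull_base_apex[of a a] by (simp add: insert_commute)

lemma aff_dim_hseg:
  assumes "a \<le> b"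
  shows "aff_dim (hseg a b) = (if a = b then 0 else 1)"
  unfolding closed_segment_base[OF assms, symmetric] segment_convex_hull aff_dim_convex_hull
  by (simp add: aff_dim_2)

lemma aff_dim_tent:
  assumes "a \<le> b"
  shows "aff_dim (tent a b) = (if a = b then 1 else 2)"
proof -
  have "apex \<notin> affine hull {(a, 0), (b, 0)}"
  proof -
    have "affine hull {(a, 0), (b, 0)} \<subseteq> {p. (0, 1::real) \<bullet> p = 0}"
      by (intro hull_minimal affine_hyperplane) auto
    then show ?thesis by (auto simp: apex_def)
  qed
  then have "aff_dim {apex, (a, 0), (b, 0)} = aff_dim {(a, 0), (b, 0::real)} + 1"
    by (simp add: aff_dim_insert)
  then show ?thesis unfolding hull_base_apex[OF assms, symmetric] aff_dim_convex_hull
    by (simp add: aff_dim_2)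
qed

text \<open>All points of a support except the apex lie on the base line, so a summand of a cell is the apex, a
  piece of the base line or a tent.\<close>
lemma hull_of_support_cases:
  assumes V: "V \<subseteq> suppA B l" "V \<noteq> {}" and fin: "finite (B l)"
  obtains "convex hull V = {apex}"
  | lo hi where "lo \<in> B l" "hi \<in> B l" "lo \<le> hi" "convex hull V = hseg (real lo) (real hi)"
  | lo hi where "lo \<in> B l" "hi \<in> B l" "lo \<le> hi" "convex hull V = tent (real lo) (real hi)"
proof -
  define W where "W = {b \<in> B l. (real b, 0) \<in> V}"
  have finW: "finite W" using fin by (simp add: W_def)
  have VW: "V - {apex} = (\<lambda>b. (real b, 0)) ` W"
    using V by (auto simp: W_def suppA_def apex_def)
  show ?thesis
  proof (cases "W = {}")
    case True
    then have "V = {apex}" using VW V by auto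
    then show ?thesis using that(1) by simp
  next
    case False
    define lo where "lo = Min W"
    define hi where "hi = Max W"
    have lohi: "lo \<in> W" "hi \<in> W" "lo \<le> hi" and rng: "\<And>b. b \<in> W \<Longrightarrow> lo \<le> b \<and> b \<le> hi"
      using finW False by (auto simp: lo_def hi_def)
    then have B: "lo \<in> B l" "hi \<in> B l" by (auto simp: W_def)
    have inV: "(real lo, 0) \<in> V" "(real hi, 0) \<in> V" using lohi by (auto simp: W_def)
    have base: "V - {apex} \<subseteq> hseg (real lo) (real hi)" using rng unfolding VW by (auto simp: hseg_def)
    have le: "real lo \<le> real hi" using lohi by simp
    show ?thesis
    proof (cases "apex \<in> V")
      case True
      have "convex hull V = tent (real lo) (real hi)"
      proof
        have "V - {apex} \<subseteq> tent (real lo) (real hi)" "apex \<in> tent (real lo) (real hi)"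
          using base by (auto simp: hseg_def tent_def apex_def)
        then show "convex hull V \<subseteq> tent (real lo) (real hi)"
          by (intro hull_minimal convex_tent) auto
        show "tent (real lo) (real hi) \<subseteq> convex hull V"
          unfolding hull_base_apex[OF le, symmetric] by (intro hull_mono) (use True inV in auto)
      qed
      then show ?thesis using that(3) B lohi by blast
    next
      case False
      have "convex hull V = hseg (real lo) (real hi)"
      proof
        show "convex hull V \<subseteq> hseg (real lo) (real hi)"
          using base False by (intro hull_minimal convex_hseg) auto
        show "hseg (real lo) (real hi) \<subseteq> convex hull V"
          unfolding closed_segment_base[OF le, symmetric] segment_convex_hull
          by (intro hull_mono) (use inV in auto)
      qed
      then show ?thesis using that(2) B lohi by blast
    qed
  qed
qed

lemma aff_dim_in_line:
  fixes a :: "real \<times> real"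
  assumes "S \<subseteq> {p. a \<bullet> p = d}" "a \<noteq> 0"
  shows "aff_dim S \<noteq> 2"
proof -
  have "aff_dim S \<le> aff_dim {p. a \<bullet> p = d}" using assms(1) by (rule aff_dim_subset)
  also have "\<dots> = 1" using assms(2) by (simp add: aff_dim_hyperplane)
  finally show ?thesis by simp
qed

lemma measure_between_graphs:
  fixes lo hi :: "real \<Rightarrow> real"
  assumes A: "A = {(x, y). s \<le> y \<and> y \<le> t \<and> lo y \<le> x \<and> x \<le> hi y}" and cl: "closed A"
    and le: "\<And>y. s \<le> y \<Longrightarrow> y \<le> t \<Longrightarrow> lo y \<le> hi y"
    and int: "((\<lambda>y. hi y - lo y) has_integral r) {s..t}"
  shows "measure lborel A = r"
proof -
  have Am: "A \<in> sets (lborel \<Otimes>\<^sub>M lborel)" unfolding lborel_prod using cl by (simp add: borel_closed)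
  have sl: "(\<lambda>x. (x, y)) -` A = (if y \<in> {s..t} then {lo y..hi y} else {})" for y by (auto simp: A)
  have em: "emeasure lborel ((\<lambda>x. (x, y)) -` A) = ennreal (if y \<in> {s..t} then hi y - lo y else 0)" for y
    unfolding sl using le[of y] by auto
  have meas: "(\<lambda>y. if y \<in> {s..t} then hi y - lo y else 0) \<in> borel_measurable lborel"
  proof -
    have "(\<lambda>y. emeasure lborel ((\<lambda>x. (x, y)) -` A)) \<in> borel_measurable lborel"
      using Am by (rule lborel_pair.measurable_emeasure_Pair2)
    then have "(\<lambda>y. enn2real (emeasure lborel ((\<lambda>x. (x, y)) -` A))) \<in> borel_measurable lborel"
      by measurable
    moreover have "enn2real (emeasure lborel ((\<lambda>x. (x, y)) -` A)) = (if y \<in> {s..t} then hi y - lo y else 0)" for y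
      unfolding em using le[of y] by auto
    ultimately show ?thesis by (simp cong: measurable_cong)
  qed
  have "emeasure lborel A = emeasure (lborel \<Otimes>\<^sub>M lborel) A" by (simp add: lborel_prod)
  also have "\<dots> = (\<integral>\<^sup>+ y. ennreal (if y \<in> {s..t} then hi y - lo y else 0) \<partial>lborel)"
    using lborel_pair.emeasure_pair_measure_alt2[OF Am] em by simp
  also have "\<dots> = ennreal r"
  proof (rule nn_integral_has_integral_lborel)
    show "(\<lambda>y. if y \<in> {s..t} then hi y - lo y else 0) \<in> borel_measurable borel" using meas by simp
    show "0 \<le> (if y \<in> {s..t} then hi y - lo y else 0)" for y using le[of y] by auto
    show "((\<lambda>y. if y \<in> {s..t} then hi y - lo y else 0) has_integral r) UNIV"
      using int by (subst has_integral_restrict_UNIV)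
  qed
  finally have "emeasure lborel A = ennreal r" .
  moreover have "0 \<le> r" using int by (rule has_integral_nonneg) (use le in auto)
  ultimately show ?thesis by (simp add: measure_def)
qed

section \<open>Cells that meet the strip\<close>
lemma compact_msum:
  assumes "\<And>l. compact (R l)"
  shows "compact (msum R)"
proof -
  have "msum R = (\<Union>p\<in>(\<Union>x\<in>R 0. \<Union>y\<in>R 1. {x + y}). \<Union>z\<in>R 2. {p + z})"
    unfolding msum_def by blast
  then show ?thesis using compact_sums'[OF compact_sums'[OF assms assms] assms] by metis
qed

lemma minkowski_cell_compact_convex:
  assumes "minkowski_cell B R" "\<And>l. finite (B l)"
  shows "compact (R l)" "convex (R l)" "R l \<noteq> {}"
proof -
  obtain V where V: "V \<subseteq> suppA B l" "V \<noteq> {}" "R l = convex hull V"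
    using assms(1) unfolding minkowski_cell_def by blast
  have "finite (suppA B l)" using assms(2)[of l] by (simp add: suppA_def setcompr_eq_image)
  then have "finite V" using V by (rule_tac finite_subset)
  then show "compact (R l)" using V by (simp add: finite_imp_compact_convex_hull)
  show "convex (R l)" "R l \<noteq> {}" using V by auto
qed

text \<open>A state \<open>(k, b, j, c)\<close> stands for the segment from \<open>(b, 2)\<close> to \<open>(b + c, 1)\<close>: at height \<open>2\<close> the summand
  \<open>k\<close> is at the base point \<open>b\<close> and the two others are at the apex; on the way down to height \<open>1\<close> the
  summand \<open>j\<close> slides from the apex to its base point \<open>c\<close>. Inside the strip a cell is bounded by
  two such segments, and the four rules list the possible summands of the cell together with its left
  side, its right side, the index of the apex summand and the area that the cell contributes as a mixed cell of
  this index. In \<open>along_base\<close> the cell is a parallelogram, in \<open>swap\<close> a parallelogram that reaches up to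
  height \<open>3\<close>; the cells of \<open>turn\<close> and \<open>widen\<close> are not mixed cells with an apex summand, so their gain is
  \<open>0\<close>.\<close>
inductive cell_step ::
  "(3 \<Rightarrow> nat set) \<Rightarrow> (3 \<Rightarrow> (real \<times> real) set) \<Rightarrow> 3 \<times> nat \<times> 3 \<times> nat \<Rightarrow> 3 \<times> nat \<times> 3 \<times> nat \<Rightarrow> 3 \<Rightarrow> real \<Rightarrow> bool"
  for B R where
  along_base: "\<lbrakk>i \<noteq> j; j \<noteq> k; i \<noteq> k; b \<in> B k; b' \<in> B k; c \<in> B j; b < b';
     R i = {apex}; R j = tent c c; R k = hseg b b'\<rbrakk>
     \<Longrightarrow> cell_step B R (k, b, j, c) (k, b', j, c) i (real b' - real b)"
| turn: "\<lbrakk>i \<noteq> j; j \<noteq> k; i \<noteq> k; b \<in> B k; c \<in> B j; c' \<in> B i; c < c';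
     R i = tent c' c'; R j = tent c c; R k = hseg b b\<rbrakk>
     \<Longrightarrow> cell_step B R (k, b, j, c) (k, b, i, c') i 0"
| widen: "\<lbrakk>i \<noteq> j; j \<noteq> k; i \<noteq> k; b \<in> B k; c \<in> B j; c' \<in> B j; c < c';
     R i = {apex}; R j = tent c c'; R k = hseg b b\<rbrakk>
     \<Longrightarrow> cell_step B R (k, b, j, c) (k, b, j, c') i 0"
| swap: "\<lbrakk>i \<noteq> j; j \<noteq> k; i \<noteq> k; b \<in> B j; c \<in> B k; b < c;
     R i = {apex}; R j = tent b b; R k = tent c c\<rbrakk>
     \<Longrightarrow> cell_step B R (j, b, k, c) (k, c, j, b) i (real c - real b)"

lemma tent_point: "p \<in> tent c c \<longleftrightarrow> (\<exists>s::real. 0 \<le> s \<and> s \<le> 1 \<and> p = (s * c, 1 - s))"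
proof -
  have "(x, y) \<in> tent c c \<longleftrightarrow> (\<exists>s::real. 0 \<le> s \<and> s \<le> 1 \<and> (x, y) = (s * c, 1 - s))" for x y
    unfolding tent_def by (auto intro!: exI[of _ "1 - y"])
  then show ?thesis by (cases p) blast
qed

lemma Bex_tent_point: "(\<exists>p\<in>tent c c. P p) \<longleftrightarrow> (\<exists>s::real. 0 \<le> s \<and> s \<le> 1 \<and> P (s * c, 1 - s))"
  unfolding Bex_def tent_point by blast

lemma hseg_point: "hseg b b = {(b, 0)}"
  by (auto simp: hseg_def)

lemma cell_step_slice:
  assumes "cell_step B R (k, b, j, c) (k', b', j', c') o' g" "1 \<le> y" "y \<le> 2"
  shows "(x, y) \<in> msum R \<longleftrightarrow> b + (2 - y) * c \<le> x \<and> x \<le> b' + (2 - y) * c'"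
  using assms(1)
proof cases
  case (along_base)
  have "(x, y) \<in> msum R \<longleftrightarrow> (\<exists>(s::real) (t::real). 0 \<le> s \<and> s \<le> 1 \<and> b \<le> t \<and> t \<le> b' \<and> (x, y) = apex + (s * c, 1 - s) + (t, 0))"
    unfolding msum_distinct_iff[OF along_base(5-7)] along_base(12-14) Bex_tent_point
    by (auto simp: hseg_def)
  also have "\<dots> \<longleftrightarrow> b + (2 - y) * c \<le> x \<and> x \<le> b' + (2 - y) * c"
  proof
    assume "b + (2 - y) * c \<le> x \<and> x \<le> b' + (2 - y) * c"
    then show "\<exists>(s::real) (t::real). 0 \<le> s \<and> s \<le> 1 \<and> b \<le> t \<and> t \<le> b' \<and> (x, y) = apex + (s * c, 1 - s) + (t, 0)"
      using assms(2,3) by (intro exI[of _ "2 - y"] exI[of _ "x - (2 - y) * c"]) (auto simp: apex_def)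
  qed (auto simp: apex_def)
  finally show ?thesis using along_base by simp
next
  case (turn)
  have "(x, y) \<in> msum R \<longleftrightarrow> (\<exists>(s::real) (t::real). 0 \<le> s \<and> s \<le> 1 \<and> 0 \<le> t \<and> t \<le> 1 \<and> (x, y) = (s * c', 1 - s) + (t * c, 1 - t) + (b, 0))"
    unfolding msum_distinct_iff[OF turn(5-7)] turn(12-14) Bex_tent_point hseg_point
    by auto
  also have "\<dots> \<longleftrightarrow> b + (2 - y) * c \<le> x \<and> x \<le> b + (2 - y) * c'"
  proof
    assume "\<exists>(s::real) (t::real). 0 \<le> s \<and> s \<le> 1 \<and> 0 \<le> t \<and> t \<le> 1 \<and> (x, y) = (s * c', 1 - s) + (t * c, 1 - t) + (b, 0)"
    then obtain s t :: real where st: "0 \<le> s" "0 \<le> t" "x = s * c' + t * c + b" "2 - y = s + t" by auto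
    have "s * c \<le> s * c'" "t * c \<le> t * c'" using turn st by (auto intro: mult_left_mono)
    then show "b + (2 - y) * c \<le> x \<and> x \<le> b + (2 - y) * c'" unfolding st by (auto simp add: algebra_simps)
  next
    assume x: "b + (2 - y) * c \<le> x \<and> x \<le> b + (2 - y) * c'"
    have cc: "real c' - real c > 0" using turn by simp
    define s where "s = (x - b - (2 - y) * c) / (real c' - real c)"
    have sc: "s * (real c' - real c) = x - b - (2 - y) * c" using cc by (simp add: s_def)
    have s0: "0 \<le> s" using x cc by (simp add: s_def)
    have "s * (real c' - real c) \<le> (2 - y) * (real c' - real c)" unfolding sc using x by (simp add: algebra_simps)
    then have s1: "s \<le> 2 - y" using cc by simp
    show "\<exists>(s::real) (t::real). 0 \<le> s \<and> s \<le> 1 \<and> 0 \<le> t \<and> t \<le> 1 \<and> (x, y) = (s * c', 1 - s) + (t * c, 1 - t) + (b, 0)"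
      using s0 s1 sc assms(2,3) by (intro exI[of _ s] exI[of _ "2 - y - s"]) (auto simp: algebra_simps)
  qed
  finally show ?thesis using turn by simp
next
  case (widen)
  have "(x, y) \<in> msum R \<longleftrightarrow> (\<exists>p\<in>tent c c'. (x, y) = apex + p + (b, 0))"
    unfolding msum_distinct_iff[OF widen(5-7)] widen(12-14) hseg_point by auto
  also have "\<dots> \<longleftrightarrow> (x - b, y - 1) \<in> tent c c'" by (force simp: apex_def)
  also have "\<dots> \<longleftrightarrow> b + (2 - y) * c \<le> x \<and> x \<le> b + (2 - y) * c'"
    using assms(2,3) by (auto simp: tent_def algebra_simps)
  finally show ?thesis using widen by simp
next
  case (swap)
  have "(x, y) \<in> msum R \<longleftrightarrow> (\<exists>(s::real) (t::real). 0 \<le> s \<and> s \<le> 1 \<and> 0 \<le> t \<and> t \<le> 1 \<and> (x, y) = apex + (s * b, 1 - s) + (t * c, 1 - t))"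
    unfolding msum_distinct_iff[OF swap(6-8)] swap(12-14) Bex_tent_point
    by auto
  also have "\<dots> \<longleftrightarrow> b + (2 - y) * c \<le> x \<and> x \<le> c + (2 - y) * b"
  proof
    assume "\<exists>(s::real) (t::real). 0 \<le> s \<and> s \<le> 1 \<and> 0 \<le> t \<and> t \<le> 1 \<and> (x, y) = apex + (s * b, 1 - s) + (t * c, 1 - t)"
    then obtain s t :: real where st: "s \<le> 1" "t \<le> 1" "x = s * b + t * c" "3 - y = s + t" by (auto simp: apex_def)
    have "(1 - s) * b \<le> (1 - s) * c" "(1 - t) * b \<le> (1 - t) * c" using swap st by (auto intro: mult_left_mono)
    moreover have "y = 3 - s - t" using st by simp
    ultimately show "b + (2 - y) * c \<le> x \<and> x \<le> c + (2 - y) * b" unfolding st(3) by (simp only: \<open>y = 3 - s - t\<close>) (simp add: algebra_simps)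
  next
    assume x: "b + (2 - y) * c \<le> x \<and> x \<le> c + (2 - y) * b"
    have cc: "real c - real b > 0" using swap by simp
    define s where "s = ((3 - y) * c - x) / (real c - real b)"
    have sc: "s * (real c - real b) = (3 - y) * c - x" using cc by (simp add: s_def)
    have "s * (real c - real b) \<le> 1 * (real c - real b)" "(2 - y) * (real c - real b) \<le> s * (real c - real b)"
      unfolding sc using x by (simp_all add: algebra_simps)
    then have s1: "s \<le> 1" "2 - y \<le> s" using cc by simp_all
    show "\<exists>(s::real) (t::real). 0 \<le> s \<and> s \<le> 1 \<and> 0 \<le> t \<and> t \<le> 1 \<and> (x, y) = apex + (s * b, 1 - s) + (t * c, 1 - t)"
      using s1 sc assms(2,3) by (intro exI[of _ s] exI[of _ "3 - y - s"]) (auto simp: algebra_simps apex_def)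
  qed
  finally show ?thesis using swap by simp
qed

lemma cell_step_support:
  assumes "cell_step B R (k, b, j, c) (k', b', j', c') o' g"
  shows "k \<noteq> j" "k' \<noteq> j'" "b \<in> B k" "c \<in> B j" "b' \<in> B k'" "c' \<in> B j'"
  using assms by (auto elim!: cell_step.cases)

lemma fun_3_eq_iff:
  fixes i j k :: 3
  assumes "i \<noteq> j" "j \<noteq> k" "i \<noteq> k"
  shows "f = g \<longleftrightarrow> f i = g i \<and> f j = g j \<and> f k = g k"
proof
  assume *: "f i = g i \<and> f j = g j \<and> f k = g k"
  show "f = g"
  proof
    show "f l = g l" for l using distinct_3_cases(1)[OF assms, of l] * by auto
  qed
qed auto

text \<open>The four corners of a cell in the strip are sums of summand points in only one way. This recovers the
  state from the position of a side.\<close>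
lemma cell_step_corner_summands:
  assumes st: "cell_step B R (k, b, j, c) (k', b', j', c') o' g" and f: "\<And>l. f l \<in> R l"
  shows "sum f UNIV = (real b, 2) \<Longrightarrow> f = (\<lambda>_. apex)(k := (real b, 0))"
    and "sum f UNIV = (real b', 2) \<Longrightarrow> f = (\<lambda>_. apex)(k' := (real b', 0))"
    and "sum f UNIV = (real b + real c, 1) \<Longrightarrow> f = (\<lambda>_. apex)(k := (real b, 0), j := (real c, 0))"
    and "sum f UNIV = (real b' + real c', 1) \<Longrightarrow> f = (\<lambda>_. apex)(k' := (real b', 0), j' := (real c', 0))"
proof -
  have "(sum f UNIV = (real b, 2) \<longrightarrow> f = (\<lambda>_. apex)(k := (real b, 0))) \<and>
    (sum f UNIV = (real b', 2) \<longrightarrow> f = (\<lambda>_. apex)(k' := (real b', 0))) \<and>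
    (sum f UNIV = (real b + real c, 1) \<longrightarrow> f = (\<lambda>_. apex)(k := (real b, 0), j := (real c, 0))) \<and>
    (sum f UNIV = (real b' + real c', 1) \<longrightarrow> f = (\<lambda>_. apex)(k' := (real b', 0), j' := (real c', 0)))"
    using st
  proof cases
    case (along_base)
    note S = sum_UNIV_3_distinct[OF along_base(5-7), of f] and F = fun_3_eq_iff[OF along_base(5-7)]
    have f1: "f o' = apex" using f[of o'] along_base by simp
    obtain s :: real where s: "f j = (s * c, 1 - s)" using f[of j] unfolding along_base(13) tent_point by blast
    obtain t where t: "f k = (t, 0)" using f[of k] along_base by (auto simp: hseg_def)
    show ?thesis unfolding S F f1 s t using along_base(1-7) by (auto simp: apex_def)
  next
    case (turn)
    note S = sum_UNIV_3_distinct[OF turn(5-7), of f] and F = fun_3_eq_iff[OF turn(5-7)]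
    have f1: "f k = (b, 0)" using f[of k] turn by (simp add: hseg_point)
    obtain s :: real where s: "0 \<le> s" "s \<le> 1" "f j = (s * c, 1 - s)" using f[of j] unfolding turn(13) tent_point by blast
    obtain t :: real where t: "0 \<le> t" "t \<le> 1" "f j' = (t * c', 1 - t)" using f[of j'] unfolding turn(12) tent_point by blast
    have cc: "real c < real c'" using turn by simp
    have S': "sum f UNIV = (b + t * c' + s * c, 2 - s - t)" using turn unfolding S f1 s t by simp
    have e0: "s = 0 \<and> t = 0" if "sum f UNIV = (real b, 2)" using that s(1) t(1) unfolding S' by simp
    have e1: "s = 1 \<and> t = 0" if "sum f UNIV = (real b + real c, 1)"
    proof -
      have st: "s = 1 - t" and x: "t * c' + s * c = real c" using that unfolding S' by simp_all
      have "t * (real c' - real c) = 0" using x unfolding st by (auto simp add: algebra_simps)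
      then have "t = 0" using cc by (metis eq_iff_diff_eq_0 less_irrefl mult_eq_0_iff)
      then show ?thesis using st by simp
    qed
    have e2: "s = 0 \<and> t = 1" if "sum f UNIV = (real b + real c', 1)"
    proof -
      have st: "t = 1 - s" and x: "t * c' + s * c = real c'" using that unfolding S' by simp_all
      have "s * (real c' - real c) = 0" using x unfolding st by (auto simp add: algebra_simps)
      then have "s = 0" using cc by (metis eq_iff_diff_eq_0 less_irrefl mult_eq_0_iff)
      then show ?thesis using st by simp
    qed
    show ?thesis unfolding F f1 s(3) t(3) using turn(1-7) e0 e1 e2 by (auto simp: apex_def)
  next
    case (widen)
    note S = sum_UNIV_3_distinct[OF widen(5-7), of f] and F = fun_3_eq_iff[OF widen(5-7)]
    have f1: "f k = (b, 0)" "f o' = apex" using f[of k] f[of o'] widen by (simp_all add: hseg_point)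
    obtain x y where fj: "f j = (x, y)" by (cases "f j")
    show ?thesis unfolding F S f1 fj using widen(1-7) by (auto simp: apex_def)
  next
    case (swap)
    note S = sum_UNIV_3_distinct[OF swap(6-8), of f] and F = fun_3_eq_iff[OF swap(6-8)]
    have f1: "f o' = apex" using f[of o'] swap by simp
    obtain s :: real where s: "0 \<le> s" "s \<le> 1" "f k = (s * b, 1 - s)" using f[of k] unfolding swap(13) tent_point by blast
    obtain t :: real where t: "0 \<le> t" "t \<le> 1" "f j = (t * c, 1 - t)" using f[of j] unfolding swap(14) tent_point by blast
    have cc: "real b < real c" using swap by simp
    have S': "sum f UNIV = (s * b + t * c, 3 - s - t)" unfolding S f1 s t by (simp add: apex_def)
    have e0: "s = 1 \<and> t = 0" if "sum f UNIV = (real b, 2)"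
    proof -
      have st: "s = 1 - t" and x: "s * b + t * c = real b" using that unfolding S' by simp_all
      have "t * (real c - real b) = 0" using x unfolding st by (auto simp add: algebra_simps)
      then have "t = 0" using cc by (metis eq_iff_diff_eq_0 less_irrefl mult_eq_0_iff)
      then show ?thesis using st by simp
    qed
    have e1: "s = 0 \<and> t = 1" if "sum f UNIV = (real c, 2)"
    proof -
      have st: "t = 1 - s" and x: "s * b + t * c = real c" using that unfolding S' by simp_all
      have "s * (real c - real b) = 0" using x unfolding st by (auto simp add: algebra_simps)
      then have "s = 0" using cc by (metis eq_iff_diff_eq_0 less_irrefl mult_eq_0_iff)
      then show ?thesis using st by simp
    qed
    have e2: "s = 1 \<and> t = 1" if "sum f UNIV = (z, 1)" for z using that s(2) t(2) unfolding S' by simp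
    show ?thesis unfolding F f1 s(3) t(3) using swap(1-8) e0 e1 e2[of "real b + real c"] by (auto simp: apex_def add.commute)
  qed
  then show "sum f UNIV = (real b, 2) \<Longrightarrow> f = (\<lambda>_. apex)(k := (real b, 0))"
    and "sum f UNIV = (real b', 2) \<Longrightarrow> f = (\<lambda>_. apex)(k' := (real b', 0))"
    and "sum f UNIV = (real b + real c, 1) \<Longrightarrow> f = (\<lambda>_. apex)(k := (real b, 0), j := (real c, 0))"
    and "sum f UNIV = (real b' + real c', 1) \<Longrightarrow> f = (\<lambda>_. apex)(k' := (real b', 0), j' := (real c', 0))"
    by argo+
qed

lemma dimension_patterns:
  fixes d :: "3 \<Rightarrow> int"
  assumes "\<And>l. d l = 0 \<or> d l = 1 \<or> d l = 2" "sum d UNIV = 2"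
  obtains l m n where "l \<noteq> m" "m \<noteq> n" "l \<noteq> n" "d l = 2" "d m = 0" "d n = 0"
  | l m n where "l \<noteq> m" "m \<noteq> n" "l \<noteq> n" "d l = 0" "d m = 1" "d n = 1"
proof -
  have ne: "(0::3) \<noteq> 1" "(1::3) \<noteq> 2" "(0::3) \<noteq> 2" by auto
  have S: "d 0 + d 1 + d 2 = 2" using assms(2) sum_UNIV_3_distinct[OF ne, of d] by simp
  have "(d 0 = 2 \<and> d 1 = 0 \<and> d 2 = 0) \<or> (d 1 = 2 \<and> d 0 = 0 \<and> d 2 = 0) \<or> (d 2 = 2 \<and> d 0 = 0 \<and> d 1 = 0)
    \<or> (d 0 = 0 \<and> d 1 = 1 \<and> d 2 = 1) \<or> (d 1 = 0 \<and> d 0 = 1 \<and> d 2 = 1) \<or> (d 2 = 0 \<and> d 0 = 1 \<and> d 1 = 1)"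
    using assms(1)[of 0] assms(1)[of 1] assms(1)[of 2] by (elim disjE) (use S in simp_all)
  then show ?thesis
  proof (elim disjE conjE)
    assume "d 0 = 2" "d 1 = 0" "d 2 = 0"
    then show ?thesis using that(1)[of 0 1 2] ne by simp
  next
    assume "d 1 = 2" "d 0 = 0" "d 2 = 0"
    then show ?thesis using that(1)[of 1 0 2] ne by simp
  next
    assume "d 2 = 2" "d 0 = 0" "d 1 = 0"
    then show ?thesis using that(1)[of 2 0 1] ne by simp
  next
    assume "d 0 = 0" "d 1 = 1" "d 2 = 1"
    then show ?thesis using that(2)[of 0 1 2] ne by simp
  next
    assume "d 1 = 0" "d 0 = 1" "d 2 = 1"
    then show ?thesis using that(2)[of 1 0 2] ne by simp
  next
    assume "d 2 = 0" "d 0 = 1" "d 1 = 1"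
    then show ?thesis using that(2)[of 2 0 1] ne by simp
  qed
qed

lemma summand_kinds:
  assumes "minkowski_cell B R" "finite (B l)"
  obtains "R l = {apex}" "aff_dim (R l) = 0"
  | b where "b \<in> B l" "R l = hseg b b" "aff_dim (R l) = 0"
  | lo hi where "lo \<in> B l" "hi \<in> B l" "lo < hi" "R l = hseg lo hi" "aff_dim (R l) = 1"
  | c where "c \<in> B l" "R l = tent c c" "aff_dim (R l) = 1"
  | lo hi where "lo \<in> B l" "hi \<in> B l" "lo < hi" "R l = tent lo hi" "aff_dim (R l) = 2"
proof -
  obtain V where V: "V \<subseteq> suppA B l" "V \<noteq> {}" "R l = convex hull V"
    using assms(1) unfolding minkowski_cell_def by blast
  from V(1,2) assms(2) show ?thesis
  proof (cases rule: hull_of_support_cases)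
    case 1
    then show ?thesis using that(1) V by simp
  next
    case (2 lo hi)
    then show ?thesis using that(2)[of lo] that(3)[of lo hi] V aff_dim_hseg[of lo hi] by (cases "lo = hi") auto
  next
    case (3 lo hi)
    then show ?thesis using that(4)[of lo] that(5)[of lo hi] V aff_dim_tent[of lo hi] by (cases "lo = hi") auto
  qed
qed

text \<open>Rules out \<open>b = c\<close> in the rule \<open>swap\<close>.\<close>
lemma parallel_slants_degenerate:
  assumes "i \<noteq> j" "j \<noteq> k" "i \<noteq> k" "R i = {z}" "R j = tent c c" "R k = tent c c"
  shows "aff_dim (msum R) \<noteq> 2"
proof (rule aff_dim_in_line)
  have "(1, c) \<bullet> p = 2 * c + (1, c) \<bullet> z" if p: "p \<in> msum R" for p
  proof -
    obtain s t where "p = z + (s * c, 1 - s) + (t * c, 1 - t)"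
      using p unfolding msum_distinct_iff[OF assms(1-3)] assms(4-6) Bex_tent_point by blast
    moreover have "(1, c) \<bullet> (s * c, 1 - s) = c" for s by (simp add: algebra_simps)
    ultimately show ?thesis by (simp add: inner_add_right)
  qed
  then show "msum R \<subseteq> {p. (1, c) \<bullet> p = 2 * c + (1, c) \<bullet> z}" by blast
  show "((1::real), c) \<noteq> 0" by (simp add: zero_prod_def)
qed

lemma snd_hseg: "p \<in> hseg a b \<Longrightarrow> snd p = 0" by (auto simp: hseg_def)
lemma snd_tent: "p \<in> tent a b \<Longrightarrow> 0 \<le> snd p \<and> snd p \<le> 1" by (auto simp: tent_def)
lemma snd_apex: "snd apex = 1" by (simp add: apex_def)

text \<open>In a tight cell one summand has dimension \<open>2\<close> and the others are points, or two summands are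
  segments and the third is a point. A point of the strip has height strictly between \<open>1\<close> and \<open>2\<close>; this
  limits the number of summands that are the apex or stay on the base line, and only the four rules remain.\<close>
lemma strip_cell_is_step:
  assumes cell: "minkowski_cell B R" "tight_cell R" and fin: "\<And>l. finite (B l)"
    and p: "(x, y) \<in> msum R" "1 < y" "y < 2"
  obtains k b j c k' b' j' c' i g where "cell_step B R (k, b, j, c) (k', b', j', c') i g"
proof -
  note result = that
  have full: "aff_dim (msum R) = 2" using cell unfolding minkowski_cell_def by simp
  have dims: "aff_dim (R l) = 0 \<or> aff_dim (R l) = 1 \<or> aff_dim (R l) = 2" for l
    using cell(1) fin[of l] by (cases rule: summand_kinds) auto
  have tot: "(\<Sum>l\<in>UNIV. aff_dim (R l)) = 2" using cell(2) by (simp add: tight_cell_def)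
  obtain f where f: "\<And>l. f l \<in> R l" "(x, y) = sum f UNIV" using msum_memE[OF p(1)] by blast
  have fy: "snd (f l) + snd (f m) + snd (f n) = y" if "l \<noteq> m" "m \<noteq> n" "l \<noteq> n" for l m n
    using f(2) sum_UNIV_3_distinct[OF that, of f] by (metis snd_add snd_conv)
  from dims tot show ?thesis
  proof (cases rule: dimension_patterns)
    case (1 l m n)
    note h = fy[OF 1(1-3)]
    have kind0: "R q = {apex} \<or> (\<exists>b\<in>B q. R q = hseg b b)" if "aff_dim (R q) = 0" for q
      using cell(1) fin[of q] by (cases rule: summand_kinds) (use that in auto)
    obtain lo hi where l: "lo \<in> B l" "hi \<in> B l" "lo < hi" "R l = tent lo hi"
      using cell(1) fin[of l] by (cases rule: summand_kinds) (use 1 in auto)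
    have hl: "0 \<le> snd (f l)" "snd (f l) \<le> 1" using f(1)[of l] snd_tent unfolding l by blast+
    from kind0[OF 1(5)] kind0[OF 1(6)] consider "R m = {apex}" "R n = {apex}" 
      | b where "R m = {apex}" "b \<in> B n" "R n = hseg b b"
      | b where "R n = {apex}" "b \<in> B m" "R m = hseg b b"
      | b b' where "R m = hseg b b" "R n = hseg b' b'" by metis
    then show ?thesis
    proof cases
      case q: 1
      then have "f m = apex" "f n = apex" using f(1)[of m] f(1)[of n] by auto
      then show ?thesis using h hl p by (simp add: snd_apex)
    next
      case q: 2
      show ?thesis by (rule result, rule widen[of m l n]) (use q l 1 in auto)
    next
      case q: 3
      show ?thesis by (rule result, rule widen[of n l m]) (use q l 1 in auto)
    next
      case q: 4
      then have "snd (f m) = 0" "snd (f n) = 0" using f(1)[of m] f(1)[of n] snd_hseg by auto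
      then show ?thesis using h hl p by simp
    qed
  next
    case (2 l m n)
    note h = fy[OF 2(1-3)]
    have kind1: "(\<exists>lo\<in>B q. \<exists>hi\<in>B q. lo < hi \<and> R q = hseg lo hi) \<or> (\<exists>c\<in>B q. R q = tent c c)" if "aff_dim (R q) = 1" for q
      using cell(1) fin[of q] by (cases rule: summand_kinds) (use that in auto)
    have kind0: "R l = {apex} \<or> (\<exists>b\<in>B l. R l = hseg b b)"
      using cell(1) fin[of l] by (cases rule: summand_kinds) (use 2 in auto)
    have kind0': "R l = {apex} \<or> snd (f l) = 0" using kind0 f(1)[of l] snd_hseg by metis
    have base_slant: thesis
      if e: "l \<noteq> m" "m \<noteq> n" "l \<noteq> n" and lo: "lo \<in> B m" "hi \<in> B m" "lo < hi" and m: "R m = hseg lo hi"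
        and c: "c \<in> B n" and n: "R n = tent c c" for m n lo hi c
    proof -
      have "snd (f m) = 0" "snd (f n) \<le> 1"
        using f(1)[of m, unfolded m] f(1)[of n, unfolded n] by (auto dest: snd_hseg snd_tent)
      then have "snd (f l) \<noteq> 0" using fy[OF e] p by auto
      then have "R l = {apex}" using kind0' by blast
      then show thesis by (intro result, rule_tac along_base[of l n m]) (use lo m c n e in auto)
    qed
    show ?thesis
    proof (cases "\<exists>lo\<in>B m. \<exists>hi\<in>B m. lo < hi \<and> R m = hseg lo hi")
      case True
      then obtain lo hi where m: "lo \<in> B m" "hi \<in> B m" "lo < hi" "R m = hseg (real lo) (real hi)" by auto
      show ?thesis
      proof (cases "\<exists>lo\<in>B n. \<exists>hi\<in>B n. lo < hi \<and> R n = hseg lo hi")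
        case True
        then obtain lo' hi' where n: "R n = hseg (real lo') (real hi')" by blast
        have "snd (f m) = 0" "snd (f n) = 0"
          using f(1)[of m, unfolded m] f(1)[of n, unfolded n] by (auto dest: snd_hseg)
        moreover have "snd (f l) = 1 \<or> snd (f l) = 0" using kind0' f(1)[of l] snd_apex by auto
        ultimately show ?thesis using h p by auto
      next
        case False
        then obtain c where "c \<in> B n" "R n = tent c c" using kind1[OF 2(6)] by blast
        then show ?thesis using base_slant[OF 2(1-3) m] by blast
      qed
    next
      case False
      then obtain c where m: "c \<in> B m" "R m = tent c c" using kind1[OF 2(5)] by blast
      show ?thesis
      proof (cases "\<exists>lo\<in>B n. \<exists>hi\<in>B n. lo < hi \<and> R n = hseg lo hi")
        case True
        then obtain lo hi where n: "lo \<in> B n" "hi \<in> B n" "lo < hi" "R n = hseg (real lo) (real hi)" by auto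
        show ?thesis using base_slant[OF 2(3) 2(2)[symmetric] 2(1) n m] .
      next
        case False
        then obtain c' where n: "c' \<in> B n" "R n = tent c' c'" using kind1[OF 2(6)] by blast
        note q = m n
        have "\<exists>z. R l = {z}" using kind0 unfolding hseg_point by blast
        then obtain z where z: "R l = {z}" ..
      have "c \<noteq> c'" using parallel_slants_degenerate[of l m n R z, OF 2(1-3) z] q full by auto
      from kind0 show ?thesis
      proof
        assume a: "R l = {apex}"
        show ?thesis
        proof (cases "c < c'")
          case True
          show ?thesis by (rule result, rule swap[of l m n]) (use q 2 a True in auto)
        next
          case False
          show ?thesis by (rule result, rule swap[of l n m]) (use q 2 a False \<open>c \<noteq> c'\<close> in auto)
        qed
      next
        assume "\<exists>b\<in>B l. R l = hseg b b"
        then obtain b where a: "b \<in> B l" "R l = hseg b b" by blast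
        show ?thesis
        proof (cases "c < c'")
          case True
          show ?thesis by (rule result, rule turn[of n m l]) (use q 2 a True in auto)
        next
          case False
          show ?thesis by (rule result, rule turn[of m n l]) (use q 2 a False \<open>c \<noteq> c'\<close> in auto)
        qed
      qed
      qed
    qed
  qed
qed

text \<open>The apex summand has height \<open>1\<close>, and the two edges can be given heights with sum \<open>1/2\<close> unless both
  lie on the base line, in which case the cell would be flat.\<close>
lemma mixed_cell_meets_strip:
  assumes mc: "mixed_cell B o' R" and full: "aff_dim (msum R) = 2"
  obtains x where "(x, 3/2) \<in> msum R"
proof -
  obtain j k where d: "o' \<noteq> j" "j \<noteq> k" "o' \<noteq> k" 
  proof -
    obtain j where "o' \<noteq> j" by (metis zero_neq_one)
    then show ?thesis using third_index_exists[of o' j] that by metis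
  qed
  have ap: "R o' = {apex}" using mc by (simp add: mixed_cell_def)
  have kind: "(\<exists>b. (b, 0) \<in> R l) \<and> ((\<forall>p\<in>R l. snd p = 0) \<or> (\<exists>b. (b, 1/2) \<in> R l))" 
    if lo': "l \<noteq> o'" for l
  proof -
    obtain p q where pq: "p \<in> suppA B l" "q \<in> suppA B l" "p \<noteq> q" "R l = closed_segment p q"
      using mc lo' unfolding mixed_cell_def by blast
    have ends: "p \<in> R l" "q \<in> R l" unfolding pq by auto
    have mid: "(1/2) *\<^sub>R p + (1/2) *\<^sub>R q \<in> R l" unfolding pq closed_segment_def by (rule CollectI, rule exI[of _ "1/2"]) simp
    show ?thesis
    proof (cases "p = apex \<or> q = apex")
      case True
      then obtain b where "{p, q} = {apex, (b, 0)}" using pq by (auto simp: suppA_def)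
      then have "(b, 0) \<in> R l" "apex \<in> R l" "(1/2) *\<^sub>R apex + (1/2) *\<^sub>R (b, 0) \<in> R l"
        using ends mid by (auto simp: doubleton_eq_iff add.commute)
      then show ?thesis by (auto simp: apex_def)
    next
      case False
      then obtain a b where ab: "p = (real a, 0)" "q = (real b, 0)" using pq by (auto simp: suppA_def)
      have "\<forall>p\<in>R l. snd p = 0" unfolding pq ab closed_segment_def by auto
      then show ?thesis using ends ab by auto
    qed
  qed
  have "\<exists>x. (x, 3/2) \<in> msum R"
  proof (cases "(\<forall>p\<in>R j. snd p = 0) \<and> (\<forall>p\<in>R k. snd p = 0)")
    case True
    have "snd p = 1" if p: "p \<in> msum R" for p
    proof -
      obtain y z where "p = apex + y + z" "y \<in> R j" "z \<in> R k"
        using p unfolding msum_distinct_iff[OF d] ap by blast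
      then show ?thesis using True by (auto simp: snd_apex)
    qed
    then have "msum R \<subseteq> {p. (0, 1) \<bullet> p = 1}" by (auto simp: inner_prod_def)
    then have "aff_dim (msum R) \<noteq> 2" by (rule aff_dim_in_line) (simp add: zero_prod_def)
    then show ?thesis using full by simp
  next
    case False
    have *: "\<exists>x. (x, 3/2) \<in> msum R" if e: "o' \<noteq> j" "j \<noteq> k" "o' \<noteq> k" and nj: "\<not> (\<forall>p\<in>R j. snd p = 0)" for j k
    proof -
      obtain b where b: "(b, 1/2) \<in> R j" using kind[OF e(1)[symmetric]] nj by blast
      obtain b' where b': "(b', 0) \<in> R k" using kind[OF e(3)[symmetric]] by blast
      have "apex + (b, 1/2) + (b', 0) \<in> msum R" unfolding msum_distinct_iff[OF e] using ap b b' by blast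
      then show ?thesis by (auto simp: apex_def)
    qed
    show ?thesis using False *[OF d] *[of k j] d by auto
  qed
  then show ?thesis using that by blast
qed

section \<open>Areas of mixed cells\<close>
lemma hat_integral: "((\<lambda>y. w * (1 - \<bar>y - 2\<bar>)) has_integral w) {1..3::real}"
proof -
  have "((\<lambda>y. w * (1 - \<bar>y - 2\<bar>)) has_integral (w * ((2 - 1)^2 / 2) - w * ((1 - 1)^2 / 2))) {1..2::real}"
    by (rule fundamental_theorem_of_calculus)
      (auto intro!: derivative_eq_intros simp: has_real_derivative_iff_has_vector_derivative[symmetric] field_simps)
  moreover have "((\<lambda>y. w * (1 - \<bar>y - 2\<bar>)) has_integral (w * (- ((3 - 3)^2) / 2) - w * (- ((3 - 2)^2) / 2))) {2..3::real}"
    by (rule fundamental_theorem_of_calculus)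
      (auto intro!: derivative_eq_intros simp: has_real_derivative_iff_has_vector_derivative[symmetric] field_simps)
  ultimately have "((\<lambda>y. w * (1 - \<bar>y - 2\<bar>)) has_integral ((w * ((2 - 1)^2 / 2) - w * ((1 - 1)^2 / 2)) + (w * (- ((3 - 3)^2) / 2) - w * (- ((3 - 2)^2) / 2)))) {1..3::real}"
    by (rule has_integral_combine[rotated 2]) auto
  then show ?thesis by simp
qed

lemma measure_along_base:
  assumes d: "i \<noteq> j" "j \<noteq> k" "i \<noteq> k" and le: "(b::real) \<le> b'"
    and R: "R i = {apex}" "R j = tent c c" "R k = hseg b b'" and cl: "closed (msum R)"
  shows "measure lborel (msum R) = b' - b"
proof (rule measure_between_graphs[OF _ cl])
  show "msum R = {(x, y). 1 \<le> y \<and> y \<le> 2 \<and> b + (2 - y) * c \<le> x \<and> x \<le> b' + (2 - y) * c}" (is "_ = ?A")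
  proof (intro set_eqI, unfold split_paired_all)
    fix x y
    have "(x, y) \<in> msum R \<longleftrightarrow> (\<exists>(s::real) (t::real). 0 \<le> s \<and> s \<le> 1 \<and> b \<le> t \<and> t \<le> b' \<and> (x, y) = apex + (s * c, 1 - s) + (t, 0))"
      unfolding msum_distinct_iff[OF d] R Bex_tent_point
      by (auto simp: hseg_def)
    also have "\<dots> \<longleftrightarrow> (x, y) \<in> ?A"
    proof
      assume "(x, y) \<in> ?A"
      then show "\<exists>(s::real) (t::real). 0 \<le> s \<and> s \<le> 1 \<and> b \<le> t \<and> t \<le> b' \<and> (x, y) = apex + (s * c, 1 - s) + (t, 0)"
        by (intro exI[of _ "2 - y"] exI[of _ "x - (2 - y) * c"]) (auto simp: apex_def)
    qed (auto simp: apex_def)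
    finally show "(x, y) \<in> msum R \<longleftrightarrow> (x, y) \<in> ?A" .
  qed
  show "((\<lambda>y. b' + (2 - y) * c - (b + (2 - y) * c)) has_integral b' - b) {1..2}"
    using has_integral_const_real[of "b' - b" 1 2] by simp
qed (use le in auto)

text \<open>The horizontal sections of this parallelogram grow linearly from height \<open>1\<close> to height \<open>2\<close> and shrink
  again up to height \<open>3\<close>.\<close>
lemma measure_swap:
  assumes d: "i \<noteq> j" "j \<noteq> k" "i \<noteq> k" and lt: "(b::real) < c"
    and R: "R i = {apex}" "R j = tent b b" "R k = tent c c" and cl: "closed (msum R)"
  shows "measure lborel (msum R) = c - b"
proof (rule measure_between_graphs[OF _ cl])
  let ?lo = "\<lambda>y. if y \<le> 2 then b + (2 - y) * c else (3 - y) * b"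
  let ?hi = "\<lambda>y. if y \<le> 2 then c + (2 - y) * b else (3 - y) * c"
  show "msum R = {(x, y). 1 \<le> y \<and> y \<le> 3 \<and> ?lo y \<le> x \<and> x \<le> ?hi y}" (is "_ = ?A")
  proof (intro set_eqI, unfold split_paired_all)
    fix x y
    have "(x, y) \<in> msum R \<longleftrightarrow> (\<exists>(s::real) (t::real). 0 \<le> s \<and> s \<le> 1 \<and> 0 \<le> t \<and> t \<le> 1 \<and> (x, y) = apex + (s * b, 1 - s) + (t * c, 1 - t))"
      unfolding msum_distinct_iff[OF d] R Bex_tent_point by auto
    also have "\<dots> \<longleftrightarrow> (x, y) \<in> ?A"
    proof
      assume "\<exists>(s::real) (t::real). 0 \<le> s \<and> s \<le> 1 \<and> 0 \<le> t \<and> t \<le> 1 \<and> (x, y) = apex + (s * b, 1 - s) + (t * c, 1 - t)"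
      then obtain s t :: real where st: "0 \<le> s" "s \<le> 1" "0 \<le> t" "t \<le> 1" "x = s * b + t * c" and y: "y = 3 - s - t"
        by (auto simp: apex_def)
      have "(1 - s) * b \<le> (1 - s) * c" "(1 - t) * b \<le> (1 - t) * c" "s * b \<le> s * c" "t * b \<le> t * c" 
        using lt st by (auto intro: mult_left_mono)
      then show "(x, y) \<in> ?A" using st(1-4) unfolding y st(5) by (auto simp: algebra_simps)
    next
      assume A: "(x, y) \<in> ?A"
      have cc: "c - b > 0" using lt by simp
      define s where "s = ((3 - y) * c - x) / (c - b)"
      have sc: "s * (c - b) = (3 - y) * c - x" using cc by (simp add: s_def)
      have "s * (c - b) \<le> 1 * (c - b) \<and> (2 - y) * (c - b) \<le> s * (c - b) \<and> 0 * (c - b) \<le> s * (c - b) \<and> s * (c - b) \<le> (3 - y) * (c - b)"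
      proof (cases "y \<le> 2")
        case True
        have "0 \<le> (2 - y) * (c - b)" "0 \<le> (y - 1) * (c - b)" "0 \<le> (3 - y) * (c - b)" using True A cc by auto
        then show ?thesis using True A unfolding sc by (auto simp add: algebra_simps)
      next
        case False
        have "0 \<le> (y - 2) * (c - b)" "0 \<le> (3 - y) * (c - b)" using False A cc by auto
        then show ?thesis using False A unfolding sc by (auto simp add: algebra_simps)
      qed
      then have s1: "s \<le> 1" "2 - y \<le> s" "0 \<le> s" "s \<le> 3 - y" using cc by (metis mult_le_cancel_right_pos)+
      show "\<exists>(s::real) (t::real). 0 \<le> s \<and> s \<le> 1 \<and> 0 \<le> t \<and> t \<le> 1 \<and> (x, y) = apex + (s * b, 1 - s) + (t * c, 1 - t)"
        using s1 sc by (intro exI[of _ s] exI[of _ "3 - y - s"]) (auto simp: algebra_simps apex_def)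
    qed
    finally show "(x, y) \<in> msum R \<longleftrightarrow> (x, y) \<in> ?A" .
  qed
  have hat: "?hi y - ?lo y = (c - b) * (1 - \<bar>y - 2\<bar>)" for y by (simp add: algebra_simps)
  show "((\<lambda>y. ?hi y - ?lo y) has_integral c - b) {1..3}"
    unfolding hat by (rule hat_integral)
  fix y :: real assume "1 \<le> y" "y \<le> 3"
  then have "0 \<le> (c - b) * (1 - \<bar>y - 2\<bar>)" using lt by (intro mult_nonneg_nonneg) auto
  then show "?lo y \<le> ?hi y" using hat[of y] by linarith
qed

lemma tent_ne_apex: "tent a b \<noteq> {apex}" if "a \<le> b"
proof -
  have "(a, 0) \<in> tent a b" "(a, 0) \<noteq> apex" using that by (auto simp: tent_def apex_def)
  then show ?thesis by blast
qed

lemma hseg_ne_apex: "hseg a b \<noteq> {apex}"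
proof -
  have "apex \<notin> hseg a b" by (simp add: hseg_def apex_def)
  then show ?thesis by blast
qed

lemma cell_step_mixed_area:
  assumes st: "cell_step B R st st' i g" and mink: "minkowski_cell B R" and fin: "\<And>l. finite (B l)"
  shows "(if mixed_cell B o' R then measure lborel (msum R) else 0) = (if o' = i then g else 0)"
proof -
  have cl: "closed (msum R)"
    using compact_imp_closed[OF compact_msum[OF minkowski_cell_compact_convex(1)[OF mink fin]]] .
  have seg: "\<exists>p\<in>suppA B l. \<exists>q\<in>suppA B l. p \<noteq> q \<and> tent c c = closed_segment p q" if "c \<in> B l" for c :: nat and l
    using that by (intro bexI[of _ "(real c, 0)"] bexI[of _ apex]) (auto simp: suppA_def tent_degenerate apex_def)
  have segh: "\<exists>p\<in>suppA B l. \<exists>q\<in>suppA B l. p \<noteq> q \<and> hseg b b' = closed_segment p q" if "b \<in> B l" "b' \<in> B l" "b < b'" for b b' :: nat and l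
    using that closed_segment_base[of b b'] by (intro bexI[of _ "(real b, 0)"] bexI[of _ "(real b', 0)"]) (auto simp: suppA_def)
  have ntri: "tent c c' \<noteq> closed_segment p q" if "c < c'" for c c' p q
  proof -
    have "aff_dim (tent c c') = 2" using that by (simp add: aff_dim_tent)
    moreover have "aff_dim (closed_segment p q) \<le> 1" unfolding segment_convex_hull aff_dim_convex_hull by (simp add: aff_dim_2)
    ultimately show ?thesis by auto
  qed
  have segments: "\<forall>l. l \<noteq> i \<longrightarrow> P l" if "i \<noteq> j" "j \<noteq> k" "i \<noteq> k" "P j" "P k" for i j k and P :: "3 \<Rightarrow> bool"
    using distinct_3_cases(1)[OF that(1-3)] that(4,5) by metis
  show ?thesis using st
  proof cases
    case (along_base j k b b' c)
    have M: "mixed_cell B o' R \<longleftrightarrow> o' = i"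
    proof
      assume "mixed_cell B o' R"
      then have "R o' = {apex}" by (simp add: mixed_cell_def)
      moreover have "R j \<noteq> {apex}" "R k \<noteq> {apex}" using along_base by (simp_all add: tent_ne_apex hseg_ne_apex)
      ultimately show "o' = i" using distinct_3_cases(1)[OF along_base(4-6), of o'] by metis
    next
      assume "o' = i"
      then have o: "o' = i" .
      have "\<forall>l. l \<noteq> i \<longrightarrow> (\<exists>p\<in>suppA B l. \<exists>q\<in>suppA B l. p \<noteq> q \<and> R l = closed_segment p q)"
        by (rule segments[OF along_base(4-6)]) (unfold along_base(12,13), rule seg[OF along_base(9)], rule segh[OF along_base(7,8,10)])
      then show "mixed_cell B o' R" unfolding mixed_cell_def o using along_base by blast
    qed
    have "measure lborel (msum R) = real b' - real b"
      by (rule measure_along_base[OF along_base(4-6)]) (use along_base cl in auto)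
    then show ?thesis using M along_base by simp
  next
    case (turn j k b c c')
    have "R i \<noteq> {apex}" "R j \<noteq> {apex}" "R k \<noteq> {apex}"
      unfolding turn(11-13) by (simp_all add: tent_ne_apex hseg_ne_apex)
    then have "R o' \<noteq> {apex}" using distinct_3_cases(1)[OF turn(4-6), of o'] by metis
    then show ?thesis using turn by (simp add: mixed_cell_def)
  next
    case (widen j k b c c')
    have "\<not> mixed_cell B o' R"
    proof
      assume m: "mixed_cell B o' R"
      then have "R o' = {apex}" by (simp add: mixed_cell_def)
      moreover have "R j \<noteq> {apex}" unfolding widen(12) using widen(10) by (simp add: tent_ne_apex)
      ultimately have "o' \<noteq> j" by metis
      then obtain p q where "R j = closed_segment p q" using m unfolding mixed_cell_def by metis
      then show False using ntri[of c c' p q] unfolding widen(12) using widen(10) by simp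
    qed
    then show ?thesis using widen by simp
  next
    case (swap j k b c)
    have M: "mixed_cell B o' R \<longleftrightarrow> o' = i"
    proof
      assume "mixed_cell B o' R"
      then have "R o' = {apex}" by (simp add: mixed_cell_def)
      moreover have "R j \<noteq> {apex}" "R k \<noteq> {apex}" using swap by (simp_all add: tent_ne_apex)
      ultimately show "o' = i" using distinct_3_cases(1)[OF swap(4-6), of o'] by metis
    next
      assume "o' = i"
      then have o: "o' = i" .
      have "\<forall>l. l \<noteq> i \<longrightarrow> (\<exists>p\<in>suppA B l. \<exists>q\<in>suppA B l. p \<noteq> q \<and> R l = closed_segment p q)"
        by (rule segments[OF swap(4-6)]) (unfold swap(11,12), rule seg[OF swap(7)], rule seg[OF swap(8)])
      then show "mixed_cell B o' R" unfolding mixed_cell_def o using swap by blast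
    qed
    have "measure lborel (msum R) = real c - real b"
      by (rule measure_swap[OF swap(4-6)]) (use swap cl in auto)
    then show ?thesis using M swap by simp
  qed
qed

section \<open>The path through the strip\<close>
definition side_at :: "3 \<times> nat \<times> 3 \<times> nat \<Rightarrow> real \<Rightarrow> real" where
  "side_at s y = (case s of (k, b, j, c) \<Rightarrow> real b + (2 - y) * real c)"

lemma side_at_simp [simp]: "side_at (k, b, j, c) y = real b + (2 - y) * real c"
  by (simp add: side_at_def)

lemma cell_step_side_slice:
  assumes "cell_step B R s s' i g" "1 \<le> y" "y \<le> 2"
  shows "(x, y) \<in> msum R \<longleftrightarrow> side_at s y \<le> x \<and> x \<le> side_at s' y"
  using assms cell_step_slice by (cases s; cases s') auto

lemma cell_step_side_less:
  assumes "cell_step B R s s' i g" "1 < y" "y < 2"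
  shows "side_at s y < side_at s' y"
  using assms(1)
proof cases
  case (swap j k b c)
  have "(y - 1) * b < (y - 1) * c" using swap assms by simp
  then show ?thesis using swap by (simp add: algebra_simps)
qed (use assms in auto)

lemma cell_step_side_le:
  assumes "cell_step B R s s' i g" "1 \<le> y" "y \<le> 2"
  shows "side_at s y \<le> side_at s' y"
  using assms(1)
proof cases
  case (swap j k b c)
  have "(y - 1) * b \<le> (y - 1) * c" using swap assms by (simp add: mult_left_mono)
  then show ?thesis using swap by (simp add: algebra_simps)
qed (use assms in \<open>auto simp: mult_left_mono\<close>)

lemma cell_step_interior:
  assumes st: "cell_step B R s s' i g" and y: "1 < y" "y < 2" and x: "side_at s y < x" "x < side_at s' y"
  shows "(x, y) \<in> interior (msum R)"
proof (rule interiorI)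
  let ?U = "{p::real \<times> real. 1 < snd p} \<inter> {p. snd p < 2} \<inter> {p. side_at s (snd p) < fst p} \<inter> {p. fst p < side_at s' (snd p)}"
  have "continuous_on UNIV (\<lambda>p::real \<times> real. side_at t (snd p))" for t
    unfolding side_at_def by (cases t) (auto intro!: continuous_intros)
  then show "open ?U" by (intro open_Int open_Collect_less continuous_intros) auto
  show "(x, y) \<in> ?U" using x y by auto
  show "?U \<subseteq> msum R" using cell_step_side_slice[OF st] by auto
qed

lemma bigC_point:
  assumes "\<And>l. f l \<in> suppA B l"
  shows "sum f UNIV \<in> bigC B"
  unfolding bigC_def using assms by (intro msum_memI[of f]) (simp_all add: hull_inc)

lemma convex_bigC: "convex (bigC B)"
  unfolding bigC_def by (rule convex_msum) (rule convex_convex_hull)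

lemma sum_two_apexes:
  assumes "b \<in> B k"
  shows "(real b, 2) \<in> bigC B"
proof -
  obtain j :: 3 where "j \<noteq> k" by (metis zero_neq_one)
  then obtain i where d: "i \<noteq> j" "j \<noteq> k" "i \<noteq> k" using third_index_exists by metis
  let ?f = "(\<lambda>_. apex)(k := (real b, 0))"
  have "sum ?f UNIV \<in> bigC B" by (rule bigC_point) (use assms in \<open>auto simp: suppA_def\<close>)
  moreover have "sum ?f UNIV = (real b, 2)" unfolding sum_UNIV_3_distinct[OF d] using d by (simp add: apex_def)
  ultimately show ?thesis by metis
qed

lemma sum_one_apex:
  assumes "b \<in> B k" "c \<in> B j" "j \<noteq> k"
  shows "(real b + real c, 1) \<in> bigC B"
proof -
  obtain i where d: "i \<noteq> j" "j \<noteq> k" "i \<noteq> k" using third_index_exists[OF assms(3)] by metis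
  let ?f = "(\<lambda>_. apex)(k := (real b, 0), j := (real c, 0))"
  have "sum ?f UNIV \<in> bigC B" by (rule bigC_point) (use assms in \<open>auto simp: suppA_def\<close>)
  moreover have "sum ?f UNIV = (real b + real c, 1)" unfolding sum_UNIV_3_distinct[OF d] using d by (simp add: apex_def)
  ultimately show ?thesis by metis
qed

text \<open>A point of \<open>C\<close> in the middle of the strip, obtained from points at its lower and at its
  upper boundary.\<close>
lemma convex_three_points:
  fixes C :: "(real \<times> real) set"
  assumes "convex C" "(a, 2) \<in> C" "(b, 2) \<in> C" "(d, 1) \<in> C"
  shows "(a / 4 + b / 4 + d / 2, 3/2) \<in> C"
proof -
  have "(1/2) *\<^sub>R (a, 2) + (1/2) *\<^sub>R (b, 2) \<in> C" using assms by (intro convexD) auto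
  then have "(1/2) *\<^sub>R ((1/2) *\<^sub>R (a, 2) + (1/2) *\<^sub>R (b, 2)) + (1/2) *\<^sub>R (d, 1) \<in> C"
    using assms by (intro convexD) auto
  then show ?thesis by (simp add: algebra_simps)
qed

text \<open>The right side of one cell and the left side of the next one may be the same segment without being the
  same state, for instance when the same number belongs to two supports. The compatibility of the Minkowski
  sum descriptions excludes this: the end points of the segment lie in the intersection of the cells, so
  they are sums of points in the intersections of the summands.\<close>
lemma cells_share_side:
  assumes st: "cell_step B R s s' i g" "cell_step B R' t t' i' g'" and inter: "intersect_properly R R'"
    and eq: "\<And>y. side_at s' y = side_at t y"
  shows "s' = t"
proof -
  obtain k b j c where s: "s = (k, b, j, c)" by (cases s)
  obtain k1 b1 j1 c1 where s': "s' = (k1, b1, j1, c1)" by (cases s')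
  obtain k2 b2 j2 c2 where t: "t = (k2, b2, j2, c2)" by (cases t)
  obtain k' b' j' c' where t': "t' = (k', b', j', c')" by (cases t')
  note st1 = st(1)[unfolded s s'] and st2 = st(2)[unfolded t t']
  have b: "b1 = b2" using eq[of 2] by (simp add: s' t)
  have c: "c1 = c2" using eq[of 1] b by (simp add: s' t)
  have kj: "k1 \<noteq> j1" "k2 \<noteq> j2" using cell_step_support[OF st1] cell_step_support[OF st2] by auto
  have shared: "\<exists>f. (\<forall>l. f l \<in> R l) \<and> (\<forall>l. f l \<in> R' l) \<and> p = sum f UNIV" if "p \<in> msum R" "p \<in> msum R'" for p
  proof -
    have "p \<in> msum (\<lambda>i. R i \<inter> R' i)" using inter that unfolding intersect_properly_def by blast
    then show ?thesis by (elim msum_memE) blast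
  qed
  have "(real b1, 2) \<in> msum R" "(real b1, 2) \<in> msum R'"
    using cell_step_side_slice[OF st(1), of 2] cell_step_side_slice[OF st(2), of 2]
      cell_step_side_le[OF st(1), of 2] cell_step_side_le[OF st(2), of 2] by (auto simp: s' t b)
  then obtain f where f: "\<And>l. f l \<in> R l" "\<And>l. f l \<in> R' l" "sum f UNIV = (real b1, 2)" using shared by metis
  have "(\<lambda>_. apex)(k1 := (real b1, 0)) = (\<lambda>_. apex)(k2 := (real b2, 0))"
    using cell_step_corner_summands(2)[OF st1, of f] cell_step_corner_summands(1)[OF st2, of f] f b by simp
  then have k: "k1 = k2" by (metis fun_upd_other fun_upd_same prod.inject apex_def zero_neq_one)
  have "(real b1 + real c1, 1) \<in> msum R" "(real b1 + real c1, 1) \<in> msum R'"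
    using cell_step_side_slice[OF st(1), of 1] cell_step_side_slice[OF st(2), of 1]
      cell_step_side_le[OF st(1), of 1] cell_step_side_le[OF st(2), of 1] by (auto simp: s' t b c)
  then obtain f where f: "\<And>l. f l \<in> R l" "\<And>l. f l \<in> R' l" "sum f UNIV = (real b1 + real c1, 1)" using shared by metis
  have "(\<lambda>_. apex)(k1 := (real b1, 0), j1 := (real c1, 0)) = (\<lambda>_. apex)(k2 := (real b2, 0), j2 := (real c2, 0))"
    using cell_step_corner_summands(4)[OF st1, of f] cell_step_corner_summands(3)[OF st2, of f] f b c by simp
  then have "((\<lambda>_. apex)(k2 := (real b2, 0), j2 := (real c2, 0))) j1 = (real c1, 0)" by (metis fun_upd_same)
  then have "j1 = j2" using kj k by (auto simp: apex_def split: if_splits)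
  then show ?thesis using b c k s' t by simp
qed

text \<open>The cells that meet the strip are ordered from left to right, consecutive cells share a side, the
  first side starts at \<open>(0, 2)\<close> and the last one at \<open>(u, 2)\<close>. So the cells form a path of states
  along which an invariant can be propagated, where the second argument of the invariant collects the mixed
  areas of the cells passed so far.\<close>
lemma strip_path_invariant:
  assumes S: "mixed_subdivision B S" and fin: "\<And>l. finite (B l)"
    and ne: "\<And>l. B l \<noteq> {}" and zero: "0 \<in> B k0"
    and init: "\<And>k j c. k \<noteq> j \<Longrightarrow> 0 \<in> B k \<Longrightarrow> c \<in> B j \<Longrightarrow> Inv (k, 0, j, c) (\<lambda>_. 0)"
    and step: "\<And>R s s' i g E. cell_step B R s s' i g \<Longrightarrow> Inv s E \<Longrightarrow> Inv s' (E(i := E i + g))"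
  obtains k j c where "k \<noteq> j" "Max (\<Union>l. B l) \<in> B k" "c \<in> B j"
    "Inv (k, Max (\<Union>l. B l), j, c) (mixed_area B S)"
proof -
  define T where "T = {R \<in> S. \<exists>x y. (x, y) \<in> msum R \<and> 1 < y \<and> y < 2}"
  note S' = S[unfolded mixed_subdivision_def]
  have finS: "finite S" using S'[THEN conjunct1] .
  have cover: "(\<Union>R\<in>S. msum R) = bigC B" using S'[THEN conjunct2, THEN conjunct2, THEN conjunct1] .
  have cellS: "minkowski_cell B R \<and> tight_cell R" if "R \<in> S" for R
    using S'[THEN conjunct2, THEN conjunct1, THEN bspec, OF that] .
  have pair: "interior (msum R) \<inter> interior (msum R') = {} \<and> intersect_properly R R'"
    if "R \<in> S" "R' \<in> S" "R \<noteq> R'" for R R'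
    using S'[THEN conjunct2, THEN conjunct2, THEN conjunct2, THEN bspec, OF that(1), THEN bspec, OF that(2), THEN mp, OF that(3)] .
  have disj: "interior (msum R) \<inter> interior (msum R') = {}" if "R \<in> S" "R' \<in> S" "R \<noteq> R'" for R R'
    using pair[OF that] by (rule conjunct1)
  have proper: "intersect_properly R R'" if "R \<in> S" "R' \<in> S" "R \<noteq> R'" for R R'
    using pair[OF that] by (rule conjunct2)
  have z2: "(0, 2) \<in> bigC B" using sum_two_apexes[of 0 B k0, OF zero] by simp
  have finT: "finite T" and TS: "T \<subseteq> S" using finS by (auto simp: T_def)
  have "\<forall>R\<in>T. \<exists>d. cell_step B R (fst d) (fst (snd d)) (fst (snd (snd d))) (snd (snd (snd d)))"
  proof
    fix R assume "R \<in> T"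
    then obtain x y where xy: "(x, y) \<in> msum R" "1 < y" "y < 2" and RS: "R \<in> S"
      unfolding T_def by blast
    obtain k b j c k' b' j' c' i g where "cell_step B R (k, b, j, c) (k', b', j', c') i g"
      using strip_cell_is_step[OF cellS[OF RS, THEN conjunct1] cellS[OF RS, THEN conjunct2] fin xy] .
    then show "\<exists>d. cell_step B R (fst d) (fst (snd d)) (fst (snd (snd d))) (snd (snd (snd d)))"
      by (intro exI[of _ "((k, b, j, c), (k', b', j', c'), i, g)"]) simp
  qed
  from bchoice[OF this] obtain D where D: "\<And>R. R \<in> T \<Longrightarrow>
      cell_step B R (fst (D R)) (fst (snd (D R))) (fst (snd (snd (D R)))) (snd (snd (snd (D R))))"
    by blast
  define ls where "ls R = fst (D R)" for R
  define rs where "rs R = fst (snd (D R))" for R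
  define ix where "ix R = fst (snd (snd (D R)))" for R
  define gn where "gn R = snd (snd (snd (D R)))" for R
  have cs: "cell_step B R (ls R) (rs R) (ix R) (gn R)" if "R \<in> T" for R
    using D[OF that] by (simp add: ls_def rs_def ix_def gn_def)
  have slice: "(x, y) \<in> msum R \<longleftrightarrow> side_at (ls R) y \<le> x \<and> x \<le> side_at (rs R) y"
    if "R \<in> T" "1 \<le> y" "y \<le> 2" for R x y using cell_step_side_slice[OF cs] that by blast
  have less: "side_at (ls R) y < side_at (rs R) y" if "R \<in> T" "1 < y" "y < 2" for R y
    using cell_step_side_less[OF cs] that by blast
  define l where "l R = side_at (ls R) (3/2)" for R
  define r where "r R = side_at (rs R) (3/2)" for R
  have lr: "l R < r R" if "R \<in> T" for R using less[OF that, of "3/2"] by (simp add: l_def r_def)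
  have sep: "side_at (rs R) y \<le> side_at (ls R') y \<or> side_at (rs R') y \<le> side_at (ls R) y"
    if R: "R \<in> T" "R' \<in> T" "R \<noteq> R'" and y: "1 < y" "y < 2" for R R' y
  proof (rule ccontr)
    assume c: "\<not> ?thesis"
    let ?a = "max (side_at (ls R) y) (side_at (ls R') y)" and ?b = "min (side_at (rs R) y) (side_at (rs R') y)"
    have "?a < ?b" using c less[OF R(1) y] less[OF R(2) y] by auto
    then obtain x where "?a < x" "x < ?b" using dense by blast
    then have "(x, y) \<in> interior (msum R)" "(x, y) \<in> interior (msum R')"
      using cell_step_interior[OF cs[OF R(1)] y] cell_step_interior[OF cs[OF R(2)] y] by auto
    then show False using disj[of R R'] R TS by blast
  qed
  have sepm: "r R \<le> l R' \<or> r R' \<le> l R" if "R \<in> T" "R' \<in> T" "R \<noteq> R'" for R R'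
    using sep[OF that, of "3/2"] by (simp add: l_def r_def)
  have covm: "\<exists>R\<in>T. l R \<le> x \<and> x \<le> r R" if p: "(x, 3/2) \<in> bigC B" for x
  proof -
    obtain R where R: "R \<in> S" "(x, 3/2) \<in> msum R" using p unfolding cover[symmetric] by blast
    have "R \<in> T" unfolding T_def
      by (rule CollectI, rule conjI[OF R(1)], rule exI[of _ x], rule exI[of _ "3/2"]) (simp add: R(2))
    then show ?thesis using slice[of R "3/2" x] R(2) by (auto simp: l_def r_def)
  qed
  have inC: "(x, 3/2) \<in> bigC B" if "R \<in> T" "l R \<le> x" "x \<le> r R" for R x
    using slice[OF that(1), of "3/2" x] that cover TS by (auto simp: l_def r_def)
  (* Two neighbouring sides meet at height 3/2 and may not cross there. Comparing them a little above
     and a little below this height gives both inequalities between their slopes. *)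
  have share: "rs R = ls R'" if R: "R \<in> T" "R' \<in> T" and eq: "r R = l R'" for R R'
  proof -
    have neq: "R \<noteq> R'" using lr[OF R(1)] eq by auto
    obtain k b j c where s: "rs R = (k, b, j, c)" by (metis prod_cases4)
    obtain k' b' j' c' where t: "ls R' = (k', b', j', c')" by (metis prod_cases4)
    obtain k1 b1 j1 c1 where s1: "ls R = (k1, b1, j1, c1)" by (metis prod_cases4)
    obtain k2 b2 j2 c2 where t2: "rs R' = (k2, b2, j2, c2)" by (metis prod_cases4)
    have e: "real b + real c / 2 = real b' + real c' / 2" using eq by (simp add: r_def l_def s t)
    define h0 where "h0 = r R' - l R"
    define h1 where "h1 = \<bar>real c2 - real c1\<bar>"
    have h0: "h0 > 0" using lr[OF R(1)] lr[OF R(2)] eq by (simp add: h0_def)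
    have h1: "h1 \<ge> 0" by (simp add: h1_def)
    define e0 where "e0 = min (1/4) (h0 / (2 * (h1 + 1)))"
    have e0: "0 < e0" "e0 < 1/2" using h0 h1 by (auto simp: e0_def)
    have eh: "e0 * h1 < h0"
    proof -
      have "e0 * h1 \<le> (h0 / (2 * (h1 + 1))) * h1" using h1 by (intro mult_right_mono) (simp_all add: e0_def)
      also have "\<dots> = h0 * (h1 / (2 * (h1 + 1)))" by simp
      also have "\<dots> < h0 * 1" using h0 h1 by (intro mult_strict_left_mono) simp_all
      also have "\<dots> = h0" by simp
      finally show ?thesis .
    qed
    have key: "side_at (rs R) (3/2 + d) \<le> side_at (ls R') (3/2 + d)" if d: "\<bar>d\<bar> = e0" for d
    proof -
      have "side_at (ls R) (3/2 + d) < side_at (rs R') (3/2 + d)"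
      proof -
        have "side_at (rs R') (3/2 + d) - side_at (ls R) (3/2 + d) = h0 - d * (real c2 - real c1)"
          by (simp add: h0_def r_def l_def s1 t2 algebra_simps)
        moreover have "\<bar>d * (real c2 - real c1)\<bar> < h0" using eh unfolding abs_mult d h1_def .
        ultimately show ?thesis by linarith
      qed
      moreover have "1 < 3/2 + d" "3/2 + d < 2" using d e0 by (simp_all add: abs_if split: if_splits)
      ultimately show ?thesis using sep[OF R neq, of "3/2 + d"] by auto
    qed
    have "real c = real c'"
    proof -
      have k2: "d * real c' \<le> d * real c" if d: "\<bar>d\<bar> = e0" for d
      proof -
        have "real b + (1/2 - d) * real c \<le> real b' + (1/2 - d) * real c'"
          using key[OF d] by (simp add: s t)
        then show ?thesis using e by (simp add: algebra_simps)
      qed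
      have "e0 * real c = e0 * real c'" using k2[of e0] k2[of "- e0"] e0(1) by linarith
      then show ?thesis using e0 by simp
    qed
    then have "side_at (rs R) y = side_at (ls R') y" for y using e by (simp add: s t)
    then show ?thesis using cells_share_side[OF cs[OF R(1)] cs[OF R(2)]] proper[of R R'] R neq TS by blast
  qed
  (* the mixed areas of the cells to the left of R *)
  define E where "E R o' = (\<Sum>R'\<in>{R'\<in>T. r R' \<le> l R}. if o' = ix R' then gn R' else 0)" for R o'
  have Eupd: "(E R)(ix R := E R (ix R) + gn R) = (\<lambda>o'. \<Sum>R'\<in>insert R {R'\<in>T. r R' \<le> l R}. if o' = ix R' then gn R' else 0)"
    if "R \<in> T" for R
  proof -
    have "R \<notin> {R'\<in>T. r R' \<le> l R}" using lr[OF that] by auto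
    then show ?thesis using finT by (auto simp: E_def fun_eq_iff add.commute)
  qed
  have top_supp: "\<exists>k b j c. ls R = (k, b, j, c) \<and> k \<noteq> j \<and> b \<in> B k \<and> c \<in> B j"
      "\<exists>k b j c. rs R = (k, b, j, c) \<and> k \<noteq> j \<and> b \<in> B k \<and> c \<in> B j" if "R \<in> T" for R
    using cs[OF that] cell_step_support by (metis prod_cases4)+
  have main: "Inv (ls R) (E R)" if "R \<in> T" for R
    using that
  proof (induction "card {R'\<in>T. l R' < l R}" arbitrary: R rule: less_induct)
    case less
    show ?case
    proof (cases "\<exists>R0\<in>T. r R0 = l R")
      case True
      then obtain R0 where R0: "R0 \<in> T" "r R0 = l R" by blast
      have "{R'\<in>T. l R' < l R0} \<subset> {R'\<in>T. l R' < l R}" using lr[OF R0(1)] R0 by force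
      then have "Inv (ls R0) (E R0)" using less.hyps[OF _ R0(1)] finT by (simp add: psubset_card_mono)
      then have "Inv (rs R0) ((E R0)(ix R0 := E R0 (ix R0) + gn R0))" using step[OF cs[OF R0(1)]] by blast
      moreover have "rs R0 = ls R" using share[OF R0(1) less.prems R0(2)] .
      moreover have "insert R0 {R'\<in>T. r R' \<le> l R0} = {R'\<in>T. r R' \<le> l R}"
        using sepm[OF R0(1)] lr[OF R0(1)] lr R0 by force
      ultimately show ?thesis using Eupd[OF R0(1)] by (simp add: E_def[abs_def])
    next
      case False
      (* R is the first cell. Its left side must start at (0, 2), because C contains (0, 2) and no point
         of C lies further left at height 3/2. *)
      have noleft: "(x, 3/2) \<notin> bigC B" if x: "x < l R" for x
      proof
        assume xC: "(x, 3/2) \<in> bigC B"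
        have RC: "(l R, 3/2) \<in> bigC B" using inC[OF less.prems, of "l R"] lr[OF less.prems] by simp
        have seg: "(z, 3/2) \<in> bigC B" if z: "x \<le> z" "z \<le> l R" for z
        proof -
          define q where "q = (z - x) / (l R - x)"
          have q: "0 \<le> q" "q \<le> 1" "q * (l R - x) = z - x" using z x by (auto simp: q_def)
          have "(1 - q) *\<^sub>R (x, 3/2) + q *\<^sub>R (l R, 3/2) \<in> bigC B"
            using xC RC q by (intro convexD[OF convex_bigC]) auto
          moreover have "(1 - q) *\<^sub>R (x, 3/2) + q *\<^sub>R (l R, 3/2::real) = (z, 3/2)"
            using q(3) by (simp add: algebra_simps add_divide_distrib diff_divide_distrib)
          ultimately show ?thesis by (simp only:)
        qed
        have "\<exists>R0\<in>T. l R0 < l R \<and> l R \<le> r R0"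
        proof (rule ccontr)
          assume no: "\<not> ?thesis"
          define A where "A = insert x (r ` {R0\<in>T. l R0 < l R})"
          have A: "finite A" "A \<noteq> {}" using finT by (auto simp: A_def)
          have "Max A < l R" using A x no by (subst Max_less_iff) (auto simp: A_def)
          from dense[OF this] obtain z where z: "Max A < z" "z < l R" by (elim exE conjE)
          have zA: "a < z" if "a \<in> A" for a using Max_ge[OF A(1) that] z(1) by simp
          have "x < z" using zA[of x] by (simp add: A_def)
          then have "(z, 3/2) \<in> bigC B" using seg[of z] z(2) by simp
          from covm[OF this] obtain R0 where R0: "R0 \<in> T" "l R0 \<le> z" "z \<le> r R0" by blast
          then have "r R0 \<in> A" using z(2) by (simp add: A_def)
          then show False using zA R0(3) by fastforce
        qed
        then obtain R0 where R0: "R0 \<in> T" "l R0 < l R" "l R \<le> r R0" by blast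
        then have "r R0 \<le> l R" using sepm[OF R0(1) less.prems] lr[OF less.prems] by force
        then show False using False R0 by force
      qed
      have noE: "{R'\<in>T. r R' \<le> l R} = {}"
      proof (rule ccontr)
        assume "{R'\<in>T. r R' \<le> l R} \<noteq> {}"
        then obtain R' where R': "R' \<in> T" "r R' \<le> l R" by blast
        then show False using noleft[of "l R'"] inC[OF R'(1), of "l R'"] lr[OF R'(1)] by auto
      qed
      have E0: "E R = (\<lambda>_. 0)" by (rule ext) (simp only: E_def noE sum.empty)
      obtain k b j c where s: "ls R = (k, b, j, c)" "k \<noteq> j" "b \<in> B k" "c \<in> B j" using top_supp[OF less.prems] by blast
      have "(0 / 4 + real b / 4 + (real b + real c) / 2, 3/2) \<in> bigC B"
        by (rule convex_three_points[OF convex_bigC z2 sum_two_apexes[of b B k, OF s(3)] sum_one_apex[of b B k c j, OF s(3,4) s(2)[symmetric]]])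
      then have "\<not> (0 / 4 + real b / 4 + (real b + real c) / 2 < l R)" using noleft by blast
      then have "b = 0" by (simp add: l_def s field_simps)
      then show ?thesis using init[of k j c] s E0 by simp
    qed
  qed
  have Tne: "T \<noteq> {}"
  proof -
    obtain j :: 3 where j: "j \<noteq> k0" by (metis zero_neq_one)
    obtain c where c: "c \<in> B j" using ne by blast
    have "(0 / 4 + 0 / 4 + (real 0 + real c) / 2, 3/2) \<in> bigC B"
      by (rule convex_three_points[OF convex_bigC z2 z2 sum_one_apex[of 0 B k0 c j, OF zero c j]])
    then show ?thesis using covm by blast
  qed
  obtain R where R: "R \<in> T" "\<And>R'. R' \<in> T \<Longrightarrow> r R' \<le> r R"
  proof -
    have "Max (r ` T) \<in> r ` T" using finT Tne by simp
    then obtain R where "R \<in> T" "r R = Max (r ` T)" by auto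
    then show ?thesis using that finT by (metis Max_ge finite_imageI imageI)
  qed
  have noright: "(x, 3/2) \<notin> bigC B" if "r R < x" for x
    using covm[of x] R(2) that by force
  obtain k b j c where s: "rs R = (k, b, j, c)" "k \<noteq> j" "b \<in> B k" "c \<in> B j" using top_supp[OF R(1)] by blast
  define u where "u = Max (\<Union>l. B l)"
  have finU: "finite (\<Union>l. B l)" using fin by simp
  have uB: "\<exists>l. u \<in> B l" using Max_in[OF finU] ne by (auto simp: u_def)
  then obtain k1 where k1: "u \<in> B k1" by blast
  have "(real u / 4 + real b / 4 + (real b + real c) / 2, 3/2) \<in> bigC B"
    by (rule convex_three_points[OF convex_bigC sum_two_apexes[of u B k1, OF k1] sum_two_apexes[of b B k, OF s(3)] sum_one_apex[of b B k c j, OF s(3,4) s(2)[symmetric]]])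
  then have "\<not> (r R < real u / 4 + real b / 4 + (real b + real c) / 2)" using noright by blast
  then have "u \<le> b" by (simp add: r_def s field_simps)
  moreover have "b \<le> u" unfolding u_def using finU s(3) by (intro Max_ge) auto
  ultimately have bu: "b = u" by simp
  have "Inv (rs R) ((E R)(ix R := E R (ix R) + gn R))" using step[OF cs[OF R(1)] main[OF R(1)]] .
  moreover have "insert R {R'\<in>T. r R' \<le> l R} = T"
  proof -
    have "r R' \<le> l R" if "R' \<in> T" "R' \<noteq> R" for R'
      using sepm[OF that(1) R(1) that(2)] R(2)[OF that(1)] lr[OF that(1)] by auto
    then show ?thesis using R by auto
  qed
  moreover have "(\<Sum>R'\<in>T. if o' = ix R' then gn R' else 0) = mixed_area B S o'" for o'
  proof -
    have "mixed_area B S o' = (\<Sum>R\<in>S. if mixed_cell B o' R then measure lborel (msum R) else 0)"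
      unfolding mixed_area_def using finS by (simp add: sum.inter_filter)
    also have "\<dots> = (\<Sum>R\<in>T. if mixed_cell B o' R then measure lborel (msum R) else 0)"
    proof (rule sum.mono_neutral_right[OF finS TS])
      show "\<forall>R\<in>S - T. (if mixed_cell B o' R then measure lborel (msum R) else 0) = 0"
      proof
        fix R assume R: "R \<in> S - T"
        have "\<not> mixed_cell B o' R"
        proof
          assume m: "mixed_cell B o' R"
          have "aff_dim (msum R) = 2" using cellS[of R] R by (simp add: minkowski_cell_def)
          then obtain x where "(x, 3/2) \<in> msum R" using mixed_cell_meets_strip[OF m] by blast
          then have "\<exists>x y. (x, y) \<in> msum R \<and> 1 < y \<and> y < 2" by (intro exI[of _ x] exI[of _ "3/2"]) simp
          then show False using R by (simp add: T_def)
        qed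
        then show "(if mixed_cell B o' R then measure lborel (msum R) else 0) = 0" by simp
      qed
    qed
    also have "\<dots> = (\<Sum>R'\<in>T. if o' = ix R' then gn R' else 0)"
    proof (rule sum.cong[OF refl])
      fix R assume R: "R \<in> T"
      then have "R \<in> S" using TS by blast
      show "(if mixed_cell B o' R then measure lborel (msum R) else 0) = (if o' = ix R then gn R else 0)"
        by (rule cell_step_mixed_area[OF cs[OF R] cellS[OF \<open>R \<in> S\<close>, THEN conjunct1] fin])
    qed
    finally show ?thesis by (rule sym)
  qed
  ultimately have "Inv (rs R) (mixed_area B S)" by (simp only: Eupd[OF R(1)])
  then have "Inv (k, u, j, c) (mixed_area B S)" by (simp only: s bu)
  then show ?thesis using that[of k j c] s bu by (simp add: u_def)
qed

section \<open>A lower bound for the mixed areas\<close>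
definition lowgap :: "(3 \<Rightarrow> nat set) \<Rightarrow> 3 \<Rightarrow> real" where
  "lowgap B l = real (Min (B l))"

definition topgap :: "(3 \<Rightarrow> nat set) \<Rightarrow> 3 \<Rightarrow> real" where
  "topgap B l = real (Max (\<Union>l. B l)) - real (Max (B l))"

definition corner_support :: "(3 \<Rightarrow> nat set) \<Rightarrow> 3 \<Rightarrow> 3 \<Rightarrow> real \<Rightarrow> real \<Rightarrow> real" where
  "corner_support B i j a b =
     min (a * lowgap B j) (b * lowgap B i) + min (a * topgap B j) (b * topgap B i)"

lemma cell_step_gain: "cell_step B R s s' i g \<Longrightarrow> 0 \<le> g \<and> g \<in> \<int>"
  by (auto elim!: cell_step.cases)

text \<open>Let \<open>(m, x, l, c)\<close> be the current state of the path. While \<open>m = k\<close>, every gain belongs to \<open>i\<close> or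
  \<open>j\<close>, because the index of a gain differs from the two indices \<open>k\<close> and \<open>l\<close> of the state. Three phases are
  possible. In the first one \<open>k\<close> has never been left; then \<open>E i + E j = x\<close>, and the split between \<open>i\<close> and
  \<open>j\<close> is forced until the slope \<open>c\<close> has passed the larger one of the two first points, since the
  other index can only come in by a turn to a larger slope. In the second phase \<open>m \<noteq> k\<close>, and the contribution
  of the left end to the corner support has been collected. In the third one a swap has brought \<open>k\<close> back
  from the position \<open>c0\<close>, which became the slope; \<open>X\<close> and \<open>Y\<close> have been gained for \<open>i\<close> and \<open>j\<close> by this swap and
  after it, and the situation is the mirror image of the first phase.\<close>
definition path_inv ::
  "(3 \<Rightarrow> nat set) \<Rightarrow> 3 \<Rightarrow> 3 \<Rightarrow> 3 \<Rightarrow> real \<Rightarrow> real \<Rightarrow> 3 \<times> nat \<times> 3 \<times> nat \<Rightarrow> (3 \<Rightarrow> real) \<Rightarrow> bool" where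
  "path_inv B i j k a b s E = (case s of (m, x, l, c) \<Rightarrow>
     0 \<le> E i \<and> 0 \<le> E j \<and>
     ((m = k \<and> E i + E j = x \<and>
        (lowgap B i \<le> lowgap B j \<longrightarrow> (l = i \<and> E j = x) \<or> lowgap B j \<le> c) \<and>
        (lowgap B j \<le> lowgap B i \<longrightarrow> (l = j \<and> E i = x) \<or> lowgap B i \<le> c)) \<or>
      (m \<noteq> k \<and> min (a * lowgap B j) (b * lowgap B i) \<le> a * E i + b * E j) \<or>
      (m = k \<and> (\<exists>X Y c0. 0 \<le> X \<and> 0 \<le> Y \<and> X + Y = x - c0 \<and> c0 \<le> c \<and>
        min (a * lowgap B j) (b * lowgap B i) + a * X + b * Y \<le> a * E i + b * E j \<and>
        (Max (B j) \<le> Max (B i) \<longrightarrow> (l = i \<and> Y = x - c0) \<or> c0 \<le> real (Max (B j))) \<and>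
        (Max (B i) \<le> Max (B j) \<longrightarrow> (l = j \<and> X = x - c0) \<or> c0 \<le> real (Max (B i)))))))"

lemma path_inv_A:
  "0 \<le> E i \<Longrightarrow> 0 \<le> E j \<Longrightarrow> E i + E j = x \<Longrightarrow>
   (lowgap B i \<le> lowgap B j \<longrightarrow> (l = i \<and> E j = x) \<or> lowgap B j \<le> c) \<Longrightarrow>
   (lowgap B j \<le> lowgap B i \<longrightarrow> (l = j \<and> E i = x) \<or> lowgap B i \<le> c) \<Longrightarrow>
   path_inv B i j k a b (k, x, l, c) E"
  unfolding path_inv_def by simp

lemma path_inv_B:
  "0 \<le> E i \<Longrightarrow> 0 \<le> E j \<Longrightarrow> m \<noteq> k \<Longrightarrow> min (a * lowgap B j) (b * lowgap B i) \<le> a * E i + b * E j \<Longrightarrow>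
   path_inv B i j k a b (m, x, l, c) E"
  unfolding path_inv_def by simp

lemma path_inv_C:
  "0 \<le> E i \<Longrightarrow> 0 \<le> E j \<Longrightarrow> 0 \<le> X \<Longrightarrow> 0 \<le> Y \<Longrightarrow> X + Y = x - c0 \<Longrightarrow> c0 \<le> c \<Longrightarrow>
   min (a * lowgap B j) (b * lowgap B i) + a * X + b * Y \<le> a * E i + b * E j \<Longrightarrow>
   (Max (B j) \<le> Max (B i) \<longrightarrow> (l = i \<and> Y = x - c0) \<or> c0 \<le> real (Max (B j))) \<Longrightarrow>
   (Max (B i) \<le> Max (B j) \<longrightarrow> (l = j \<and> X = x - c0) \<or> c0 \<le> real (Max (B i))) \<Longrightarrow>
   path_inv B i j k a b (k, x, l, c) E"
  unfolding path_inv_def prod.case by blast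

lemma path_inv_cases:
  assumes "path_inv B i j k a b (m, x, l, c) E"
  obtains (A) "0 \<le> E i" "0 \<le> E j" "m = k" "E i + E j = x"
     "lowgap B i \<le> lowgap B j \<longrightarrow> (l = i \<and> E j = x) \<or> lowgap B j \<le> c"
     "lowgap B j \<le> lowgap B i \<longrightarrow> (l = j \<and> E i = x) \<or> lowgap B i \<le> c"
  | (B) "0 \<le> E i" "0 \<le> E j" "m \<noteq> k" "min (a * lowgap B j) (b * lowgap B i) \<le> a * E i + b * E j"
  | (C) X Y c0 where "0 \<le> E i" "0 \<le> E j" "m = k" "0 \<le> X" "0 \<le> Y" "X + Y = x - c0" "c0 \<le> c"
     "min (a * lowgap B j) (b * lowgap B i) + a * X + b * Y \<le> a * E i + b * E j"
     "Max (B j) \<le> Max (B i) \<longrightarrow> (l = i \<and> Y = x - c0) \<or> c0 \<le> real (Max (B j))"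
     "Max (B i) \<le> Max (B j) \<longrightarrow> (l = j \<and> X = x - c0) \<or> c0 \<le> real (Max (B i))"
  using assms unfolding path_inv_def prod.case by (elim conjE disjE exE) (erule that; assumption)+

lemma path_inv_sym:
  assumes "path_inv B i j k a b s E"
  shows "path_inv B j i k b a s E"
proof -
  obtain m x l c where s: "s = (m, x, l, c)" by (metis prod_cases4)
  from assms[unfolded s] have "path_inv B j i k b a (m, x, l, c) E"
  proof (cases rule: path_inv_cases)
    case A
    then show ?thesis by (simp only:) (rule path_inv_A; simp add: add.commute)
  next
    case B
    then show ?thesis by (intro path_inv_B) (simp_all add: add.commute min.commute)
  next
    case (C X Y c0)
    then show ?thesis
      by (simp only:) (rule path_inv_C[of _ _ _ Y X _ c0]; simp add: add.commute min.commute)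
  qed
  then show ?thesis by (simp only: s)
qed

text \<open>On the segment \<open>x + y = z\<close> of nonnegative pairs the weighted sum is least at an end point.\<close>
lemma min_bound_sum:
  fixes a b x y p q z :: real
  assumes "0 \<le> a" "0 \<le> b" "0 \<le> x" "0 \<le> y" "x + y = z" "q \<le> p" "p \<le> z"
  shows "min (a * p) (b * q) \<le> a * x + b * y"
proof (cases "a \<le> b")
  case True
  have "a * p \<le> a * z" using assms by (simp add: mult_left_mono)
  also have "\<dots> = a * x + a * y" using assms(5) by (simp flip: distrib_left)
  also have "\<dots> \<le> a * x + b * y" using True assms by (simp add: mult_right_mono)
  finally show ?thesis by simp
next
  case False
  have "b * q \<le> b * z" using assms by (simp add: mult_left_mono)
  also have "\<dots> = b * x + b * y" using assms(5) by (simp flip: distrib_left)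
  also have "\<dots> \<le> a * x + b * y" using False assms by (simp add: mult_right_mono)
  finally show ?thesis by simp
qed

text \<open>The steps from a state \<open>(k, x, i, c)\<close>; those from \<open>(k, x, j, c)\<close> follow by exchanging \<open>i\<close> and \<open>j\<close>. A
  swap ends the phase: its gain \<open>c - x\<close> completes \<open>E i + E j\<close> to \<open>c\<close>, and \<open>c\<close> is a point of the support of
  \<open>i\<close>, so the contribution of the left end is reached.\<close>
lemma path_inv_step_first:
  assumes d: "i \<noteq> j" "j \<noteq> k" "i \<noteq> k" and ab: "0 \<le> a" "0 \<le> b" and fin: "\<And>l. finite (B l)"
    and st: "cell_step B R (k, x, i, c) s' o' g" and inv: "path_inv B i j k a b (k, x, i, c) E"
  shows "path_inv B i j k a b s' (E(o' := E o' + g))"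
proof -
  have low: "lowgap B l \<le> real n" and top: "n \<le> Max (B l)" if "n \<in> B l" for n l
    using that fin[of l] by (simp_all add: lowgap_def)
  show ?thesis using st
  proof cases
    case (along_base x')
    have oj: "o' = j" using distinct_3_cases(1)[OF d, of o'] along_base by auto
    from inv show ?thesis
    proof (cases rule: path_inv_cases)
      case A
      then show ?thesis unfolding along_base(1) using along_base d oj by (intro path_inv_A) auto
    next
      case (C X Y c0)
      have "b * (Y + g) = b * Y + b * g" by (simp add: distrib_left)
      then show ?thesis unfolding along_base(1) using along_base d oj C
        by (intro path_inv_C[of _ _ _ X "Y + g" _ c0]) (auto simp: distrib_left)
    qed simp
  next
    case (turn c')
    have oj: "o' = j" using distinct_3_cases(1)[OF d, of o'] turn by auto
    have c': "lowgap B j \<le> c'" "c' \<le> Max (B j)" using low top turn oj by auto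
    from inv show ?thesis
    proof (cases rule: path_inv_cases)
      case A
      then show ?thesis unfolding turn(1) using turn d oj c' by (intro path_inv_A) auto
    next
      case (C X Y c0)
      then show ?thesis unfolding turn(1) using turn d oj c'
        by (intro path_inv_C[of _ _ _ X Y _ c0]) auto
    qed simp
  next
    case (widen c')
    from inv show ?thesis
    proof (cases rule: path_inv_cases)
      case A
      then show ?thesis unfolding widen(1) using widen by (intro path_inv_A) auto
    next
      case (C X Y c0)
      then show ?thesis unfolding widen(1) using widen
        by (intro path_inv_C[of _ _ _ X Y _ c0]) auto
    qed simp
  next
    case swap
    have oj: "o' = j" using distinct_3_cases(1)[OF d, of o'] swap by auto
    have ci: "lowgap B i \<le> c" and g: "0 \<le> g" "g = real c - real x" using low swap by auto
    from inv show ?thesis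
    proof (cases rule: path_inv_cases)
      case A
      have "min (a * lowgap B j) (b * lowgap B i) \<le> a * E i + b * (E j + g)"
      proof (cases "lowgap B i \<le> lowgap B j")
        case True
        show ?thesis
        proof (cases "lowgap B j \<le> c")
          case cj: True
          show ?thesis by (rule min_bound_sum[of a b _ _ c]) (use A g ab True cj in auto)
        next
          case False
          then have "E j = x" using A True by auto
          then have "b * lowgap B i \<le> b * (E j + g)" using ci g ab by (simp add: mult_left_mono)
          moreover have "0 \<le> a * E i" using ab A by simp
          ultimately show ?thesis by linarith
        qed
      next
        case False
        then have "min (b * lowgap B i) (a * lowgap B j) \<le> b * (E j + g) + a * E i"
          by (intro min_bound_sum[of b a _ _ c]) (use A g ab d in auto)
        then show ?thesis by (simp add: min.commute add.commute)
      qed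
      then show ?thesis unfolding swap(1) using A g d oj by (intro path_inv_B) auto
    next
      case (C X Y c0)
      have "0 \<le> a * X" "0 \<le> b * Y" "0 \<le> b * g" using ab C g by auto
      then have "min (a * lowgap B j) (b * lowgap B i) \<le> a * E i + b * (E j + g)"
        using C by (simp add: distrib_left)
      then show ?thesis unfolding swap(1) using C g d oj by (intro path_inv_B) auto
    qed simp
  qed
qed

lemma path_inv_step:
  assumes d: "i \<noteq> j" "j \<noteq> k" "i \<noteq> k" and ab: "0 \<le> a" "0 \<le> b" and fin: "\<And>l. finite (B l)"
    and st: "cell_step B R s s' o' g" and inv: "path_inv B i j k a b s E"
  shows "path_inv B i j k a b s' (E(o' := E o' + g))"
proof -
  obtain m x l c where s: "s = (m, x, l, c)" by (metis prod_cases4)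
  obtain m' x' l' c' where s': "s' = (m', x', l', c')" by (metis prod_cases4)
  note st' = st[unfolded s s']
  have ml: "m \<noteq> l" using cell_step_support[OF st'] by simp
  have g: "0 \<le> g" using cell_step_gain[OF st] by simp
  have top: "n \<le> Max (B l)" if "n \<in> B l" for n l using that fin[of l] by simp
  show ?thesis
  proof (cases "m = k")
    case True
    then consider "l = i" | "l = j" using distinct_3_cases(1)[OF d, of l] ml by auto
    then show ?thesis
    proof cases
      case 1
      show ?thesis by (rule path_inv_step_first[OF d ab fin]) (use st inv s True 1 in auto)
    next
      case 2
      have "path_inv B j i k b a s' (E(o' := E o' + g))"
        by (rule path_inv_step_first[of j i k b a B R x c])
          (use d ab fin st path_inv_sym[OF inv] s True 2 in auto)
      then show ?thesis by (rule path_inv_sym)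
    qed
  next
    case False
    from inv[unfolded s] have "0 \<le> E i \<and> 0 \<le> E j \<and> min (a * lowgap B j) (b * lowgap B i) \<le> a * E i + b * E j"
      by (cases rule: path_inv_cases) (use False in auto)
    then have inv': "0 \<le> E i" "0 \<le> E j"
      "min (a * lowgap B j) (b * lowgap B i) \<le> a * E i + b * E j" by simp_all
    have E': "0 \<le> (E(o' := E o' + g)) i" "0 \<le> (E(o' := E o' + g)) j" using inv' g by auto
    have "0 \<le> a * g" "0 \<le> b * g" using ab g by auto
    then have up: "min (a * lowgap B j) (b * lowgap B i) \<le> a * (E(o' := E o' + g)) i + b * (E(o' := E o' + g)) j"
      using inv' d by (auto simp: distrib_left)
    show ?thesis
    proof (cases "m' = k")
      case mk: False
      then show ?thesis unfolding s' using E' up by (intro path_inv_B) auto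
    next
      case True
      from st' have sw: "m' = l" "x' = c" "l' = m" "c' = x" "x \<in> B m" "o' \<noteq> m" "o' \<noteq> k" "g = real c - real x"
        by (cases; use False True in auto)+
      consider "m = i" | "m = j" using distinct_3_cases(1)[OF d, of m] False by auto
      then show ?thesis
      proof cases
        case 1
        then have "o' = j" using distinct_3_cases(1)[OF d, of o'] sw by auto
        then show ?thesis unfolding s' True using E' inv' sw d 1 top[of x i] g
          by (intro path_inv_C[of _ _ _ 0 g _ x]) (auto simp: distrib_left)
      next
        case 2
        then have "o' = i" using distinct_3_cases(1)[OF d, of o'] sw by auto
        then show ?thesis unfolding s' True using E' inv' sw d 2 top[of x j] g
          by (intro path_inv_C[of _ _ _ g 0 _ x]) (auto simp: distrib_left)
      qed
    qed
  qed
qed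

text \<open>At the end of the path the state starts at \<open>u\<close>. If it starts there with the index \<open>i\<close> or \<open>j\<close>, the right
  part of the corner support vanishes; otherwise the third phase of the invariant supplies it. If \<open>k\<close> has
  never been left, then \<open>E i + E j = u\<close>, which is more than enough.\<close>
theorem mixed_area_lower_bound:
  assumes S: "mixed_subdivision B S" and fin: "\<And>l. finite (B l)" and ne: "\<And>l. B l \<noteq> {}"
    and zero: "0 \<in> B k0" and d: "i \<noteq> j" "j \<noteq> k" "i \<noteq> k" and ab: "0 \<le> a" "0 \<le> b"
  shows "corner_support B i j a b \<le> a * mixed_area B S i + b * mixed_area B S j"
proof -
  define u where "u = Max (\<Union>l. B l)"
  have finU: "finite (\<Union>l. B l)" using fin by simp
  have low: "lowgap B l \<le> real n" and top: "n \<le> Max (B l)" and nu: "n \<le> u" if "n \<in> B l" for n l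
    using that fin[of l] finU by (auto simp: lowgap_def u_def intro!: Max_ge)
  have low0: "0 \<le> lowgap B l" for l by (simp add: lowgap_def)
  have Mx: "Max (B l) \<in> B l" for l using fin ne by simp
  have topg: "topgap B l = real u - real (Max (B l))" for l by (simp add: topgap_def u_def)
  have top0: "0 \<le> topgap B l" for l using nu[OF Mx] by (simp add: topg)
  have sumle: "lowgap B l + topgap B l \<le> u" for l using low[OF Mx, of l] by (simp add: topg)
  obtain m l c where fin_state: "m \<noteq> l" "u \<in> B m" "c \<in> B l" "path_inv B i j k a b (m, u, l, c) (mixed_area B S)"
  proof (rule strip_path_invariant[OF S fin ne zero, where Inv = "path_inv B i j k a b"])
    fix m l c assume ml: "m \<noteq> l" "0 \<in> B m" "c \<in> B l"
    show "path_inv B i j k a b (m, 0, l, c) (\<lambda>_. 0)"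
    proof (cases "m = k")
      case True
      then have "l = i \<or> l = j" using distinct_3_cases(1)[OF d, of l] ml by auto
      then show ?thesis unfolding True using low[OF ml(3)] d by (intro path_inv_A) auto
    next
      case False
      then have "m = i \<or> m = j" using distinct_3_cases(1)[OF d, of m] by auto
      moreover have "lowgap B m = 0" using low[OF ml(2)] low0[of m] by simp
      ultimately have "a * lowgap B j = 0 \<or> b * lowgap B i = 0" by auto
      then have "min (a * lowgap B j) (b * lowgap B i) \<le> 0" by auto
      then show ?thesis using False by (intro path_inv_B) auto
    qed
  next
    fix R s s' o' g E
    assume "cell_step B R s s' o' g" "path_inv B i j k a b s E"
    then show "path_inv B i j k a b s' (E(o' := E o' + g))" by (rule path_inv_step[OF d ab fin])
  next
    fix m l c
    assume "m \<noteq> l" "Max (\<Union>l. B l) \<in> B m" "c \<in> B l" "path_inv B i j k a b (m, Max (\<Union>l. B l), l, c) (mixed_area B S)"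
    then show thesis using that by (simp add: u_def)
  qed
  let ?E = "mixed_area B S"
  from fin_state(4) show ?thesis
  proof (cases rule: path_inv_cases)
    case A
    show ?thesis
    proof (cases "a \<le> b")
      case True
      have "a * lowgap B j + a * topgap B j \<le> a * u"
        using sumle[of j] ab by (simp add: mult_left_mono flip: distrib_left)
      also have "\<dots> = a * ?E i + a * ?E j" using A by (simp flip: distrib_left)
      also have "\<dots> \<le> a * ?E i + b * ?E j" using True A by (simp add: mult_right_mono)
      finally show ?thesis unfolding corner_support_def by linarith
    next
      case False
      have "b * lowgap B i + b * topgap B i \<le> b * u"
        using sumle[of i] ab by (simp add: mult_left_mono flip: distrib_left)
      also have "\<dots> = b * ?E i + b * ?E j" using A by (simp flip: distrib_left)
      also have "\<dots> \<le> a * ?E i + b * ?E j" using False A by (simp add: mult_right_mono)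
      finally show ?thesis unfolding corner_support_def by linarith
    qed
  next
    case B
    then have "m = i \<or> m = j" using distinct_3_cases(1)[OF d, of m] by auto
    moreover have "topgap B m = 0" using top[OF fin_state(2)] top0[of m] by (simp add: topg)
    ultimately have "a * topgap B j = 0 \<or> b * topgap B i = 0" by auto
    then show ?thesis using B unfolding corner_support_def by linarith
  next
    case (C X Y c0)
    have li: "l = i \<or> l = j" using distinct_3_cases(1)[OF d, of l] fin_state C by auto
    have cl: "real c \<le> real (Max (B l))" using top[OF fin_state(3)] by simp
    have "min (a * topgap B j) (b * topgap B i) \<le> a * X + b * Y"
    proof (cases "Max (B j) \<le> Max (B i)")
      case True
      then have le: "topgap B i \<le> topgap B j" by (simp add: topg)
      show ?thesis
      proof (cases "c0 \<le> real (Max (B j))")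
        case cj: True
        show ?thesis by (rule min_bound_sum[of a b X Y "real u - c0"]) (use C ab le cj topg in auto)
      next
        case False
        then have "l = i" "Y = real u - c0" using C True by auto
        then have "topgap B i \<le> Y" using C(7) cl topg by auto
        then have "b * topgap B i \<le> b * Y" using ab by (simp add: mult_left_mono)
        moreover have "0 \<le> a * X" using ab C by simp
        ultimately show ?thesis by linarith
      qed
    next
      case False
      then have le: "topgap B j \<le> topgap B i" and MM: "Max (B i) \<le> Max (B j)" by (simp_all add: topg)
      show ?thesis
      proof (cases "c0 \<le> real (Max (B i))")
        case cj: True
        have "min (b * topgap B i) (a * topgap B j) \<le> b * Y + a * X"
          by (rule min_bound_sum[of b a Y X "real u - c0"]) (use C ab le cj topg in auto)
        then show ?thesis by (simp add: min.commute add.commute)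
      next
        case False
        then have "l = j" "X = real u - c0" using C MM by auto
        then have "topgap B j \<le> X" using C(7) cl topg by auto
        then have "a * topgap B j \<le> a * X" using ab by (simp add: mult_left_mono)
        moreover have "0 \<le> b * Y" using ab C by simp
        ultimately show ?thesis by linarith
      qed
    qed
    then show ?thesis using C unfolding corner_support_def by linarith
  qed
qed

text \<open>In \<open>along_base\<close> and \<open>swap\<close> the gain is the displacement of the point at height \<open>2\<close>, and in \<open>turn\<close> and
  \<open>widen\<close> both are zero. So the gains add up to the length of the top edge.\<close>
theorem mixed_area_total:
  assumes S: "mixed_subdivision B S" and fin: "\<And>l. finite (B l)" and ne: "\<And>l. B l \<noteq> {}" and zero: "0 \<in> B k0"
  shows "sum (mixed_area B S) UNIV = real (Max (\<Union>l. B l))" "mixed_area B S l \<in> \<int>" "0 \<le> mixed_area B S l"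
proof -
  define I :: "3 \<times> nat \<times> 3 \<times> nat \<Rightarrow> (3 \<Rightarrow> real) \<Rightarrow> bool"
    where "I s E \<longleftrightarrow> sum E UNIV = real (fst (snd s)) \<and> (\<forall>l. E l \<in> \<int> \<and> 0 \<le> E l)" for s E
  obtain m n c where *: "I (m, Max (\<Union>l. B l), n, c) (mixed_area B S)"
  proof (rule strip_path_invariant[OF S fin ne zero, where Inv = I])
    show "I (m, 0, l, c) (\<lambda>_. 0)" for m l c by (simp add: I_def)
  next
    fix R s s' o' g E
    assume st: "cell_step B R s s' o' g" and I: "I s E"
    have "sum (E(o' := E o' + g)) UNIV = sum E UNIV + g"
    proof -
      have "sum (E(o' := E o' + g)) UNIV = (E o' + g) + sum (E(o' := E o' + g)) (UNIV - {o'})"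
        by (subst sum.remove[of _ o']) auto
      also have "sum (E(o' := E o' + g)) (UNIV - {o'}) = sum E (UNIV - {o'})" by (rule sum.cong) auto
      also have "(E o' + g) + sum E (UNIV - {o'}) = sum E UNIV + g" by (simp add: sum.remove[of UNIV o' E])
      finally show ?thesis .
    qed
    moreover have "real (fst (snd s')) = real (fst (snd s)) + g" using st by (auto elim!: cell_step.cases)
    ultimately show "I s' (E(o' := E o' + g))" using I cell_step_gain[OF st] by (simp add: I_def)
  qed (use that in blast)
  then show "sum (mixed_area B S) UNIV = real (Max (\<Union>l. B l))" "mixed_area B S l \<in> \<int>" "0 \<le> mixed_area B S l"
    by (simp_all add: I_def)
qed

section \<open>Regular mixed subdivisions\<close>

text \<open>The points of \<open>A l\<close> are lifted to the heights \<open>w l\<close>. The functional \<open>(a, 1)\<close> is minimal on a face of each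
  lifted polytope, and \<open>lowface\<close> is the projection of this face.\<close>
definition lowface :: "(3 \<Rightarrow> (real \<times> real) set) \<Rightarrow> (3 \<Rightarrow> real \<times> real \<Rightarrow> real) \<Rightarrow> real \<times> real \<Rightarrow> 3 \<Rightarrow> (real \<times> real) set" where
  "lowface A w a l = convex hull {p \<in> A l. \<forall>q\<in>A l. w l p + a \<bullet> p \<le> w l q + a \<bullet> q}"

definition lowmin :: "(3 \<Rightarrow> (real \<times> real) set) \<Rightarrow> (3 \<Rightarrow> real \<times> real \<Rightarrow> real) \<Rightarrow> real \<times> real \<Rightarrow> 3 \<Rightarrow> real" where
  "lowmin A w a l = Min ((\<lambda>p. w l p + a \<bullet> p) ` A l)"

definition lifted :: "(3 \<Rightarrow> (real \<times> real) set) \<Rightarrow> (3 \<Rightarrow> real \<times> real \<Rightarrow> real) \<Rightarrow> 3 \<Rightarrow> ((real \<times> real) \<times> real) set" where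
  "lifted A w l = convex hull ((\<lambda>p. (p, w l p)) ` A l)"

definition regular_cells :: "(3 \<Rightarrow> (real \<times> real) set) \<Rightarrow> (3 \<Rightarrow> real \<times> real \<Rightarrow> real) \<Rightarrow> (3 \<Rightarrow> (real \<times> real) set) set" where
  "regular_cells A w = {lowface A w a | a. aff_dim (msum (lowface A w a)) = 2}"

context
  fixes A :: "3 \<Rightarrow> (real \<times> real) set" and w :: "3 \<Rightarrow> real \<times> real \<Rightarrow> real"
  assumes finA: "\<And>l. finite (A l)" and neA: "\<And>l. A l \<noteq> {}"
begin

lemma lowmin_le: "p \<in> A l \<Longrightarrow> lowmin A w a l \<le> w l p + a \<bullet> p"
  using finA by (simp add: lowmin_def)

lemma lowmin_attained:
  obtains p where "p \<in> A l" "w l p + a \<bullet> p = lowmin A w a l"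
proof -
  have "lowmin A w a l \<in> (\<lambda>p. w l p + a \<bullet> p) ` A l" unfolding lowmin_def using finA neA by (intro Min_in) auto
  then show ?thesis using that by force
qed

lemma minimizer_iff: "(\<forall>q\<in>A l. w l p + a \<bullet> p \<le> w l q + a \<bullet> q) \<longleftrightarrow> w l p + a \<bullet> p = lowmin A w a l" if "p \<in> A l"
proof -
  obtain q where "q \<in> A l" "w l q + a \<bullet> q = lowmin A w a l" using lowmin_attained by blast
  then show ?thesis using lowmin_le[of _ l a] that by fastforce
qed

lemma lowface_eq: "lowface A w a l = convex hull {p \<in> A l. w l p + a \<bullet> p = lowmin A w a l}"
proof -
  have "{p \<in> A l. \<forall>q\<in>A l. w l p + a \<bullet> p \<le> w l q + a \<bullet> q} = {p \<in> A l. w l p + a \<bullet> p = lowmin A w a l}"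
    using minimizer_iff by blast
  then show ?thesis by (simp add: lowface_def)
qed

lemma lifted_ge:
  assumes "(q, z) \<in> lifted A w l"
  shows "lowmin A w a l \<le> z + a \<bullet> q"
proof -
  have "lifted A w l \<subseteq> {v. (a, 1) \<bullet> v \<ge> lowmin A w a l}"
    unfolding lifted_def
  proof (rule hull_minimal)
    show "(\<lambda>p. (p, w l p)) ` A l \<subseteq> {v. (a, 1) \<bullet> v \<ge> lowmin A w a l}"
      using lowmin_le[of _ l a] by (auto simp: inner_Pair add.commute)
    show "convex {v. (a, 1) \<bullet> v \<ge> lowmin A w a l}" by (rule convex_halfspace_ge)
  qed
  then show ?thesis using assms by (auto simp: inner_Pair add.commute)
qed

lemma lowface_lift:
  assumes "q \<in> lowface A w a l"
  shows "(q, lowmin A w a l - a \<bullet> q) \<in> lifted A w l"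
proof -
  let ?T = "{q. (q, lowmin A w a l - a \<bullet> q) \<in> lifted A w l}"
  have "convex ?T"
  proof (rule convexI)
    fix x y and s t :: real assume xy: "x \<in> ?T" "y \<in> ?T" and st: "0 \<le> s" "0 \<le> t" "s + t = 1"
    have "s *\<^sub>R (x, lowmin A w a l - a \<bullet> x) + t *\<^sub>R (y, lowmin A w a l - a \<bullet> y) \<in> lifted A w l"
      using xy st by (intro convexD) (auto simp: lifted_def)
    moreover have "s * (lowmin A w a l - a \<bullet> x) + t * (lowmin A w a l - a \<bullet> y) = lowmin A w a l - a \<bullet> (s *\<^sub>R x + t *\<^sub>R y)"
    proof -
      have "s * (lowmin A w a l - a \<bullet> x) + t * (lowmin A w a l - a \<bullet> y) = (s + t) * lowmin A w a l - (s * (a \<bullet> x) + t * (a \<bullet> y))"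
        by (simp add: algebra_simps)
      then show ?thesis using st by (simp add: inner_add_right)
    qed
    ultimately show "s *\<^sub>R x + t *\<^sub>R y \<in> ?T" by simp
  qed
  moreover have "{p \<in> A l. w l p + a \<bullet> p = lowmin A w a l} \<subseteq> ?T"
    by (auto simp: lifted_def intro!: hull_inc)
  ultimately have "lowface A w a l \<subseteq> ?T" unfolding lowface_eq by (intro hull_minimal)
  then show ?thesis using assms by blast
qed

lemma lifted_eq_lowface:
  assumes "(q, z) \<in> lifted A w l" "z + a \<bullet> q = lowmin A w a l"
  shows "q \<in> lowface A w a l"
proof -
  let ?X = "(\<lambda>p. (p, w l p)) ` A l"
  let ?H = "{v. (a, 1) \<bullet> v = lowmin A w a l}"
  have face: "convex hull ?X \<inter> ?H face_of convex hull ?X"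
  proof (rule face_of_Int_supporting_hyperplane_ge[OF convex_convex_hull])
    fix v assume v: "v \<in> convex hull ?X"
    obtain q z where "v = (q, z)" by (cases v)
    then show "lowmin A w a l \<le> (a, 1) \<bullet> v"
      using lifted_ge[of q z l a] v by (simp add: lifted_def inner_Pair add.commute)
  qed
  obtain X' where X': "X' \<subseteq> ?X" "convex hull ?X \<inter> ?H = convex hull X'"
    by (rule face_of_convex_hull_subset[OF finite_imp_compact[OF finite_imageI[OF finA]] face])
  have "fst ` X' \<subseteq> {p \<in> A l. w l p + a \<bullet> p = lowmin A w a l}"
  proof
    fix p assume "p \<in> fst ` X'"
    then have m: "(p, w l p) \<in> X'" "p \<in> A l" using X'(1) by auto
    have "(p, w l p) \<in> convex hull X'" using m(1) by (rule hull_inc)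
    then have "(p, w l p) \<in> ?H" unfolding X'(2)[symmetric] by simp
    then show "p \<in> {p \<in> A l. w l p + a \<bullet> p = lowmin A w a l}" using m(2) by (simp add: inner_Pair add.commute)
  qed
  then have "convex hull (fst ` X') \<subseteq> lowface A w a l" unfolding lowface_eq by (rule hull_mono)
  moreover have "(q, z) \<in> convex hull X'"
    unfolding X'(2)[symmetric] using assms by (simp add: lifted_def inner_Pair add.commute)
  then have "q \<in> fst ` (convex hull X')" by (rule rev_image_eqI) simp
  then have "q \<in> convex hull (fst ` X')" by (simp add: convex_hull_linear_image linear_fst)
  ultimately show ?thesis by blast
qed

lemma convex_lowface: "convex (lowface A w a l)"
  by (simp add: lowface_def)

lemma lowface_shift_ge:
  assumes "q \<in> lowface A w a l"
  shows "lowmin A w a' l - lowmin A w a l \<le> (a' - a) \<bullet> q"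
  using lifted_ge[OF lowface_lift[OF assms], of a'] by (simp add: inner_diff_left)

text \<open>Passing from \<open>a\<close> to \<open>a'\<close>, the affine functional on the right cuts the common part with another lower
  face out of a lower face. All intersection properties of the cells follow from this.\<close>
lemma lowface_shift_eq:
  assumes "q \<in> lowface A w a l"
  shows "q \<in> lowface A w a' l \<longleftrightarrow> (a' - a) \<bullet> q = lowmin A w a' l - lowmin A w a l"
proof
  assume "q \<in> lowface A w a' l"
  then have "lowmin A w a l - lowmin A w a' l \<le> (a - a') \<bullet> q" by (rule lowface_shift_ge)
  then show "(a' - a) \<bullet> q = lowmin A w a' l - lowmin A w a l"
    using lowface_shift_ge[OF assms, of a'] by (simp add: inner_diff_left)
next
  assume "(a' - a) \<bullet> q = lowmin A w a' l - lowmin A w a l"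
  then show "q \<in> lowface A w a' l"
    by (intro lifted_eq_lowface[OF lowface_lift[OF assms]]) (simp add: inner_diff_left)
qed

lemma lowface_Int: "lowface A w a l \<inter> lowface A w a' l =
    lowface A w a l \<inter> {q. (a' - a) \<bullet> q = lowmin A w a' l - lowmin A w a l}"
  using lowface_shift_eq by blast

lemma lowface_Int_face: "lowface A w a l \<inter> lowface A w a' l face_of lowface A w a l"
  unfolding lowface_Int using lowface_shift_ge convex_lowface by (intro face_of_Int_supporting_hyperplane_ge)

lemma inner_sum_UNIV: "c \<bullet> sum f UNIV = (\<Sum>l\<in>UNIV. c \<bullet> f l)"
  by (rule inner_sum_right)

lemma msum_lowface_Int:
  "msum (lowface A w a) \<inter> msum (lowface A w a') = msum (\<lambda>l. lowface A w a l \<inter> lowface A w a' l)"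
proof
  show "msum (\<lambda>l. lowface A w a l \<inter> lowface A w a' l) \<subseteq> msum (lowface A w a) \<inter> msum (lowface A w a')"
    unfolding msum_def by blast
  show "msum (lowface A w a) \<inter> msum (lowface A w a') \<subseteq> msum (\<lambda>l. lowface A w a l \<inter> lowface A w a' l)"
  proof
    fix p assume p: "p \<in> msum (lowface A w a) \<inter> msum (lowface A w a')"
    obtain f where f: "\<And>l. f l \<in> lowface A w a l" "p = sum f UNIV" using p msum_memE by blast
    obtain g where g: "\<And>l. g l \<in> lowface A w a' l" "p = sum g UNIV" using p msum_memE by blast
    define z where "z l = lowmin A w a l - a \<bullet> f l" for l
    define y where "y l = lowmin A w a' l - a' \<bullet> g l" for l
    have lz: "(f l, z l) \<in> lifted A w l" and ly: "(g l, y l) \<in> lifted A w l" for l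
      using lowface_lift f g by (auto simp: z_def y_def)
    have "0 \<le> z l + a' \<bullet> f l - lowmin A w a' l" for l using lifted_ge[OF lz] by simp
    then have "0 \<le> (\<Sum>l\<in>UNIV. z l + a' \<bullet> f l - lowmin A w a' l)" by (intro sum_nonneg)
    also have "\<dots> = sum z UNIV + a' \<bullet> p - (\<Sum>l\<in>UNIV. lowmin A w a' l)"
      by (simp add: sum.distrib sum_subtractf inner_sum_UNIV f(2))
    also have "\<dots> = sum z UNIV - sum y UNIV"
      by (simp add: y_def sum_subtractf g(2) inner_sum_UNIV)
    finally have 1: "sum y UNIV \<le> sum z UNIV" by simp
    have nn: "0 \<le> y l + a \<bullet> g l - lowmin A w a l" for l using lifted_ge[OF ly] by simp
    have "(\<Sum>l\<in>UNIV. y l + a \<bullet> g l - lowmin A w a l) = sum y UNIV + a \<bullet> p - (\<Sum>l\<in>UNIV. lowmin A w a l)"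
      by (simp add: sum.distrib sum_subtractf inner_sum_UNIV g(2))
    also have "\<dots> = sum y UNIV - sum z UNIV" by (simp add: z_def sum_subtractf f(2) inner_sum_UNIV)
    finally have "(\<Sum>l\<in>UNIV. y l + a \<bullet> g l - lowmin A w a l) \<le> 0" using 1 by simp
    moreover have "0 \<le> (\<Sum>l\<in>UNIV. y l + a \<bullet> g l - lowmin A w a l)" by (rule sum_nonneg) (rule nn)
    ultimately have "(\<Sum>l\<in>UNIV. y l + a \<bullet> g l - lowmin A w a l) = 0" by simp
    then have "y l + a \<bullet> g l - lowmin A w a l = 0" for l using nn by (simp add: sum_nonneg_eq_0_iff)
    then have "g l \<in> lowface A w a l" for l using lifted_eq_lowface[OF ly] by simp
    then show "p \<in> msum (\<lambda>l. lowface A w a l \<inter> lowface A w a' l)"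
      using g by (intro msum_memI[of g]) auto
  qed
qed

lemma msum_shift_ge:
  assumes "p \<in> msum (lowface A w a)"
  shows "(\<Sum>l\<in>UNIV. lowmin A w a' l - lowmin A w a l) \<le> (a' - a) \<bullet> p"
proof -
  obtain f where f: "\<And>l. f l \<in> lowface A w a l" "p = sum f UNIV" using assms msum_memE by blast
  show ?thesis unfolding f(2) inner_sum_UNIV by (rule sum_mono) (rule lowface_shift_ge[OF f(1)])
qed

lemma msum_shift_eq:
  assumes "p \<in> msum (lowface A w a)"
  shows "p \<in> msum (lowface A w a') \<longleftrightarrow> (a' - a) \<bullet> p = (\<Sum>l\<in>UNIV. lowmin A w a' l - lowmin A w a l)"
proof
  assume "p \<in> msum (lowface A w a')"
  then have "p \<in> msum (\<lambda>l. lowface A w a l \<inter> lowface A w a' l)" using assms msum_lowface_Int by blast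
  then obtain f where f: "\<And>l. f l \<in> lowface A w a l \<inter> lowface A w a' l" "p = sum f UNIV" using msum_memE by blast
  show "(a' - a) \<bullet> p = (\<Sum>l\<in>UNIV. lowmin A w a' l - lowmin A w a l)"
    unfolding f(2) inner_sum_UNIV by (rule sum.cong[OF refl]) (use lowface_shift_eq f(1) in blast)
next
  assume e: "(a' - a) \<bullet> p = (\<Sum>l\<in>UNIV. lowmin A w a' l - lowmin A w a l)"
  obtain f where f: "\<And>l. f l \<in> lowface A w a l" "p = sum f UNIV" using assms msum_memE by blast
  have nn: "0 \<le> (a' - a) \<bullet> f l - (lowmin A w a' l - lowmin A w a l)" for l using lowface_shift_ge[OF f(1)] by simp
  have "(\<Sum>l\<in>UNIV. (a' - a) \<bullet> f l - (lowmin A w a' l - lowmin A w a l)) = 0"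
    using e unfolding f(2) inner_sum_UNIV by (simp only: sum_subtractf)
  then have "(a' - a) \<bullet> f l - (lowmin A w a' l - lowmin A w a l) = 0" for l using nn by (simp only: sum_nonneg_eq_0_iff finite UNIV_I) 
  then have "f l \<in> lowface A w a' l" for l using lowface_shift_eq[OF f(1)] by simp
  then show "p \<in> msum (lowface A w a')" using f by (intro msum_memI[of f]) auto
qed

lemma msum_lowface_face: "msum (lowface A w a) \<inter> msum (lowface A w a') face_of msum (lowface A w a)"
proof -
  have eq: "msum (lowface A w a) \<inter> msum (lowface A w a') =
      msum (lowface A w a) \<inter> {p. (a' - a) \<bullet> p = (\<Sum>l\<in>UNIV. lowmin A w a' l - lowmin A w a l)}"
    using msum_shift_eq by blast
  show ?thesis unfolding eq
    by (rule face_of_Int_supporting_hyperplane_ge[OF convex_msum[OF convex_lowface] msum_shift_ge])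
qed

lemma regular_cells_intersect:
  "intersect_properly (lowface A w a) (lowface A w a')"
  unfolding intersect_properly_def
  using lowface_Int_face[of a _ a'] lowface_Int_face[of a' _ a] msum_lowface_face[of a a'] msum_lowface_face[of a' a]
    msum_lowface_Int[of a a'] by (simp add: Int_commute)

lemma regular_cells_interior:
  assumes "lowface A w a \<noteq> lowface A w a'"
  shows "interior (msum (lowface A w a)) \<inter> interior (msum (lowface A w a')) = {}"
proof -
  have "a' - a \<noteq> 0" using assms by auto
  have "msum (lowface A w a) \<inter> msum (lowface A w a') \<subseteq>
      {p. (a' - a) \<bullet> p = (\<Sum>l\<in>UNIV. lowmin A w a' l - lowmin A w a l)}"
    using msum_shift_eq by blast
  then have "interior (msum (lowface A w a) \<inter> msum (lowface A w a')) \<subseteq> interior {p. (a' - a) \<bullet> p = (\<Sum>l\<in>UNIV. lowmin A w a' l - lowmin A w a l)}"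
    by (rule interior_mono)
  also have "\<dots> = {}" using \<open>a' - a \<noteq> 0\<close> by (rule interior_hyperplane)
  finally show ?thesis by (simp add: interior_Int)
qed

text \<open>The lifted sum has a lowest point over \<open>p\<close>. A hyperplane that separates it from the points below it is
  not vertical, because \<open>p\<close> is an interior point, and its slope is the functional \<open>a\<close>.\<close>
lemma supporting_functional:
  assumes p: "p \<in> interior (msum (\<lambda>l. convex hull A l))"
  obtains a where "p \<in> msum (lowface A w a)"
proof -
  define G where "G = (\<Union>x\<in>(\<Union>x\<in>lifted A w 0. \<Union>y\<in>lifted A w 1. {x + y}). \<Union>z\<in>lifted A w 2. {x + z})"
  have Lc: "compact (lifted A w l)" "convex (lifted A w l)" for l
    unfolding lifted_def using finA by (auto intro!: finite_imp_compact_convex_hull)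
  have ne: "(0::3) \<noteq> 1" "(1::3) \<noteq> 2" "(0::3) \<noteq> 2" by auto
  have S3: "sum f UNIV = f 0 + f 1 + f 2" for f :: "3 \<Rightarrow> 'z::comm_monoid_add" by (rule sum_UNIV_3_distinct[OF ne])
  have Gc: "compact G" unfolding G_def by (intro compact_sums' Lc)
  have Gv: "convex G" unfolding G_def by (intro convex_sums Lc)
  have GI: "sum v UNIV \<in> G" if "\<And>l. v l \<in> lifted A w l" for v unfolding S3 G_def using that by blast
  have GE: "\<exists>v. (\<forall>l. v l \<in> lifted A w l) \<and> x = sum v UNIV" if x': "x \<in> G" for x
  proof -
    obtain x0 x1 x2 where x: "x0 \<in> lifted A w 0" "x1 \<in> lifted A w 1" "x2 \<in> lifted A w 2" "x = x0 + x1 + x2"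
      using x' unfolding G_def by blast
    define v where "v = (\<lambda>l::3. if l = 0 then x0 else if l = 1 then x1 else x2)"
    have "v l \<in> lifted A w l" for l using distinct_3_cases(1)[OF ne, of l] x by (auto simp: v_def)
    moreover have "x = sum v UNIV" unfolding S3 by (simp add: v_def x)
    ultimately show ?thesis by blast
  qed
  have proj: "\<exists>z. (q, z) \<in> G" if q: "q \<in> msum (\<lambda>l. convex hull A l)" for q
  proof -
    obtain f where f: "\<And>l. f l \<in> convex hull A l" "q = sum f UNIV" using q msum_memE by blast
    have "\<exists>z. (f l, z) \<in> lifted A w l" for l
    proof -
      have "fst ` lifted A w l = convex hull (fst ` (\<lambda>p. (p, w l p)) ` A l)"
        unfolding lifted_def by (simp add: convex_hull_linear_image linear_fst)
      then have "convex hull A l = fst ` lifted A w l" by (simp add: image_image)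
      then show ?thesis using f(1)[of l] by force
    qed
    then obtain z where z: "\<And>l. (f l, z l) \<in> lifted A w l" by metis
    have "(\<Sum>l\<in>UNIV. (f l, z l)) = (q, sum z UNIV)" by (simp add: f(2) sum_prod)
    then show ?thesis using GI[of "\<lambda>l. (f l, z l)"] z by metis
  qed
  define K where "K = G \<inter> {v. fst v = p}"
  have "compact K" unfolding K_def using Gc by (intro compact_Int_closed closed_Collect_eq continuous_intros)
  moreover have "K \<noteq> {}" using proj[of p] p interior_subset by (force simp: K_def)
  ultimately obtain v0 where v0: "v0 \<in> K" "\<And>v. v \<in> K \<Longrightarrow> snd v0 \<le> snd v"
    using continuous_attains_inf[of K snd] continuous_on_snd[OF continuous_on_id] by blast
  define z0 where "z0 = snd v0"
  have v0G: "(p, z0) \<in> G" using v0(1) by (auto simp: K_def z0_def)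
  have zmin: "z0 \<le> z" if "(p, z) \<in> G" for z using v0(2)[of "(p, z)"] that by (simp add: K_def z0_def)
  define T where "T = {p} \<times> {..<z0}"
  have "convex T" "T \<noteq> {}" by (auto simp: T_def convex_Times) 
  moreover have "G \<inter> T = {}" using zmin by (force simp: T_def)
  ultimately obtain n \<beta> where n: "n \<noteq> 0" "\<And>x. x \<in> G \<Longrightarrow> n \<bullet> x \<le> \<beta>" "\<And>x. x \<in> T \<Longrightarrow> \<beta> \<le> n \<bullet> x"
    using separating_hyperplane_sets[of G T] Gv v0G by blast
  obtain n1 \<tau> where nn: "n = (n1, \<tau>)" by (cases n)
  have below: "\<beta> \<le> n1 \<bullet> p + \<tau> * t" if "t < z0" for t
    using n(3)[of "(p, t)"] that by (simp add: T_def nn inner_Pair)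
  have top: "n1 \<bullet> p + \<tau> * z0 \<le> \<beta>" using n(2)[OF v0G] by (simp add: nn inner_Pair)
  have tau: "\<tau> \<le> 0" using below[of "z0 - 1"] top by (simp add: algebra_simps)
  have eq: "n1 \<bullet> p + \<tau> * z0 = \<beta>"
  proof (rule ccontr)
    assume "n1 \<bullet> p + \<tau> * z0 \<noteq> \<beta>"
    then have gap: "0 < \<beta> - (n1 \<bullet> p + \<tau> * z0)" using top by simp
    define d where "d = (\<beta> - (n1 \<bullet> p + \<tau> * z0)) / (2 * (1 - \<tau>))"
    have d: "0 < d" using gap tau by (simp add: d_def)
    have "\<beta> \<le> n1 \<bullet> p + \<tau> * (z0 - d)" using below[of "z0 - d"] d by simp
    then have "\<beta> - (n1 \<bullet> p + \<tau> * z0) \<le> (- \<tau>) * d" by (simp add: algebra_simps)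
    also have "\<dots> \<le> (1 - \<tau>) * d" using d by (intro mult_right_mono) auto
    also have "\<dots> = (\<beta> - (n1 \<bullet> p + \<tau> * z0)) / 2" unfolding d_def using tau by (simp add: field_simps)
    finally show False using gap by simp
  qed
  have tau': "\<tau> < 0"
  proof (rule ccontr)
    assume "\<not> \<tau> < 0"
    then have t0: "\<tau> = 0" using tau by simp
    then have n1: "n1 \<noteq> 0" using n(1) nn by (simp add: zero_prod_def)
    obtain e where e: "e > 0" "ball p e \<subseteq> msum (\<lambda>l. convex hull A l)" using p mem_interior by blast
    define q where "q = p + (e / (2 * norm n1)) *\<^sub>R n1"
    have "dist p q < e" using e n1 by (simp add: q_def dist_norm)
    then have "q \<in> ball p e" by simp
    then have "q \<in> msum (\<lambda>l. convex hull A l)" by (rule subsetD[OF e(2)])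
    from proj[OF this] obtain z where "(q, z) \<in> G" by blast
    then have "n1 \<bullet> q \<le> n1 \<bullet> p" using n(2)[of "(q, z)"] eq by (simp add: nn inner_Pair t0)
    then have "(e / (2 * norm n1)) * (n1 \<bullet> n1) \<le> 0" by (simp add: q_def inner_add_right)
    moreover have "0 < (e / (2 * norm n1)) * (n1 \<bullet> n1)" using e n1 by simp
    ultimately show False by linarith
  qed
  define a where "a = (1 / \<tau>) *\<^sub>R n1"
  have ineq: "z0 + a \<bullet> p \<le> z + a \<bullet> q" if "(q, z) \<in> G" for q z
  proof -
    have "n1 \<bullet> q + \<tau> * z \<le> n1 \<bullet> p + \<tau> * z0" using n(2)[OF that] eq by (simp add: nn inner_Pair)
    then have "(n1 \<bullet> p + \<tau> * z0) / \<tau> \<le> (n1 \<bullet> q + \<tau> * z) / \<tau>" using tau' by (simp add: divide_right_mono_neg)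
    then show ?thesis using tau' by (simp add: a_def add_divide_distrib add.commute)
  qed
  obtain v where v: "\<And>l. v l \<in> lifted A w l" "(p, z0) = sum v UNIV" using GE[OF v0G] by blast
  define f where "f l = fst (v l)" for l
  define z where "z l = snd (v l)" for l
  have vl: "(f l, z l) \<in> lifted A w l" for l using v(1)[of l] by (simp add: f_def z_def)
  have pf: "p = sum f UNIV" and zz: "z0 = sum z UNIV"
    using v(2) by (metis (no_types, lifting) f_def fst_conv fst_sum sum.cong, metis (no_types, lifting) z_def snd_conv snd_sum sum.cong)
  have "\<forall>l. \<exists>p. p \<in> A l \<and> w l p + a \<bullet> p = lowmin A w a l"
  proof
    fix l
    obtain p where "p \<in> A l" "w l p + a \<bullet> p = lowmin A w a l" by (rule lowmin_attained)
    then show "\<exists>p. p \<in> A l \<and> w l p + a \<bullet> p = lowmin A w a l" by blast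
  qed
  from choice[OF this] obtain g where g: "\<And>l. g l \<in> A l" "\<And>l. w l (g l) + a \<bullet> g l = lowmin A w a l" by blast
  have "(\<Sum>l\<in>UNIV. (g l, w l (g l))) \<in> G" using g(1) by (intro GI) (auto simp: lifted_def intro!: hull_inc)
  then have "(sum g UNIV, \<Sum>l\<in>UNIV. w l (g l)) \<in> G" by (simp add: sum_prod)
  then have "z0 + a \<bullet> p \<le> (\<Sum>l\<in>UNIV. w l (g l)) + a \<bullet> sum g UNIV" by (rule ineq)
  also have "\<dots> = (\<Sum>l\<in>UNIV. lowmin A w a l)" unfolding inner_sum_UNIV sum.distrib[symmetric] g(2) ..
  finally have le: "z0 + a \<bullet> p \<le> (\<Sum>l\<in>UNIV. lowmin A w a l)" .
  have nng: "0 \<le> z l + a \<bullet> f l - lowmin A w a l" for l using lifted_ge[OF vl] by simp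
  have "(\<Sum>l\<in>UNIV. z l + a \<bullet> f l - lowmin A w a l) = z0 + a \<bullet> p - (\<Sum>l\<in>UNIV. lowmin A w a l)"
    by (simp add: sum.distrib sum_subtractf pf zz inner_sum_UNIV)
  moreover have "0 \<le> (\<Sum>l\<in>UNIV. z l + a \<bullet> f l - lowmin A w a l)" by (rule sum_nonneg) (rule nng)
  ultimately have "(\<Sum>l\<in>UNIV. z l + a \<bullet> f l - lowmin A w a l) = 0" using le by simp
  then have "z l + a \<bullet> f l - lowmin A w a l = 0" for l using nng by (simp add: sum_nonneg_eq_0_iff)
  then have "f l \<in> lowface A w a l" for l using lifted_eq_lowface[OF vl] by simp
  then have "p \<in> msum (lowface A w a)" using pf by (intro msum_memI[of f]) auto
  then show ?thesis using that by blast
qed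

text \<open>The sums of lower faces that are not full-dimensional form a finite union of flat sets. So the full-dimensional
  ones cover the interior up to a negligible set, and being closed they cover everything.\<close>
theorem regular_mixed_subdivision:
  assumes sub: "\<And>l. A l \<subseteq> suppA B l" and hull: "\<And>l. convex hull A l = convex hull suppA B l"
    and int: "interior (bigC B) \<noteq> {}"
    and tight: "\<And>a. aff_dim (msum (lowface A w a)) = 2 \<Longrightarrow> tight_cell (lowface A w a)"
  shows "mixed_subdivision B (regular_cells A w)"
proof -
  define F where "F = {R. \<forall>l. R l \<in> (\<lambda>V. convex hull V) ` (Pow (A l) - {{}})}"
  have finF: "finite F"
  proof -
    have "finite (PiE UNIV (\<lambda>l. (\<lambda>V. convex hull V) ` (Pow (A l) - {{}})))"
      using finA by (intro finite_PiE) auto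
    moreover have "F \<subseteq> PiE UNIV (\<lambda>l. (\<lambda>V. convex hull V) ` (Pow (A l) - {{}}))"
      by (auto simp: F_def PiE_def extensional_def)
    ultimately show ?thesis by (rule finite_subset[rotated])
  qed
  have minne: "{p \<in> A l. w l p + a \<bullet> p = lowmin A w a l} \<noteq> {}" for a l using lowmin_attained by blast
  have lowF: "lowface A w a \<in> F" for a
    unfolding F_def lowface_eq using minne by (intro CollectI allI imageI) blast
  have "regular_cells A w \<subseteq> F" using lowF by (auto simp: regular_cells_def)
  then have fin: "finite (regular_cells A w)" using finF finite_subset by blast
  have Fc: "compact (msum R)" "convex (msum R)" if "R \<in> F" for R
  proof -
    have "compact (R l) \<and> convex (R l)" for l
    proof -
      obtain V where V: "V \<subseteq> A l" "R l = convex hull V" using \<open>R \<in> F\<close> unfolding F_def by blast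
      have "finite V" using V(1) finA by (rule finite_subset)
      then show ?thesis unfolding V(2) by (simp add: finite_imp_compact_convex_hull)
    qed
    then show "compact (msum R)" "convex (msum R)" using compact_msum convex_msum by blast+
  qed
  have C: "bigC B = msum (\<lambda>l. convex hull A l)" by (simp add: bigC_def hull)
  define N where "N = \<Union> (msum ` {R \<in> F. aff_dim (msum R) \<noteq> 2})"
  have negN: "negligible N"
    unfolding N_def
  proof (rule negligible_Union)
    show "finite (msum ` {R \<in> F. aff_dim (msum R) \<noteq> 2})" using finF by simp
    fix X assume "X \<in> msum ` {R \<in> F. aff_dim (msum R) \<noteq> 2}"
    then obtain R where R: "R \<in> F" "aff_dim (msum R) \<noteq> 2" "X = msum R" by blast
    have "interior (msum R) = {}"
    proof (rule ccontr)
      assume "interior (msum R) \<noteq> {}"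
      then have "aff_dim (msum R) = int (DIM(real \<times> real))" by (rule aff_dim_nonempty_interior)
      then show False using R by simp
    qed
    then show "negligible X" using R Fc negligible_convex_interior by blast
  qed
  define K where "K = (\<Union>R\<in>regular_cells A w. msum R)"
  have Kcl: "closed K" unfolding K_def using fin Fc \<open>regular_cells A w \<subseteq> F\<close> by (intro closed_UN) (auto intro: compact_imp_closed)
  have sub1: "interior (bigC B) - N \<subseteq> K"
  proof
    fix p assume p: "p \<in> interior (bigC B) - N"
    then obtain a where a: "p \<in> msum (lowface A w a)" using supporting_functional[of p] unfolding C by blast
    then have "aff_dim (msum (lowface A w a)) = 2" using p lowF[of a] unfolding N_def by blast
    then show "p \<in> K" using a unfolding K_def regular_cells_def by blast
  qed
  have sub2: "interior (bigC B) \<subseteq> K"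
  proof
    fix p assume p: "p \<in> interior (bigC B)"
    have "p \<in> closure K"
    proof (subst closure_approachable, intro allI impI)
      fix e :: real assume e: "0 < e"
      have "p \<in> ball p e \<inter> interior (bigC B)" using p e by simp
      then have "ball p e \<inter> interior (bigC B) \<noteq> {}" by blast
      moreover have "open (ball p e \<inter> interior (bigC B))" by (intro open_Int open_ball open_interior)
      ultimately have "\<not> negligible (ball p e \<inter> interior (bigC B))" by (intro open_not_negligible)
      then have "\<not> ball p e \<inter> interior (bigC B) \<subseteq> N" using negN negligible_subset by blast
      then obtain q where "q \<in> ball p e" "q \<in> interior (bigC B) - N" by blast
      then show "\<exists>y\<in>K. dist y p < e" using sub1 by (auto simp: dist_commute)
    qed
    then show "p \<in> K" using Kcl by simp
  qed
  have Ccomp: "compact (bigC B)" unfolding C using finA by (intro compact_msum finite_imp_compact_convex_hull)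
  have "bigC B \<subseteq> closure (interior (bigC B))"
    using convex_closure_interior[OF convex_bigC int] closure_subset by metis
  also have "\<dots> \<subseteq> K" using sub2 Kcl by (rule closure_minimal)
  finally have CK: "bigC B \<subseteq> K" .
  have "K \<subseteq> bigC B"
  proof -
    have "lowface A w a l \<subseteq> convex hull A l" for a l unfolding lowface_def by (rule hull_mono) blast
    then show ?thesis unfolding K_def regular_cells_def C msum_def by blast
  qed
  then have cover: "(\<Union>R\<in>regular_cells A w. msum R) = bigC B" using CK by (simp add: K_def)
  have cell: "minkowski_cell B R \<and> tight_cell R" if R: "R \<in> regular_cells A w" for R
  proof -
    obtain a where a: "R = lowface A w a" "aff_dim (msum R) = 2" using R unfolding regular_cells_def by blast
    have "\<exists>V. V \<subseteq> suppA B l \<and> V \<noteq> {} \<and> R l = convex hull V" for l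
      using minne[of l a] sub[of l] by (intro exI[of _ "{p \<in> A l. w l p + a \<bullet> p = lowmin A w a l}"]) (auto simp: a lowface_eq)
    then show ?thesis using a tight[of a] unfolding minkowski_cell_def by simp
  qed
  show ?thesis unfolding mixed_subdivision_def
  proof (intro conjI ballI impI)
    show "finite (regular_cells A w)" by (rule fin)
    show "(\<Union>R\<in>regular_cells A w. msum R) = bigC B" by (rule cover)
    show "minkowski_cell B R" "tight_cell R" if "R \<in> regular_cells A w" for R using cell[OF that] by simp_all
    fix R R' assume "R \<in> regular_cells A w" "R' \<in> regular_cells A w" and neq: "R \<noteq> R'"
    then obtain a a' where a: "R = lowface A w a" "R' = lowface A w a'" unfolding regular_cells_def by blast
    show "interior (msum R) \<inter> interior (msum R') = {}" using neq unfolding a by (rule regular_cells_interior)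
    show "intersect_properly R R'" unfolding a by (rule regular_cells_intersect)
  qed
qed

end

section \<open>Lifts of the end points\<close>
definition endsA :: "(3 \<Rightarrow> nat set) \<Rightarrow> 3 \<Rightarrow> (real \<times> real) set" where
  "endsA B l = {apex, (real (Min (B l)), 0), (real (Max (B l)), 0)}"

text \<open>The apexes stay at height \<open>0\<close>. A support with a single point is lifted by \<open>p\<close> alone.\<close>
definition endlift :: "(3 \<Rightarrow> nat set) \<Rightarrow> (3 \<Rightarrow> real) \<Rightarrow> (3 \<Rightarrow> real) \<Rightarrow> 3 \<Rightarrow> real \<times> real \<Rightarrow> real" where
  "endlift B p q l x = (if snd x = 1 then 0 else if fst x = real (Min (B l)) then p l else q l)"

text \<open>The height of the last point.\<close>
definition hicost :: "(3 \<Rightarrow> nat set) \<Rightarrow> (3 \<Rightarrow> real) \<Rightarrow> (3 \<Rightarrow> real) \<Rightarrow> 3 \<Rightarrow> real" where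
  "hicost B p q l = (if Min (B l) = Max (B l) then p l else q l)"

lemma endface_kinds:
  fixes B p q l \<alpha> \<beta>
  defines "lo \<equiv> real (Min (B l))" and "hi \<equiv> real (Max (B l))" and "R \<equiv> lowface (endsA B) (endlift B p q) (\<alpha>, \<beta>) l"
    and "P \<equiv> p l" and "Q \<equiv> hicost B p q l"
  assumes le: "Min (B l) \<le> Max (B l)"
  obtains (apex) "R = {apex}" "aff_dim R = 0" "\<beta> < \<alpha> * lo + P" "\<beta> < \<alpha> * hi + Q"
  | (point) b where "R = hseg b b" "aff_dim R = 0"
  | (base) "R = hseg lo hi" "aff_dim R = 1" "lo < hi" "\<alpha> * lo + P = \<alpha> * hi + Q" "\<alpha> * lo + P < \<beta>"
  | (slant_lo) "R = tent lo lo" "aff_dim R = 1" "\<beta> = \<alpha> * lo + P" "\<beta> \<le> \<alpha> * hi + Q" "lo < hi \<longrightarrow> \<beta> < \<alpha> * hi + Q"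
  | (slant_hi) "R = tent hi hi" "aff_dim R = 1" "lo < hi" "\<beta> = \<alpha> * hi + Q" "\<beta> < \<alpha> * lo + P"
  | (triangle) "R = tent lo hi" "aff_dim R = 2" "lo < hi" "\<beta> = \<alpha> * lo + P" "\<beta> = \<alpha> * hi + Q"
proof -
  have lohi: "lo \<le> hi" using le by (simp add: lo_def hi_def)
  define cost where "cost x = endlift B p q l x + (\<alpha>, \<beta>) \<bullet> x" for x
  have c1: "cost apex = \<beta>" by (simp add: cost_def endlift_def apex_def)
  have c2: "cost (lo, 0) = \<alpha> * lo + P" by (simp add: cost_def endlift_def lo_def P_def)
  have c3: "cost (hi, 0) = \<alpha> * hi + Q" by (simp add: cost_def endlift_def hi_def Q_def hicost_def P_def)
  have ne: "apex \<noteq> (x, 0)" for x by (simp add: apex_def)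
  have Aeq: "endsA B l = {apex, (lo, 0), (hi, 0)}" by (simp add: endsA_def lo_def hi_def)
  have R: "R = convex hull {x \<in> {apex, (lo, 0), (hi, 0)}. cost x \<le> \<beta> \<and> cost x \<le> \<alpha> * lo + P \<and> cost x \<le> \<alpha> * hi + Q}"
    unfolding R_def lowface_def Aeq by (simp add: cost_def[symmetric] c1 c2 c3)
  have same: "lo = hi \<Longrightarrow> P = Q" by (simp add: lo_def hi_def Q_def P_def hicost_def)
  have gen: "{x \<in> {a, b, c}. F x} = (if F a then {a} else {}) \<union> (if F b then {b} else {}) \<union> (if F c then {c} else {})"
    for a b c :: "real \<times> real" and F by auto
  have M: "{x \<in> {apex, (lo, 0), (hi, 0)}. cost x \<le> \<beta> \<and> cost x \<le> \<alpha> * lo + P \<and> cost x \<le> \<alpha> * hi + Q} =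
     (if \<beta> \<le> \<alpha> * lo + P \<and> \<beta> \<le> \<alpha> * hi + Q then {apex} else {}) \<union>
     (if \<alpha> * lo + P \<le> \<beta> \<and> \<alpha> * lo + P \<le> \<alpha> * hi + Q then {(lo, 0)} else {}) \<union>
     (if \<alpha> * hi + Q \<le> \<beta> \<and> \<alpha> * hi + Q \<le> \<alpha> * lo + P then {(hi, 0)} else {})"
    unfolding gen c1 c2 c3 by (simp only: order_refl simp_thms)
  have h1: "convex hull {(b, 0)} = hseg b b" for b by (simp add: hseg_point)
  have h2: "convex hull {(lo, 0), (hi, 0)} = hseg lo hi"
    using closed_segment_base[OF lohi] by (simp add: segment_convex_hull)
  have h3: "convex hull {apex, (b, 0)} = tent b b" "convex hull {(b, 0), apex} = tent b b" for b
    using hull_base_apex[of b b] by (simp_all add: insert_commute)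
  have h4: "convex hull {apex, (lo, 0), (hi, 0)} = tent lo hi" "convex hull {(hi, 0), (lo, 0), apex} = tent lo hi"
    using hull_base_apex[OF lohi] by (simp_all add: insert_commute)
  let ?L = "\<alpha> * lo + P" and ?H = "\<alpha> * hi + Q"
  consider "\<beta> < ?L" "\<beta> < ?H" | "?L < \<beta>" "?L < ?H" | "?H < \<beta>" "?H < ?L" | "?L < \<beta>" "?L = ?H"
    | "?L = \<beta>" "?L < ?H" | "?H = \<beta>" "?H < ?L" | "?L = \<beta>" "?L = ?H" by linarith
  then show ?thesis
  proof cases
    case 1
    then have "R = {apex}" unfolding R M by auto
    then show ?thesis using 1 apex by simp
  next
    case 2
    then have "R = hseg lo lo" unfolding R M by (auto simp: h1[symmetric])
    then show ?thesis using point[of lo] aff_dim_hseg[of lo lo] by simp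
  next
    case 3
    then have "R = hseg hi hi" unfolding R M by (auto simp: h1[symmetric])
    then show ?thesis using point[of hi] aff_dim_hseg[of hi hi] by simp
  next
    case 4
    then have RR: "R = hseg lo hi" unfolding R M by (auto simp: h2[symmetric] insert_commute)
    show ?thesis
    proof (cases "lo = hi")
      case True
      then show ?thesis using RR point[of lo] aff_dim_hseg[of lo lo] by simp
    next
      case False
      then show ?thesis using RR 4 base aff_dim_hseg[OF lohi] lohi by simp
    qed
  next
    case 5
    then have "R = tent lo lo" unfolding R M by (simp add: h3)
    then show ?thesis using 5 slant_lo aff_dim_tent[of lo lo] by simp
  next
    case 6
    then have RR: "R = tent hi hi" unfolding R M by (simp add: h3)
    have "lo \<noteq> hi" using 6 same by auto
    then show ?thesis using RR 6 slant_hi aff_dim_tent[of hi hi] lohi by simp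
  next
    case 7
    then have RR: "R = tent lo hi" unfolding R M by (simp add: h4)
    show ?thesis
    proof (cases "lo = hi")
      case True
      show ?thesis by (rule slant_lo) (use RR 7 True aff_dim_tent[of lo lo] in auto)
    next
      case False
      show ?thesis by (rule triangle) (use RR 7 False aff_dim_tent[OF lohi] lohi in auto)
    qed
  qed
qed

text \<open>Linear independence of the six heights over the integers.\<close>
definition zindep :: "(3 \<Rightarrow> real) \<Rightarrow> (3 \<Rightarrow> real) \<Rightarrow> bool" where
  "zindep p q \<longleftrightarrow> (\<forall>(c :: 3 \<Rightarrow> int) (d :: 3 \<Rightarrow> int).
     (\<Sum>l\<in>UNIV. of_int (c l) * p l + of_int (d l) * q l) = 0 \<longrightarrow> (\<forall>l. c l = 0 \<and> d l = 0))"

text \<open>The dependent heights lie in countably many hyperplanes, so they cannot fill a ball.\<close>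
lemma generic_lifts:
  fixes t :: "3 \<Rightarrow> real"
  assumes "0 < \<rho>"
  obtains p q where "\<And>l. \<bar>p l - t l\<bar> < \<rho>" "\<And>l. \<bar>q l - t l\<bar> < \<rho>" "zindep p q"
proof -
  define vec :: "(3 \<Rightarrow> int) \<Rightarrow> real ^ 3" where "vec c = (\<chi> l. real_of_int (c l))" for c
  define x0 :: "(real ^ 3) \<times> (real ^ 3)" where "x0 = ((\<chi> l. t l), (\<chi> l. t l))"
  define F where "F = (\<lambda>(c, d). {x. (vec c, vec d) \<bullet> x = 0}) ` {(c, d). \<not> (\<forall>l. c l = 0 \<and> d l = 0)}"
  have "countable F" unfolding F_def by (rule countable_image) (rule countableI_type)
  moreover have "negligible S" if S: "S \<in> F" for S
  proof -
    obtain c d where cd: "S = {x. (vec c, vec d) \<bullet> x = 0}" "\<not> (\<forall>l. c l = 0 \<and> d l = 0)"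
      using S unfolding F_def by auto
    have "(vec c, vec d) \<noteq> 0" using cd(2) by (auto simp: vec_def zero_prod_def vec_eq_iff)
    then show ?thesis unfolding cd(1) by (intro negligible_hyperplane) simp
  qed
  ultimately have "negligible (\<Union>F)" by (rule negligible_countable_Union)
  moreover have "\<not> negligible (ball x0 \<rho>)" using assms by (intro open_not_negligible) auto
  ultimately have "\<not> ball x0 \<rho> \<subseteq> \<Union>F" using negligible_subset by blast
  then obtain x where x: "x \<in> ball x0 \<rho>" "x \<notin> \<Union>F" by blast
  have d1: "\<bar>fst x $ l - t l\<bar> < \<rho>" for l
  proof -
    have "\<bar>(fst x - fst x0) $ l\<bar> \<le> norm (fst x - fst x0)" by (rule component_le_norm_cart)
    also have "\<dots> \<le> dist x x0" using dist_fst_le[of x x0] by (simp add: dist_norm)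
    finally show ?thesis using x(1) by (simp add: x0_def dist_commute)
  qed
  have d2: "\<bar>snd x $ l - t l\<bar> < \<rho>" for l
  proof -
    have "\<bar>(snd x - snd x0) $ l\<bar> \<le> norm (snd x - snd x0)" by (rule component_le_norm_cart)
    also have "\<dots> \<le> dist x x0" using dist_snd_le[of x x0] by (simp add: dist_norm)
    finally show ?thesis using x(1) by (simp add: x0_def dist_commute)
  qed
  have "zindep (($) (fst x)) (($) (snd x))" unfolding zindep_def
  proof (intro allI impI, rule ccontr)
    fix c :: "3 \<Rightarrow> int" and d :: "3 \<Rightarrow> int" and l
    assume s: "(\<Sum>l\<in>UNIV. real_of_int (c l) * fst x $ l + real_of_int (d l) * snd x $ l) = 0" and n: "\<not> (c l = 0 \<and> d l = 0)"
    have "(vec c, vec d) \<bullet> x = 0" using s by (simp add: inner_prod_def inner_vec_def vec_def sum.distrib)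
    then have "x \<in> \<Union>F" unfolding F_def using n by (intro UnionI[OF imageI[of "(c, d)"]]) auto
    then show False using x by simp
  qed
  then show ?thesis using that[of "($) (fst x)" "($) (snd x)"] d1 d2 by blast
qed

lemma integer_relation:
  fixes x1 x2 x3 y1 y2 y3 :: int
  obtains s1 s2 s3 :: int where "s1 \<noteq> 0 \<or> s2 \<noteq> 0 \<or> s3 \<noteq> 0"
    "s1 * x1 + s2 * x2 + s3 * x3 = 0" "s1 * y1 + s2 * y2 + s3 * y3 = 0"
proof -
  let ?d12 = "x1 * y2 - x2 * y1" and ?d23 = "x2 * y3 - x3 * y2" and ?d31 = "x3 * y1 - x1 * y3"
  show ?thesis
  proof (cases "?d12 = 0 \<and> ?d23 = 0 \<and> ?d31 = 0")
    case False
    then show ?thesis by (intro that[of ?d23 ?d31 ?d12]) (auto simp: algebra_simps)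
  next
    case True
    show ?thesis
    proof (cases "x1 = 0 \<and> y1 = 0")
      case True
      then show ?thesis by (intro that[of 1 0 0]) auto
    next
      case False
      then consider "x1 \<noteq> 0" | "y1 \<noteq> 0" by blast
      then show ?thesis
      proof cases
        case 1
        then show ?thesis using True by (intro that[of x2 "- x1" 0]) (auto simp: algebra_simps)
      next
        case 2
        then show ?thesis using True by (intro that[of y2 "- y1" 0]) (auto simp: algebra_simps)
      qed
    qed
  qed
qed

text \<open>A linear equation with integer coefficients for a functional \<open>(\<alpha>, \<beta>)\<close>: the functional takes equal values
  at two lifted points of one polygon.\<close>
definition lift_eqn :: "(3 \<Rightarrow> real) \<Rightarrow> (3 \<Rightarrow> real) \<Rightarrow> real \<Rightarrow> real \<Rightarrow> int \<Rightarrow> int \<Rightarrow> (3 \<Rightarrow> int) \<Rightarrow> (3 \<Rightarrow> int) \<Rightarrow> bool" where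
  "lift_eqn p q \<alpha> \<beta> x y c d \<longleftrightarrow> x * \<alpha> + y * \<beta> = (\<Sum>l\<in>UNIV. c l * p l + d l * q l)"

text \<open>Three equations in the two unknowns \<open>\<alpha>\<close> and \<open>\<beta>\<close> have an integer combination without unknowns, which is a
  relation between the heights.\<close>
lemma no_three_equations:
  assumes z: "zindep p q" and e: "lift_eqn p q \<alpha> \<beta> x1 y1 c1 d1" "lift_eqn p q \<alpha> \<beta> x2 y2 c2 d2" "lift_eqn p q \<alpha> \<beta> x3 y3 c3 d3"
    and ind: "\<And>s1 s2 s3 :: int. (\<And>l. s1 * c1 l + s2 * c2 l + s3 * c3 l = 0) \<Longrightarrow>
        (\<And>l. s1 * d1 l + s2 * d2 l + s3 * d3 l = 0) \<Longrightarrow> s1 = 0 \<and> s2 = 0 \<and> s3 = 0"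
  shows False
proof -
  obtain s1 s2 s3 :: int where s: "s1 \<noteq> 0 \<or> s2 \<noteq> 0 \<or> s3 \<noteq> 0"
    "s1 * x1 + s2 * x2 + s3 * x3 = 0" "s1 * y1 + s2 * y2 + s3 * y3 = 0" by (rule integer_relation)
  define c where "c l = s1 * c1 l + s2 * c2 l + s3 * c3 l" for l
  define d where "d l = s1 * d1 l + s2 * d2 l + s3 * d3 l" for l
  have "(\<Sum>l\<in>UNIV. c l * p l + d l * q l) =
      s1 * (\<Sum>l\<in>UNIV. c1 l * p l + d1 l * q l) + s2 * (\<Sum>l\<in>UNIV. c2 l * p l + d2 l * q l) + s3 * (\<Sum>l\<in>UNIV. c3 l * p l + d3 l * q l)"
    by (simp add: c_def d_def sum_distrib_left sum.distrib[symmetric] algebra_simps)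
  also have "\<dots> = s1 * (x1 * \<alpha> + y1 * \<beta>) + s2 * (x2 * \<alpha> + y2 * \<beta>) + s3 * (x3 * \<alpha> + y3 * \<beta>)"
    using e by (simp add: lift_eqn_def)
  also have "\<dots> = real_of_int (s1 * x1 + s2 * x2 + s3 * x3) * \<alpha> + real_of_int (s1 * y1 + s2 * y2 + s3 * y3) * \<beta>"
    by (simp add: algebra_simps)
  also have "\<dots> = 0" using s by simp
  finally have "\<forall>l. c l = 0 \<and> d l = 0" using z unfolding zindep_def by blast
  then show False using ind[of s1 s2 s3] s(1) by (simp add: c_def d_def)
qed

lemma endface_equation:
  assumes le: "Min (B l) \<le> Max (B l)" and dim: "1 \<le> aff_dim (lowface (endsA B) (endlift B p q) (\<alpha>, \<beta>) l)"
  obtains x y c d where "lift_eqn p q \<alpha> \<beta> x y c d" "\<And>m. m \<noteq> l \<Longrightarrow> c m = 0 \<and> d m = 0" "c l \<noteq> 0 \<or> d l \<noteq> 0"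
proof -
  note result = that
  let ?lo = "int (Min (B l))" and ?hi = "int (Max (B l))"
  have one: "(\<Sum>m\<in>UNIV. real_of_int (if m = l then x else 0) * p m + real_of_int (if m = l then y else 0) * q m) = x * p l + y * q l" for x y :: int
  proof -
    have "(\<Sum>m\<in>UNIV. real_of_int (if m = l then x else 0) * p m + real_of_int (if m = l then y else 0) * q m) =
      (\<Sum>m\<in>UNIV. if m = l then real_of_int x * p m + real_of_int y * q m else 0)" by (rule sum.cong) auto
    then show ?thesis by simp
  qed
  have res: thesis if "x * \<alpha> + y * \<beta> = c * p l + d * q l" "c \<noteq> 0 \<or> d \<noteq> 0" for x y c d :: int
    using result[of x y "\<lambda>m. if m = l then c else 0" "\<lambda>m. if m = l then d else 0"] one that by (auto simp: lift_eqn_def)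
  from le show ?thesis
  proof (cases rule: endface_kinds[of B l p q \<alpha> \<beta>])
    case base
    then have "hicost B p q l = q l" by (simp add: hicost_def)
    then show ?thesis using base by (intro res[of "?hi - ?lo" 0 1 "-1"]) (auto simp: algebra_simps)
  next
    case slant_lo
    then show ?thesis by (intro res[of "- ?lo" 1 1 0]) (auto simp: algebra_simps)
  next
    case slant_hi
    then have "hicost B p q l = q l" by (simp add: hicost_def)
    then show ?thesis using slant_hi by (intro res[of "- ?hi" 1 0 1]) (auto simp: algebra_simps)
  next
    case triangle
    then show ?thesis by (intro res[of "- ?lo" 1 1 0]) (auto simp: algebra_simps)
  qed (use dim in auto)
qed

lemma endface_two_equations:
  assumes le: "Min (B l) \<le> Max (B l)" and dim: "aff_dim (lowface (endsA B) (endlift B p q) (\<alpha>, \<beta>) l) = 2"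
  obtains x y x' y' where "lift_eqn p q \<alpha> \<beta> x y (\<lambda>m. if m = l then 1 else 0) (\<lambda>_. 0)"
     "lift_eqn p q \<alpha> \<beta> x' y' (\<lambda>_. 0) (\<lambda>m. if m = l then 1 else 0)"
proof -
  note result = that
  have one: "(\<Sum>m\<in>UNIV. real_of_int (if m = l then 1 else 0) * f m) = f l" for f :: "3 \<Rightarrow> real"
  proof -
    have "(\<Sum>m\<in>UNIV. real_of_int (if m = l then 1 else 0) * f m) = (\<Sum>m\<in>UNIV. if m = l then f m else 0)"
      by (rule sum.cong) auto
    then show ?thesis by simp
  qed
  from le show ?thesis
  proof (cases rule: endface_kinds[of B l p q \<alpha> \<beta>])
    case triangle
    then have "hicost B p q l = q l" by (simp add: hicost_def)
    then have "lift_eqn p q \<alpha> \<beta> (- int (Min (B l))) 1 (\<lambda>m. if m = l then 1 else 0) (\<lambda>_. 0)"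
      "lift_eqn p q \<alpha> \<beta> (- int (Max (B l))) 1 (\<lambda>_. 0) (\<lambda>m. if m = l then 1 else 0)"
      using triangle one unfolding lift_eqn_def by (simp_all add: algebra_simps)
    then show ?thesis by (rule result)
  qed (use dim in auto)
qed

text \<open>A lower face of dimension \<open>d\<close> gives \<open>d\<close> independent equations for the functional. With generic heights the
  dimensions therefore add up to at most \<open>2\<close>, and a full-dimensional sum needs at least \<open>2\<close>.\<close>
lemma endface_tight:
  fixes B :: "3 \<Rightarrow> nat set"
  assumes z: "zindep p q" and le: "\<And>l. Min (B l) \<le> Max (B l)"
    and full: "aff_dim (msum (lowface (endsA B) (endlift B p q) a)) = 2"
  shows "tight_cell (lowface (endsA B) (endlift B p q) a)"
proof -
  obtain \<alpha> \<beta> where a: "a = (\<alpha>, \<beta>)" by (cases a)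
  define R where "R = lowface (endsA B) (endlift B p q) (\<alpha>, \<beta>)"
  define d where "d l = aff_dim (R l)" for l
  have dcases: "d l = 0 \<or> d l = 1 \<or> d l = 2" for l
    unfolding d_def R_def using le[of l] by (cases rule: endface_kinds[of B l p q \<alpha> \<beta>]) auto
  have point: "\<exists>x. R l = {x}" if "d l = 0" for l
    using le[of l] by (cases rule: endface_kinds[of B l p q \<alpha> \<beta>]) (use that in \<open>auto simp: d_def R_def hseg_point\<close>)
  have upper: False if d3: "3 \<le> d 0 + d 1 + d 2"
  proof -
    have ne: "(0::3) \<noteq> 1" "(1::3) \<noteq> 2" "(0::3) \<noteq> 2" by auto
    show False
    proof (cases "1 \<le> d 0 \<and> 1 \<le> d 1 \<and> 1 \<le> d 2")
      case True
      have "\<forall>l. \<exists>x y c e. lift_eqn p q \<alpha> \<beta> x y c e \<and> (\<forall>m. m \<noteq> l \<longrightarrow> c m = 0 \<and> e m = 0) \<and> (c l \<noteq> 0 \<or> e l \<noteq> 0)"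
      proof
        fix l
        have "1 \<le> aff_dim (lowface (endsA B) (endlift B p q) (\<alpha>, \<beta>) l)"
          using True distinct_3_cases(1)[OF ne, of l] by (auto simp: d_def R_def)
        from endface_equation[OF le this] show "\<exists>x y c e. lift_eqn p q \<alpha> \<beta> x y c e \<and> (\<forall>m. m \<noteq> l \<longrightarrow> c m = 0 \<and> e m = 0) \<and> (c l \<noteq> 0 \<or> e l \<noteq> 0)"
          by metis
      qed
      then obtain x y c e where E: "\<And>l. lift_eqn p q \<alpha> \<beta> (x l) (y l) (c l) (e l)"
        and off: "\<And>l m. m \<noteq> l \<Longrightarrow> c l m = 0 \<and> e l m = 0" and on: "\<And>l. c l l \<noteq> 0 \<or> e l l \<noteq> 0" by metis
      show False
      proof (rule no_three_equations[OF z E[of 0] E[of 1] E[of 2]])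
        fix s1 s2 s3 :: int
        assume C: "\<And>l. s1 * c 0 l + s2 * c 1 l + s3 * c 2 l = 0" and D: "\<And>l. s1 * e 0 l + s2 * e 1 l + s3 * e 2 l = 0"
        show "s1 = 0 \<and> s2 = 0 \<and> s3 = 0"
          using C[of 0] D[of 0] C[of 1] D[of 1] C[of 2] D[of 2] on[of 0] on[of 1] on[of 2]
            off[of 0 1] off[of 0 2] off[of 1 0] off[of 1 2] off[of 2 0] off[of 2 1] ne by auto
      qed
    next
      case False
      have "\<exists>l m. l \<noteq> m \<and> d l = 2 \<and> 1 \<le> d m"
      proof -
        have "(d 0 = 2 \<and> 1 \<le> d 1) \<or> (d 0 = 2 \<and> 1 \<le> d 2) \<or> (d 1 = 2 \<and> 1 \<le> d 0) \<or> (d 1 = 2 \<and> 1 \<le> d 2) \<or> (d 2 = 2 \<and> 1 \<le> d 0) \<or> (d 2 = 2 \<and> 1 \<le> d 1)"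
          using False d3 dcases[of 0] dcases[of 1] dcases[of 2] by (elim disjE) simp_all
        then show ?thesis using ne ne[symmetric] by metis
      qed
      then obtain l m where lm: "l \<noteq> m" "d l = 2" "1 \<le> d m" by blast
      obtain x1 y1 x2 y2 where E12: "lift_eqn p q \<alpha> \<beta> x1 y1 (\<lambda>m. if m = l then 1 else 0) (\<lambda>_. 0)"
          "lift_eqn p q \<alpha> \<beta> x2 y2 (\<lambda>_. 0) (\<lambda>m. if m = l then 1 else 0)"
        using endface_two_equations[of B l p q \<alpha> \<beta>, OF le] lm(2) unfolding d_def R_def by blast
      obtain x3 y3 c e where E3: "lift_eqn p q \<alpha> \<beta> x3 y3 c e" and off: "\<And>n. n \<noteq> m \<Longrightarrow> c n = 0 \<and> e n = 0" and on: "c m \<noteq> 0 \<or> e m \<noteq> 0"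
        using endface_equation[of B m p q \<alpha> \<beta>, OF le] lm(3) unfolding d_def R_def by blast
      show False
      proof (rule no_three_equations[OF z E12 E3])
        fix s1 s2 s3 :: int
        assume C: "\<And>n. s1 * (if n = l then 1 else 0) + s2 * 0 + s3 * c n = 0"
          and D: "\<And>n. s1 * 0 + s2 * (if n = l then 1 else 0) + s3 * e n = 0"
        show "s1 = 0 \<and> s2 = 0 \<and> s3 = 0"
          using C[of l] D[of l] C[of m] D[of m] off[of l] on lm(1) by auto
      qed
    qed
  qed
  have ne3: "(0::3) \<noteq> 1" "(1::3) \<noteq> 2" "(0::3) \<noteq> 2" "(1::3) \<noteq> 0" "(2::3) \<noteq> 1" "(2::3) \<noteq> 0" by auto
  have lower: "2 \<le> d 0 + d 1 + d 2"
  proof (rule ccontr)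
    assume n: "\<not> 2 \<le> d 0 + d 1 + d 2"
    have bad: False if ijk: "i \<noteq> j" "j \<noteq> k" "i \<noteq> k" and z: "d i = 0" "d k = 0" and dj: "d j \<le> 1" for i j k
    proof -
      obtain x where x: "R i = {x}" using point[OF z(1)] by (elim exE)
      obtain y where y: "R k = {y}" using point[OF z(2)] by (elim exE)
      note xy = x y
      have "msum R = (\<lambda>r. (x + y) + r) ` R j"
        unfolding set_eq_iff msum_distinct_iff[OF ijk] xy image_iff by (simp add: add.assoc add.commute[of _ y])
      then have "aff_dim (msum R) = d j" by (simp add: aff_dim_translation_eq d_def)
      then show False using full dj by (simp add: R_def a)
    qed
    have "(d 0 = 0 \<and> d 1 = 0 \<and> d 2 \<le> 1) \<or> (d 0 = 0 \<and> d 2 = 0 \<and> d 1 \<le> 1) \<or> (d 1 = 0 \<and> d 2 = 0 \<and> d 0 \<le> 1)"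
      using n dcases[of 0] dcases[of 1] dcases[of 2] by (elim disjE) simp_all
    then show False using bad[of 0 2 1] bad[of 0 1 2] bad[of 1 0 2] ne3 by (elim disjE conjE) simp_all
  qed
  have "(\<Sum>l\<in>UNIV. aff_dim (R l)) = d 0 + d 1 + d 2"
    using sum_UNIV_3_distinct[of 0 1 2 "\<lambda>l. aff_dim (R l)"] by (simp add: d_def)
  moreover have "\<not> 3 \<le> d 0 + d 1 + d 2" using upper by blast
  ultimately show ?thesis using lower unfolding tight_cell_def R_def a by simp
qed

section \<open>Mixed areas of end point subdivisions\<close>
lemma closed_msum_lowface:
  assumes "\<And>l. finite (A l)"
  shows "closed (msum (lowface A w a))"
proof -
  have "compact (lowface A w a l)" for l
    unfolding lowface_def using assms[of l] by (intro finite_imp_compact_convex_hull) simp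
  then show ?thesis by (intro compact_imp_closed compact_msum)
qed

text \<open>The lines \<open>x \<mapsto> p\<^sub>l + x v\<^sub>l\<close> are compared at \<open>x = \<alpha>\<close>, where the lines \<open>j\<close> and \<open>k\<close> cross below the
  line \<open>i\<close>. Since \<open>p\<^sub>k\<close> is the largest height, the line \<open>k\<close> has the smallest slope, which is
  zero.\<close>
lemma crossing_bound:
  fixes \<alpha> vi vj vk pi pj pk :: real
  assumes al: "0 < \<alpha>" and v: "0 \<le> vi" "0 \<le> vj" "0 \<le> vk" and zero: "vi = 0 \<or> vj = 0 \<or> vk = 0"
    and pij: "pi < pk" "pj < pk"
    and eq: "\<alpha> * vj + pj = \<alpha> * vk + pk" and less: "\<alpha> * vk + pk < \<alpha> * vi + pi"
  shows "vk = 0" "0 < vj" "\<alpha> * vj = pk - pj" "(pk - pi) * vj < (pk - pj) * vi"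
proof -
  have "\<alpha> * (vj - vk) = pk - pj" using eq by (simp add: algebra_simps)
  then have "0 < \<alpha> * (vj - vk)" using pij by simp
  then have gt: "vk < vj" using al by (simp add: zero_less_mult_iff)
  then show vj: "0 < vj" using v by simp
  have "\<alpha> * (vi - vk) > pk - pi" using less by (simp add: algebra_simps)
  then have "0 < \<alpha> * (vi - vk)" using pij by linarith
  then have "vk < vi" using al by (simp add: zero_less_mult_iff)
  then show vk: "vk = 0" using zero gt v by auto
  show e: "\<alpha> * vj = pk - pj" using eq vk by simp
  have "pk - pi < \<alpha> * vi" using less vk by simp
  then have "(pk - pi) * vj < (\<alpha> * vi) * vj" using vj by simp
  also have "\<dots> = (pk - pj) * vi" using e by (simp add: mult.commute mult.left_commute)
  finally show "(pk - pi) * vj < (pk - pj) * vi" .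
qed

text \<open>The heights are close to \<open>- a\<close>, \<open>- b\<close> and \<open>0\<close>. The additional \<open>\<eta>\<close> keeps the heights of \<open>i\<close> and \<open>j\<close> below
  the one of \<open>k\<close> even if \<open>a = 0\<close> or \<open>b = 0\<close>, and the perturbation \<open>\<rho>\<close> is small compared with \<open>\<eta>\<close>.\<close>
locale end_lifts =
  fixes B :: "3 \<Rightarrow> nat set" and p q t :: "3 \<Rightarrow> real" and i j k :: 3 and a b \<eta> \<rho> u :: real
  assumes fin: "\<And>l. finite (B l)" and ne: "\<And>l. B l \<noteq> {}"
    and u: "u = real (Max (\<Union>l. B l))"
    and ijk: "i \<noteq> j" "j \<noteq> k" "i \<noteq> k"
    and ab: "0 \<le> a" "0 \<le> b" and zero: "\<exists>l. 0 \<in> B l"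
    and t: "t i = - (a + \<eta>)" "t j = - (b + \<eta>)" "t k = 0"
    and \<rho>: "0 < \<rho>" "\<rho> * (4 * u + 4) < \<eta>"
    and pq: "\<And>l. \<bar>p l - t l\<bar> < \<rho>" "\<And>l. \<bar>q l - t l\<bar> < \<rho>"
begin

abbreviation "lo l \<equiv> real (Min (B l))"
abbreviation "hi l \<equiv> real (Max (B l))"
abbreviation "Q \<equiv> hicost B p q"
abbreviation "cells \<equiv> regular_cells (endsA B) (endlift B p q)"

lemma ends: "lo l \<le> hi l" "hi l \<le> u" "Min (B l) \<le> Max (B l)" "Min (B l) \<in> B l" "Max (B l) \<in> B l"
proof -
  show M: "Min (B l) \<in> B l" "Max (B l) \<in> B l" using fin ne by simp_all
  show le: "Min (B l) \<le> Max (B l)" using fin M by simp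
  then show "lo l \<le> hi l" by simp
  have "finite (\<Union>l. B l)" using fin by simp
  then have "Max (B l) \<le> Max (\<Union>l. B l)" using M by (intro Max_ge) auto
  then show "hi l \<le> u" by (simp add: u)
qed

lemma u0: "0 \<le> u" by (simp add: u)

lemma Qt: "\<bar>Q l - t l\<bar> < \<rho>" using pq by (simp add: hicost_def)

lemma lo_zero: "lo i = 0 \<or> lo j = 0 \<or> lo k = 0"
proof -
  obtain l where l: "0 \<in> B l" using zero by blast
  then have "Min (B l) = 0" using fin[of l] by (meson Min_le le_zero_eq)
  then show ?thesis using distinct_3_cases(1)[OF ijk, of l] by auto
qed

lemma hi_top: "u - hi i = 0 \<or> u - hi j = 0 \<or> u - hi k = 0"
proof -
  have "finite (\<Union>l. B l)" "(\<Union>l. B l) \<noteq> {}" using fin ne by auto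
  then have "Max (\<Union>l. B l) \<in> (\<Union>l. B l)" by (rule Max_in)
  then obtain l where l: "Max (\<Union>l. B l) \<in> B l" by blast
  then have "Max (\<Union>l. B l) \<le> Max (B l)" using fin by simp
  then have "hi l = u" using ends(2)[of l] by (simp add: u)
  then show ?thesis using distinct_3_cases(1)[OF ijk, of l] by auto
qed

lemma eta: "0 < \<eta>" "2 * \<rho> * u + \<rho> < \<eta> - (2 * \<rho> * u + \<rho>)"
proof -
  have "0 \<le> \<rho> * u" using \<rho> u0 by simp
  then show "0 < \<eta>" "2 * \<rho> * u + \<rho> < \<eta> - (2 * \<rho> * u + \<rho>)" using \<rho> by (simp_all add: algebra_simps)
qed

lemma gaps: "p i < p k" "p j < p k" "Q i < Q k" "Q j < Q k"
proof -
  have "0 \<le> \<rho> * u" using \<rho> u0 by simp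
  then have r: "2 * \<rho> < \<eta>" using \<rho> by (simp add: algebra_simps)
  have B: "t l - \<rho> < p l" "p l < t l + \<rho>" "t l - \<rho> < Q l" "Q l < t l + \<rho>" for l
    using pq(1)[of l] Qt[of l] by (auto simp: abs_less_iff)
  show "p i < p k" using B(2)[of i] B(1)[of k] t(1,3) ab(1) r by linarith
  show "p j < p k" using B(2)[of j] B(1)[of k] t(2,3) ab(2) r by linarith
  show "Q i < Q k" using B(4)[of i] B(3)[of k] t(1,3) ab(1) r by linarith
  show "Q j < Q k" using B(4)[of j] B(3)[of k] t(2,3) ab(2) r by linarith
qed

text \<open>There is at most one \<open>i\<close>-mixed cell at each end of \<open>C\<close>. The summands \<open>j\<close> and \<open>k\<close> of such a cell
  cannot lie on the base line, since the two end points of a support have almost equal heights, while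
  \<open>\<alpha>\<close> is not small. So they are edges from the apex to the first points (\<open>\<alpha> > 0\<close>) or
  to the last points (\<open>\<alpha> < 0\<close>), and the comparison of lines determines the cell and its area.\<close>
lemma mixed_end_cell:
  assumes R: "R \<in> cells" and m: "mixed_cell B i R"
  shows "(\<exists>\<alpha> \<beta>. R = lowface (endsA B) (endlift B p q) (\<alpha>, \<beta>) \<and> 0 < lo j \<and> \<alpha> * lo j = p k - p j \<and> \<beta> = p k \<and>
            measure lborel (msum R) = lo j \<and> (p k - p i) * lo j < (p k - p j) * lo i) \<or>
         (\<exists>\<alpha> \<beta>. R = lowface (endsA B) (endlift B p q) (\<alpha>, \<beta>) \<and> 0 < u - hi j \<and> (- \<alpha>) * (u - hi j) = Q k - Q j \<and>
            \<beta> = \<alpha> * u + Q k \<and> measure lborel (msum R) = u - hi j \<and> (Q k - Q i) * (u - hi j) < (Q k - Q j) * (u - hi i))"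
proof -
  obtain aa where aa: "R = lowface (endsA B) (endlift B p q) aa" "aff_dim (msum R) = 2"
    using R unfolding regular_cells_def by blast
  obtain \<alpha> \<beta> where ab': "aa = (\<alpha>, \<beta>)" by (cases aa)
  have Rl: "R = lowface (endsA B) (endlift B p q) (\<alpha>, \<beta>)" using aa ab' by simp
  have cl: "closed (msum R)" unfolding Rl by (rule closed_msum_lowface) (simp add: endsA_def)
  have Ri: "R i = {apex}" using m by (simp add: mixed_cell_def)
  have bi: "\<beta> < \<alpha> * lo i + p i" "\<beta> < \<alpha> * hi i + Q i"
  proof -
    have "\<beta> < \<alpha> * lo i + p i \<and> \<beta> < \<alpha> * hi i + Q i"
      using ends(3)[of i]
    proof (cases rule: endface_kinds[of B i p q \<alpha> \<beta>])
      case (point x)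
      then have "hseg x x = {apex}" using Ri unfolding Rl by simp
      then show ?thesis by (simp add: hseg_ne_apex)
    next
      case base
      then have "hseg (lo i) (hi i) = {apex}" using Ri unfolding Rl by simp
      then show ?thesis by (simp add: hseg_ne_apex)
    next
      case slant_lo
      then have "tent (lo i) (lo i) = {apex}" using Ri unfolding Rl by simp
      then show ?thesis using tent_ne_apex[of "lo i" "lo i"] by simp
    next
      case slant_hi
      then have "tent (hi i) (hi i) = {apex}" using Ri unfolding Rl by simp
      then show ?thesis using tent_ne_apex[of "hi i" "hi i"] by simp
    next
      case triangle
      then have "tent (lo i) (hi i) = {apex}" using Ri unfolding Rl by simp
      then show ?thesis using tent_ne_apex[of "lo i" "hi i"] ends(1)[of i] by simp
    qed simp
    then show "\<beta> < \<alpha> * lo i + p i" "\<beta> < \<alpha> * hi i + Q i" by simp_all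
  qed
  have kind: "(R l = hseg (lo l) (hi l) \<and> lo l < hi l \<and> \<alpha> * lo l + p l = \<alpha> * hi l + Q l \<and> \<alpha> * lo l + p l < \<beta>) \<or>
      (R l = tent (lo l) (lo l) \<and> \<beta> = \<alpha> * lo l + p l \<and> (lo l < hi l \<longrightarrow> \<beta> < \<alpha> * hi l + Q l)) \<or>
      (R l = tent (hi l) (hi l) \<and> lo l < hi l \<and> \<beta> = \<alpha> * hi l + Q l \<and> \<beta> < \<alpha> * lo l + p l)" if li: "l \<noteq> i" for l
  proof -
    obtain x y where xy: "x \<noteq> y" "R l = closed_segment x y" using m li unfolding mixed_cell_def by blast
    have "aff_dim (R l) = 1" unfolding xy(2) segment_convex_hull aff_dim_convex_hull using xy(1) by (simp add: aff_dim_2)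
    then have d1: "aff_dim (lowface (endsA B) (endlift B p q) (\<alpha>, \<beta>) l) = 1" by (simp add: Rl)
    from ends(3)[of l] show ?thesis
    proof (cases rule: endface_kinds[of B l p q \<alpha> \<beta>])
      case base
      then show ?thesis unfolding Rl by simp
    next
      case slant_lo
      then show ?thesis unfolding Rl by simp
    next
      case slant_hi
      then show ?thesis unfolding Rl by simp
    qed (use d1 in auto)
  qed
  have small: "\<bar>\<alpha> * x\<bar> \<le> 2 * \<rho> * u" if "\<bar>\<alpha>\<bar> \<le> 2 * \<rho>" "0 \<le> x" "x \<le> u" for x
    unfolding abs_mult using that \<rho> by (intro mult_mono) auto
  (* For small \<alpha> the value \<beta> would be almost 0 because of the summand k, and at most about - \<eta>
     because of the summand i. *)
  have big: "2 * \<rho> < \<bar>\<alpha>\<bar>"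
  proof (rule ccontr)
    assume "\<not> ?thesis"
    then have al: "\<bar>\<alpha>\<bar> \<le> 2 * \<rho>" by simp
    have s: "\<bar>\<alpha> * lo l\<bar> \<le> 2 * \<rho> * u" "\<bar>\<alpha> * hi l\<bar> \<le> 2 * \<rho> * u" for l
      using small[OF al, of "lo l"] small[OF al, of "hi l"] ends(1,2)[of l] by auto
    have "- (2 * \<rho> * u) - \<rho> < \<beta>"
    proof -
      have "\<alpha> * lo k + p k \<le> \<beta> \<or> \<alpha> * hi k + Q k \<le> \<beta>" using kind[of k] ijk by auto
      moreover have "- (2 * \<rho> * u) \<le> \<alpha> * lo k" "- (2 * \<rho> * u) \<le> \<alpha> * hi k" "- \<rho> < p k" "- \<rho> < Q k"
        using s[of k] pq(1)[of k] Qt[of k] t(3) by (auto simp: abs_le_iff abs_less_iff)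
      ultimately show ?thesis by (elim disjE) linarith+
    qed
    moreover have "\<beta> < 2 * \<rho> * u + \<rho> - \<eta>"
    proof -
      have "\<alpha> * lo i \<le> 2 * \<rho> * u" "p i < - (a + \<eta>) + \<rho>"
        using s(1)[of i] pq(1)[of i] t(1) by (auto simp: abs_le_iff abs_less_iff)
      then show ?thesis using bi(1) ab(1) by linarith
    qed
    ultimately show False using eta(2) by linarith
  qed
  have pQ: "\<bar>p l - Q l\<bar> < 2 * \<rho>" for l using pq(1)[of l] Qt[of l] by linarith
  have slope: "\<bar>\<alpha>\<bar> \<le> \<bar>\<alpha> * (hi l - lo l)\<bar>" if "lo l < hi l" for l
  proof -
    have "Min (B l) + 1 \<le> Max (B l)" using that by simp
    then have "real (Min (B l) + 1) \<le> hi l" by (simp only: of_nat_le_iff)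
    then have "1 \<le> hi l - lo l" by simp
    then have "\<bar>\<alpha>\<bar> * 1 \<le> \<bar>\<alpha>\<bar> * \<bar>hi l - lo l\<bar>" by (intro mult_left_mono) auto
    then show ?thesis by (simp add: abs_mult)
  qed
  have expand: "\<alpha> * (hi l - lo l) = \<alpha> * hi l - \<alpha> * lo l" for l by (simp add: right_diff_distrib)
  have nobase: "\<alpha> * lo l + p l \<noteq> \<alpha> * hi l + Q l" if "lo l < hi l" for l
  proof
    assume "\<alpha> * lo l + p l = \<alpha> * hi l + Q l"
    then have "\<alpha> * (hi l - lo l) = p l - Q l" unfolding expand by linarith
    then show False using slope[OF that] pQ[of l] big by linarith
  qed
  show ?thesis
  proof (cases "0 < \<alpha>")
    case True
    have lslant: "R l = tent (lo l) (lo l) \<and> \<beta> = \<alpha> * lo l + p l" if li: "l \<noteq> i" for l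
    proof -
      have "\<not> (lo l < hi l \<and> \<beta> = \<alpha> * hi l + Q l \<and> \<beta> < \<alpha> * lo l + p l)"
      proof
        assume h: "lo l < hi l \<and> \<beta> = \<alpha> * hi l + Q l \<and> \<beta> < \<alpha> * lo l + p l"
        then have "\<alpha> * (hi l - lo l) < p l - Q l" unfolding expand by linarith
        moreover have "0 \<le> \<alpha> * (hi l - lo l)" using True h by simp
        ultimately show False using slope[of l] h pQ[of l] big by linarith
      qed
      then show ?thesis using kind[OF li] nobase[of l] by blast
    qed
    have lj: "R j = tent (lo j) (lo j)" "\<beta> = \<alpha> * lo j + p j" and lk: "R k = tent (lo k) (lo k)" "\<beta> = \<alpha> * lo k + p k"
      using lslant[of j] lslant[of k] ijk by auto
    have "\<alpha> * lo j + p j = \<alpha> * lo k + p k" "\<alpha> * lo k + p k < \<alpha> * lo i + p i" using lj lk bi by auto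
    note cb = crossing_bound[OF True _ _ _ lo_zero gaps(1,2) this]
    have c: "lo k = 0" "0 < lo j" "\<alpha> * lo j = p k - p j" "(p k - p i) * lo j < (p k - p j) * lo i"
      using cb by auto
    have "measure lborel (msum R) = lo j - lo k"
      by (rule measure_swap[of i k j]) (use ijk c Ri lj lk cl in auto)
    then show ?thesis using Rl c lk by (intro disjI1 exI[of _ \<alpha>] exI[of _ \<beta>]) auto
  next
    case False
    then have al: "0 < - \<alpha>" using big \<rho> by linarith
    have hslant: "R l = tent (hi l) (hi l) \<and> \<beta> = \<alpha> * hi l + Q l" if li: "l \<noteq> i" for l
    proof (cases "lo l = hi l")
      case True
      then have "Min (B l) = Max (B l)" by simp
      then have "Q l = p l" by (simp add: hicost_def)
      then show ?thesis using kind[OF li] True by auto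
    next
      case False
      then have lh: "lo l < hi l" using ends(1)[of l] by simp
      have "\<not> \<beta> < \<alpha> * hi l + Q l \<or> \<beta> \<noteq> \<alpha> * lo l + p l"
      proof (rule ccontr)
        assume "\<not> ?thesis"
        then have "p l - Q l < \<alpha> * (hi l - lo l)" unfolding expand by linarith
        moreover have "\<alpha> * (hi l - lo l) \<le> 0" using al lh by (simp add: mult_le_0_iff)
        ultimately show False using slope[OF lh] pQ[of l] big by linarith
      qed
      then show ?thesis using kind[OF li] nobase[OF lh] lh by blast
    qed
    have lj: "R j = tent (hi j) (hi j)" "\<beta> = \<alpha> * hi j + Q j" and lk: "R k = tent (hi k) (hi k)" "\<beta> = \<alpha> * hi k + Q k"
      using hslant[of j] hslant[of k] ijk by auto
    have "(- \<alpha>) * (u - hi j) + Q j = (- \<alpha>) * (u - hi k) + Q k" "(- \<alpha>) * (u - hi k) + Q k < (- \<alpha>) * (u - hi i) + Q i"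
      using lj lk bi by (auto simp: algebra_simps)
    note cb = crossing_bound[OF al _ _ _ hi_top gaps(3,4) this]
    have c: "u - hi k = 0" "0 < u - hi j" "(- \<alpha>) * (u - hi j) = Q k - Q j" "(Q k - Q i) * (u - hi j) < (Q k - Q j) * (u - hi i)"
      using cb ends(2) by auto
    have "measure lborel (msum R) = hi k - hi j"
      by (rule measure_swap[of i j k]) (use ijk c Ri lj lk cl in auto)
    then show ?thesis using Rl c lk by (intro disjI2 exI[of _ \<alpha>] exI[of _ \<beta>]) auto
  qed
qed

lemma mixed_area_end_cells:
  assumes fc: "finite cells"
  shows "mixed_area B cells i \<le>
     (if (p k - p i) * lo j < (p k - p j) * lo i then lo j else 0) +
     (if (Q k - Q i) * (u - hi j) < (Q k - Q j) * (u - hi i) then u - hi j else 0)"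
proof -
  define X where "X = {R \<in> cells. mixed_cell B i R}"
  define Rl where "Rl = lowface (endsA B) (endlift B p q) ((p k - p j) / lo j, p k)"
  define Rr where "Rr = lowface (endsA B) (endlift B p q) (- ((Q k - Q j) / (u - hi j)), - ((Q k - Q j) / (u - hi j)) * u + Q k)"
  have cases: "(R = Rl \<and> measure lborel (msum R) = lo j \<and> (p k - p i) * lo j < (p k - p j) * lo i) \<or>
     (R = Rr \<and> measure lborel (msum R) = u - hi j \<and> (Q k - Q i) * (u - hi j) < (Q k - Q j) * (u - hi i))" if RX: "R \<in> X" for R
  proof -
    have "R \<in> cells" "mixed_cell B i R" using RX by (auto simp: X_def)
    from mixed_end_cell[OF this] show ?thesis
    proof (elim disjE exE conjE)
      fix \<alpha> \<beta>
      assume *: "R = lowface (endsA B) (endlift B p q) (\<alpha>, \<beta>)" "0 < lo j" "\<alpha> * lo j = p k - p j" "\<beta> = p k"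
        "measure lborel (msum R) = lo j" "(p k - p i) * lo j < (p k - p j) * lo i"
      have "\<alpha> = (p k - p j) / lo j" using *(2) unfolding *(3)[symmetric] by simp
      then have "R = Rl" using *(1,4) by (simp add: Rl_def)
      then show ?thesis using *(5,6) by simp
    next
      fix \<alpha> \<beta>
      assume *: "R = lowface (endsA B) (endlift B p q) (\<alpha>, \<beta>)" "0 < u - hi j" "(- \<alpha>) * (u - hi j) = Q k - Q j" "\<beta> = \<alpha> * u + Q k"
        "measure lborel (msum R) = u - hi j" "(Q k - Q i) * (u - hi j) < (Q k - Q j) * (u - hi i)"
      have "\<alpha> = - ((Q k - Q j) / (u - hi j))" using *(2) unfolding *(3)[symmetric] by simp
      then have "R = Rr" using *(1,4) by (simp add: Rr_def)
      then show ?thesis using *(5,6) by simp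
    qed
  qed
  have fX: "finite X" using fc by (simp add: X_def)
  let ?L = "if (p k - p i) * lo j < (p k - p j) * lo i then lo j else 0"
  let ?H = "if (Q k - Q i) * (u - hi j) < (Q k - Q j) * (u - hi i) then u - hi j else 0"
  have L0: "0 \<le> ?L" "0 \<le> ?H" using ends(2)[of j] by auto
  define Xl where "Xl = {R \<in> X. R = Rl \<and> measure lborel (msum R) = lo j \<and> (p k - p i) * lo j < (p k - p j) * lo i}"
  have "mixed_area B cells i = sum (\<lambda>R. measure lborel (msum R)) X" by (simp add: mixed_area_def X_def)
  also have "\<dots> = sum (\<lambda>R. measure lborel (msum R)) (X - Xl) + sum (\<lambda>R. measure lborel (msum R)) Xl"
    by (rule sum.subset_diff) (use fX in \<open>auto simp: Xl_def\<close>)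
  finally have split: "mixed_area B cells i = sum (\<lambda>R. measure lborel (msum R)) (X - Xl) + sum (\<lambda>R. measure lborel (msum R)) Xl" .
  have left: "sum (\<lambda>R. measure lborel (msum R)) Xl \<le> ?L"
  proof (cases "Xl = {}")
    case True
    show ?thesis unfolding True sum.empty by (rule L0)
  next
    case False
    then have X1: "Xl = {Rl}" and c: "measure lborel (msum Rl) = lo j" "(p k - p i) * lo j < (p k - p j) * lo i" by (auto simp: Xl_def)
    show ?thesis unfolding X1 using c by simp
  qed
  have right: "sum (\<lambda>R. measure lborel (msum R)) (X - Xl) \<le> ?H"
  proof (cases "X - Xl = {}")
    case True
    show ?thesis unfolding True sum.empty by (rule L0)
  next
    case False
    have *: "R = Rr \<and> measure lborel (msum R) = u - hi j \<and> (Q k - Q i) * (u - hi j) < (Q k - Q j) * (u - hi i)" if "R \<in> X - Xl" for R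
      using cases[of R] that by (auto simp: Xl_def)
    then have X2: "X - Xl = {Rr}" using False by blast
    show ?thesis unfolding X2 using *[of Rr] unfolding X2 by simp
  qed
  show ?thesis using split left right by linarith
qed

end

lemma used_point_regular_cells:
  assumes "used_point (regular_cells (endsA B) w) l b"
  shows "b = Min (B l) \<or> b = Max (B l)"
proof -
  obtain a where "(real b, 0) extreme_point_of lowface (endsA B) w a l"
    using assms unfolding used_point_def regular_cells_def by blast
  then have "(real b, 0) \<in> endsA B l" unfolding lowface_def using extreme_point_of_convex_hull by blast
  then show ?thesis by (auto simp: endsA_def apex_def)
qed

text \<open>The two conditions exclude each other, so only one of the terms occurs, and it is the smaller one up to
  the difference between the exact weights \<open>x\<close>, \<open>y\<close> and the perturbed weights \<open>A\<close>, \<open>C\<close>.\<close>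
lemma min_weight_bound:
  fixes A C x y z w v \<epsilon> :: real
  assumes "0 \<le> x" "0 \<le> y" "0 \<le> A" "0 \<le> C" "A \<le> x + \<epsilon>" "C \<le> y + \<epsilon>" "x \<le> A" "y \<le> C" "0 \<le> z" "0 \<le> w" "z \<le> v" "w \<le> v" "0 \<le> \<epsilon>"
  shows "x * (if A * z < C * w then z else 0) + y * (if C * w < A * z then w else 0) \<le> min (x * z) (y * w) + \<epsilon> * v"
proof -
  have "x * (if A * z < C * w then z else 0) + y * (if C * w < A * z then w else 0)
      \<le> A * (if A * z < C * w then z else 0) + C * (if C * w < A * z then w else 0)"
    using assms by (intro add_mono mult_right_mono) auto
  also have "\<dots> \<le> min (A * z) (C * w)"
    using assms by auto
  also have "\<dots> \<le> min (x * z) (y * w) + \<epsilon> * v"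
  proof -
    have "A * z \<le> (x + \<epsilon>) * z" "C * w \<le> (y + \<epsilon>) * w" using assms by (auto intro: mult_right_mono)
    moreover have "\<epsilon> * z \<le> \<epsilon> * v" "\<epsilon> * w \<le> \<epsilon> * v" using assms by (auto intro: mult_left_mono)
    ultimately show ?thesis by (simp add: algebra_simps min_def)
  qed
  finally show ?thesis .
qed

text \<open>The generic lift whose heights are close to \<open>- a\<close>, \<open>- b\<close> and \<open>0\<close> favours mixed cells in the way
  prescribed by the weights: of the two possible mixed cells at an end of \<open>C\<close>, an \<open>i\<close>-mixed one of area
  \<open>v\<^sub>j\<close> and a \<open>j\<close>-mixed one of area \<open>v\<^sub>i\<close>, only the cheaper one occurs.\<close>
theorem end_subdivision_bound:
  assumes fin: "\<And>l. finite (B l)" and ne: "\<And>l. B l \<noteq> {}" and zero: "0 \<in> B k0"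
    and d: "i \<noteq> j" "j \<noteq> k" "i \<noteq> k" and ab: "0 \<le> a" "0 \<le> b" and \<epsilon>: "0 < \<epsilon>"
    and int: "interior (bigC B) \<noteq> {}"
  obtains S where "mixed_subdivision B S" "\<And>l b'. used_point S l b' \<Longrightarrow> b' = Min (B l) \<or> b' = Max (B l)"
    "a * mixed_area B S i + b * mixed_area B S j \<le> corner_support B i j a b + \<epsilon>"
proof -
  define u where "u = real (Max (\<Union>l. B l))"
  have u0: "0 \<le> u" by (simp add: u_def)
  define \<eta> where "\<eta> = \<epsilon> / (8 * (u + 1))"
  define \<rho> where "\<rho> = \<eta> / (8 * (u + 1))"
  have \<eta>: "0 < \<eta>" using \<epsilon> u0 by (simp add: \<eta>_def)
  have \<eta>u: "\<eta> * (8 * (u + 1)) = \<epsilon>" using u0 by (simp add: \<eta>_def)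
  have \<rho>: "0 < \<rho>" using \<eta> u0 by (simp add: \<rho>_def)
  have \<rho>u: "\<rho> * (8 * (u + 1)) = \<eta>" using u0 by (simp add: \<rho>_def)
  have "0 \<le> \<rho> * u" using \<rho> u0 by simp
  then have r4: "\<rho> * (4 * u + 4) < \<eta>" and r2: "2 * \<rho> \<le> \<eta>" using \<rho> \<rho>u by (auto simp: algebra_simps)
  define t where "t = (\<lambda>l. if l = i then - (a + \<eta>) else if l = j then - (b + \<eta>) else 0)"
  have t: "t i = - (a + \<eta>)" "t j = - (b + \<eta>)" "t k = 0" using d by (auto simp: t_def)
  obtain p q where pq: "\<And>l. \<bar>p l - t l\<bar> < \<rho>" "\<And>l. \<bar>q l - t l\<bar> < \<rho>" and z: "zindep p q"
    using generic_lifts[OF \<rho>, of t] by blast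
  interpret L: end_lifts B p q t i j k a b \<eta> \<rho> u
    by unfold_locales (use fin ne d ab t \<rho> r4 pq zero in \<open>auto simp: u_def\<close>)
  interpret L': end_lifts B p q t j i k b a \<eta> \<rho> u
    by unfold_locales (use fin ne d ab t \<rho> r4 pq zero in \<open>auto simp: u_def\<close>)
  let ?S = "regular_cells (endsA B) (endlift B p q)"
  have S: "mixed_subdivision B ?S"
  proof (rule regular_mixed_subdivision[OF _ _ _ _ int])
    show "finite (endsA B l)" "endsA B l \<noteq> {}" for l by (auto simp: endsA_def)
    show sub: "endsA B l \<subseteq> suppA B l" for l using L.ends(4,5)[of l] by (auto simp: endsA_def suppA_def)
    show "convex hull endsA B l = convex hull suppA B l" for l
    proof
      show "convex hull endsA B l \<subseteq> convex hull suppA B l" using sub by (rule hull_mono)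
      have H: "convex hull endsA B l = tent (real (Min (B l))) (real (Max (B l)))"
        unfolding endsA_def using L.ends(1) by (rule hull_base_apex)
      have "suppA B l \<subseteq> tent (real (Min (B l))) (real (Max (B l)))"
        using fin[of l] by (auto simp: suppA_def tent_def apex_def)
      then show "convex hull suppA B l \<subseteq> convex hull endsA B l" unfolding H by (intro hull_minimal convex_tent)
    qed
    show "tight_cell (lowface (endsA B) (endlift B p q) x)"
      if "aff_dim (msum (lowface (endsA B) (endlift B p q) x)) = 2" for x
      using z L.ends(3) that by (rule endface_tight)
  qed
  then have fc: "finite ?S" by (simp add: mixed_subdivision_def)
  have Q: "hicost B p q l \<le> t l + \<rho>" "t l - \<rho> \<le> hicost B p q l" "p l \<le> t l + \<rho>" "t l - \<rho> \<le> p l" for l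
    using L.Qt[of l] pq(1)[of l] by (auto simp: abs_less_iff)
  have lh: "0 \<le> real (Min (B l))" "real (Min (B l)) \<le> u" "0 \<le> u - real (Max (B l))" "u - real (Max (B l)) \<le> u" for l
    using L.ends(1,2)[of l] by auto
  let ?P = "\<lambda>l. p k - p l" and ?Q = "\<lambda>l. hicost B p q k - hicost B p q l"
  have 1: "a * (if ?P i * L.lo j < ?P j * L.lo i then L.lo j else 0) + b * (if ?P j * L.lo i < ?P i * L.lo j then L.lo i else 0)
     \<le> min (a * L.lo j) (b * L.lo i) + (2 * \<eta>) * u"
    by (rule min_weight_bound) (use ab lh[of i] lh[of j] Q[of i] Q[of j] Q[of k] t r2 \<eta> in linarith)+
  have 2: "a * (if ?Q i * (u - L.hi j) < ?Q j * (u - L.hi i) then u - L.hi j else 0) + b * (if ?Q j * (u - L.hi i) < ?Q i * (u - L.hi j) then u - L.hi i else 0)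
     \<le> min (a * (u - L.hi j)) (b * (u - L.hi i)) + (2 * \<eta>) * u"
    by (rule min_weight_bound) (use ab lh[of i] lh[of j] Q[of i] Q[of j] Q[of k] t r2 \<eta> in linarith)+
  have "a * mixed_area B ?S i + b * mixed_area B ?S j \<le>
     a * ((if ?P i * L.lo j < ?P j * L.lo i then L.lo j else 0) + (if ?Q i * (u - L.hi j) < ?Q j * (u - L.hi i) then u - L.hi j else 0)) +
     b * ((if ?P j * L.lo i < ?P i * L.lo j then L.lo i else 0) + (if ?Q j * (u - L.hi i) < ?Q i * (u - L.hi j) then u - L.hi i else 0))"
    by (intro add_mono mult_left_mono L.mixed_area_end_cells[OF fc] L'.mixed_area_end_cells[OF fc] ab)
  also have "\<dots> \<le> corner_support B i j a b + (4 * \<eta>) * u"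
    using 1 2 unfolding corner_support_def lowgap_def topgap_def u_def[symmetric] by (simp add: distrib_left)
  finally have "a * mixed_area B ?S i + b * mixed_area B ?S j \<le> corner_support B i j a b + (4 * \<eta>) * u" .
  moreover have "(4 * \<eta>) * u \<le> \<epsilon>"
  proof -
    have "8 * (\<eta> * u) + 8 * \<eta> = \<epsilon>" using \<eta>u by (simp add: algebra_simps)
    moreover have "0 \<le> \<eta> * u" using \<eta> u0 by simp
    moreover have "(4 * \<eta>) * u = 4 * (\<eta> * u)" by simp
    ultimately show ?thesis using \<eta> by linarith
  qed
  ultimately have "a * mixed_area B ?S i + b * mixed_area B ?S j \<le> corner_support B i j a b + \<epsilon>" by simp
  then show ?thesis using that[OF S] used_point_regular_cells by blast
qed

section \<open>Pencils of polynomials\<close>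

lemma monom_dvd_order_0:
  fixes p :: "'a::idom poly"
  assumes "p \<noteq> 0"
  shows "monom 1 (order 0 p) dvd p"
  using order_divides[of 0 "order 0 p" p] by (simp add: monom_altdef)

lemma coeff_order_0_nonzero:
  fixes p :: "'a::idom poly"
  assumes p: "p \<noteq> 0"
  shows "coeff p (order 0 p) \<noteq> 0"
proof
  assume 0: "coeff p (order 0 p) = 0"
  obtain q where q: "p = monom 1 (order 0 p) * q" using monom_dvd_order_0[OF p] by (elim dvdE)
  have "coeff q 0 = 0" using 0 by (subst (asm) q) (simp add: coeff_monom_mult)
  then have "[:-0, 1:] ^ 1 dvd q" using poly_eq_0_iff_dvd[of q 0] by (simp add: poly_0_coeff_0)
  then obtain r where "q = monom 1 1 * r" by (auto simp: monom_altdef elim!: dvdE)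
  then have "p = monom 1 (Suc (order 0 p)) * r" using q by (metis mult.assoc mult_monom mult_1 Suc_eq_plus1)
  then have "[:-0, 1:] ^ Suc (order 0 p) dvd p" by (metis dvd_triv_left monom_altdef smult_1_left diff_0 neg_equal_zero minus_zero)
  then show False using order_divides[of 0 "Suc (order 0 p)" p] p by simp
qed

lemma order_0_le:
  fixes p :: "'a::idom poly"
  assumes "coeff p n \<noteq> 0"
  shows "order 0 p \<le> n"
proof (rule ccontr)
  assume "\<not> ?thesis"
  moreover have p: "p \<noteq> 0" using assms by auto
  moreover obtain q where "p = monom 1 (order 0 p) * q" using monom_dvd_order_0[OF p] by (elim dvdE)
  ultimately have "coeff p n = 0" by (metis coeff_monom_mult leI)
  then show False using assms by simp
qed

lemma order_power:
  fixes p :: "'a::idom poly"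
  assumes "p \<noteq> 0"
  shows "order x (p ^ n) = n * order x p"
  using assms by (induction n) (simp_all add: order_mult)

lemma order_Suc_pderiv:
  fixes p :: "complex poly"
  assumes "pderiv p \<noteq> 0" "poly p r = 0"
  shows "order r p = Suc (order r (pderiv p))"
proof -
  have "p \<noteq> 0" using assms(1) by auto
  then show ?thesis using assms(2) by (rule order_pderiv)
qed

text \<open>So the number of nonzero roots is the length of the interval spanned by the exponents.\<close>

lemma degree_as_root_count:
  fixes p :: "complex poly"
  assumes "p \<noteq> 0"
  shows "degree p = order 0 p + (\<Sum>r | r \<noteq> 0 \<and> poly p r = 0. order r p)"
proof -
  have fin: "finite {r. poly p r = 0}" using assms by (rule poly_roots_finite)
  have "degree p = (\<Sum>r\<in>{r. poly p r = 0}. order r p)"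
    unfolding size_proots_complex[symmetric] size_multiset_overloaded_eq using assms by simp
  also have "\<dots> = (\<Sum>r\<in>insert 0 {r. r \<noteq> 0 \<and> poly p r = 0}. order r p)"
    using fin by (intro sum.mono_neutral_left) (auto simp: order_root)
  also have "\<dots> = order 0 p + (\<Sum>r | r \<noteq> 0 \<and> poly p r = 0. order r p)"
    using fin by (intro sum.insert) (auto intro: finite_subset[OF _ fin])
  finally show ?thesis .
qed

lemma only_root_0_monom:
  fixes p :: "complex poly"
  assumes "p \<noteq> 0" "\<And>r. r \<noteq> 0 \<Longrightarrow> poly p r \<noteq> 0"
  shows "p = monom (lead_coeff p) (degree p)"
proof -
  have E: "{r. r \<noteq> 0 \<and> poly p r = 0} = {}" using assms(2) by auto
  have "degree p = order 0 p" using degree_as_root_count[OF assms(1)] unfolding E by simp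
  then have "coeff p n \<noteq> 0 \<Longrightarrow> n = degree p" for n using order_0_le[of p n] le_degree[of p n] by simp
  then show ?thesis by (intro poly_eqI) (auto simp: coeff_monom)
qed

text \<open>At a root of \<open>f\<close> the left side vanishes to a smaller order than the right side.\<close>
lemma wronskian_root:
  fixes f g :: "complex poly"
  assumes g: "poly g r \<noteq> 0" and f: "f \<noteq> 0" "poly f r = 0" and W: "pderiv f * g = f * pderiv g"
  shows False
proof -
  have g0: "g \<noteq> 0" using g by auto
  have f': "pderiv f \<noteq> 0"
  proof
    assume "pderiv f = 0"
    then obtain c where "f = [:c:]" using pderiv_iszero by blast
    then show False using f by simp
  qed
  then have g': "pderiv g \<noteq> 0" using W f' g0 by (metis mult_eq_0_iff)
  have "order r (pderiv f) + order r g = order r f + order r (pderiv g)"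
    using W f' g0 g' f by (metis order_mult mult_eq_0_iff)
  then show False using order_Suc_pderiv[OF f' f(2)] order_0I[OF g] by simp
qed

text \<open>A repeated root of \<open>f - \<gamma> g\<close> is a root of the Wronskian of \<open>f\<close> and \<open>g\<close>, and each root of the
  Wronskian is a root of \<open>f - \<gamma> g\<close> for at most one \<open>\<gamma>\<close>. So the nonzero roots of a general member
  of the pencil are simple, and their number is the length of the interval spanned by its
  exponents. A vanishing Wronskian makes the pencil trivial: then \<open>f\<close> and \<open>g\<close> are monomials of the
  same degree.\<close>

lemma pencil_roots:
  fixes f g :: "complex poly"
  assumes f: "f \<noteq> 0" and g: "g \<noteq> 0" and com: "\<And>r. r \<noteq> 0 \<Longrightarrow> poly f r = 0 \<Longrightarrow> poly g r = 0 \<Longrightarrow> False"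
    and F: "finite F"
  obtains G where "finite G" "\<And>\<gamma>. \<gamma> \<notin> G \<Longrightarrow>
    \<exists>N. finite N \<and> (\<forall>t\<in>N. t \<noteq> 0 \<and> t \<notin> F \<and> poly f t = \<gamma> * poly g t) \<and>
      max (degree f) (degree g) \<le> card N + min (order 0 f) (order 0 g)"
proof (cases "pderiv f * g = f * pderiv g")
  case True
  have nf: "poly f r \<noteq> 0" if "r \<noteq> 0" for r
  proof
    assume r: "poly f r = 0"
    then have "poly g r \<noteq> 0" using com that by blast
    then show False using wronskian_root f r True by blast
  qed
  have ng: "poly g r \<noteq> 0" if "r \<noteq> 0" for r
  proof
    assume r: "poly g r = 0"
    moreover have "pderiv g * f = g * pderiv f" using True by (simp add: mult.commute)
    ultimately show False using wronskian_root g nf[OF that] by blast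
  qed
  define c d m n where "c = lead_coeff f" "d = lead_coeff g" "m = degree f" "n = degree g"
  note defs = this
  have fm: "f = monom c m" and gm: "g = monom d n"
    unfolding defs using only_root_0_monom f g nf ng by blast+
  have cd: "c \<noteq> 0" "d \<noteq> 0" using f g by (auto simp: defs)
  have "poly (pderiv f * g) 1 = poly (f * pderiv g) 1" using True by simp
  then have "of_nat m * (c * d) = of_nat n * (c * d)"
    by (simp add: fm gm pderiv_monom poly_monom mult_ac)
  then have mn: "m = n" using cd by simp
  have o: "n \<le> order 0 f" "n \<le> order 0 g"
    using coeff_order_0_nonzero[OF f] coeff_order_0_nonzero[OF g] by (auto simp: fm gm mn coeff_monom split: if_splits)
  show ?thesis
  proof (rule that)
    show "finite ({} :: complex set)" by simp
    show "\<exists>N. finite N \<and> (\<forall>t\<in>N. t \<noteq> 0 \<and> t \<notin> F \<and> poly f t = \<gamma> * poly g t) \<and>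
      max (degree f) (degree g) \<le> card N + min (order 0 f) (order 0 g)" for \<gamma>
      using o mn by (intro exI[of _ "{}"]) (simp add: defs)
  qed
next
  case False
  define W where "W = pderiv f * g - f * pderiv g"
  have W: "W \<noteq> 0" using False by (simp add: W_def)
  define Z where "Z = {r. r \<noteq> 0 \<and> (r \<in> F \<or> poly W r = 0)}"
  have finZ: "finite Z" using F poly_roots_finite[OF W] by (simp add: Z_def)
  define G where "G = (\<lambda>r. poly f r / poly g r) ` Z \<union>
    (\<lambda>n. coeff f n / coeff g n) ` {degree f, degree g, order 0 f, order 0 g} \<union> {0}"
  show ?thesis
  proof (rule that)
    show "finite G" using finZ by (simp add: G_def)
    fix \<gamma> assume \<gamma>: "\<gamma> \<notin> G"
    define h where "h = f - smult \<gamma> g"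
    have hc: "coeff h n \<noteq> 0" if n: "n \<in> {degree f, degree g, order 0 f, order 0 g}" and ne: "coeff f n \<noteq> 0 \<or> coeff g n \<noteq> 0" for n
    proof
      assume "coeff h n = 0"
      then have e: "coeff f n = \<gamma> * coeff g n" by (simp add: h_def)
      then have "coeff g n \<noteq> 0" using ne by auto
      then have "\<gamma> = coeff f n / coeff g n" using e by simp
      then show False using \<gamma> n unfolding G_def by blast
    qed
    have top: "coeff h (max (degree f) (degree g)) \<noteq> 0"
      by (rule hc) (use f g in \<open>auto simp: max_def\<close>)
    then have h0: "h \<noteq> 0" by auto
    have low: "coeff h (min (order 0 f) (order 0 g)) \<noteq> 0"
      by (rule hc) (use f g coeff_order_0_nonzero in \<open>auto simp: min_def\<close>)
    have nZ: "r \<notin> Z" if r: "r \<noteq> 0" "poly h r = 0" for r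
    proof
      assume rZ: "r \<in> Z"
      have e: "poly f r = \<gamma> * poly g r" using r by (simp add: h_def)
      then have "poly g r \<noteq> 0" using com[OF r(1)] by auto
      then have "\<gamma> = poly f r / poly g r" using e by simp
      then show False using \<gamma> rZ unfolding G_def by blast
    qed
    have simple: "order r h = 1" if r: "r \<noteq> 0" "poly h r = 0" for r
    proof -
      have Wr: "poly W r \<noteq> 0" using nZ[OF r] r by (auto simp: Z_def)
      have e: "poly f r = \<gamma> * poly g r" using r by (simp add: h_def)
      have d: "poly (pderiv h) r \<noteq> 0"
      proof
        assume "poly (pderiv h) r = 0"
        then have "poly (pderiv f) r = \<gamma> * poly (pderiv g) r" by (simp add: h_def pderiv_diff pderiv_smult)
        then have "poly W r = 0" using e by (simp add: W_def)
        then show False using Wr by simp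
      qed
      then have "pderiv h \<noteq> 0" by auto
      then show ?thesis using order_Suc_pderiv r(2) order_0I[OF d] by simp
    qed
    define N where "N = {r. r \<noteq> 0 \<and> poly h r = 0}"
    have "finite N" unfolding N_def by (rule finite_subset[OF _ poly_roots_finite[OF h0]]) auto
    moreover have "\<forall>t\<in>N. t \<noteq> 0 \<and> t \<notin> F \<and> poly f t = \<gamma> * poly g t"
    proof
      fix t assume "t \<in> N"
      then have t: "t \<noteq> 0" "poly h t = 0" by (auto simp: N_def)
      have "t \<notin> F" using nZ[OF t] t(1) unfolding Z_def by blast
      moreover have "poly f t = \<gamma> * poly g t" using t(2) by (simp add: h_def)
      ultimately show "t \<noteq> 0 \<and> t \<notin> F \<and> poly f t = \<gamma> * poly g t" using t(1) by blast
    qed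
    moreover have "max (degree f) (degree g) \<le> card N + min (order 0 f) (order 0 g)"
    proof -
      have "max (degree f) (degree g) \<le> degree h" using top by (rule le_degree)
      also have "\<dots> = order 0 h + (\<Sum>r\<in>N. order r h)" using degree_as_root_count[OF h0] by (simp add: N_def)
      also have "(\<Sum>r\<in>N. order r h) = card N" using simple by (simp add: N_def)
      also have "order 0 h \<le> min (order 0 f) (order 0 g)" using low by (rule order_0_le)
      finally show ?thesis by simp
    qed
    ultimately show "\<exists>N. finite N \<and> (\<forall>t\<in>N. t \<noteq> 0 \<and> t \<notin> F \<and> poly f t = \<gamma> * poly g t) \<and>
      max (degree f) (degree g) \<le> card N + min (order 0 f) (order 0 g)" by blast
  qed
qed

text \<open>With \<open>\<alpha> a + \<beta> b = 1\<close> take \<open>s = x\<^sup>\<alpha> y\<^sup>\<beta>\<close>.\<close>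
lemma common_root_of_powers:
  fixes x y :: complex
  assumes "coprime a b" "x \<noteq> 0" "y \<noteq> 0" "y ^ a = x ^ b"
  obtains s where "s ^ a = x" "s ^ b = y"
proof -
  obtain \<alpha> \<beta> :: int where ab: "\<alpha> * int a + \<beta> * int b = 1"
    using assms(1) bezout_int[of "int a" "int b"] by (auto simp: coprime_iff_gcd_eq_1)
  have e: "y powi int a = x powi int b" using assms(4) by simp
  define s where "s = x powi \<alpha> * y powi \<beta>"
  have pm: "(z powi m) powi n = z powi (m * n)" for z :: complex and m n
    by (simp add: power_int_mult)
  have "s powi int a = (x powi \<alpha>) powi int a * (y powi \<beta>) powi int a"
    unfolding s_def by (rule power_int_mult_distrib)
  also have "(y powi \<beta>) powi int a = (y powi int a) powi \<beta>" unfolding pm by (simp only: mult.commute)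
  also have "(x powi \<alpha>) powi int a * (y powi int a) powi \<beta> = x powi (\<alpha> * int a + \<beta> * int b)"
    unfolding e pm using assms(2) by (subst power_int_add) (auto simp: mult.commute)
  finally have 1: "s ^ a = x" using ab by simp
  have "s powi int b = (x powi \<alpha>) powi int b * (y powi \<beta>) powi int b"
    unfolding s_def by (rule power_int_mult_distrib)
  also have "(x powi \<alpha>) powi int b = (x powi int b) powi \<alpha>" unfolding pm by (simp only: mult.commute)
  also have "(x powi int b) powi \<alpha> * (y powi \<beta>) powi int b = y powi (\<alpha> * int a + \<beta> * int b)"
    unfolding e[symmetric] pm using assms(3) by (subst power_int_add) (auto simp: mult.commute)
  finally have 2: "s ^ b = y" using ab by simp
  show ?thesis using that 1 2 by blast
qed

section \<open>The degree of the implicit equation\<close>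

text \<open>A monomial \<open>x\<^sup>p y\<^sup>q\<close> is written as the pair \<open>(p, q)\<close>, whereas the coefficients of a polynomial in \<open>y\<close> over
  polynomials in \<open>x\<close> are addressed in the opposite order.\<close>
definition psupp :: "complex poly poly \<Rightarrow> (nat \<times> nat) set" where
  "psupp F = {m. coeff (coeff F (snd m)) (fst m) \<noteq> 0}"

abbreviation pco :: "complex poly poly \<Rightarrow> nat \<times> nat \<Rightarrow> complex" where
  "pco F m \<equiv> coeff (coeff F (snd m)) (fst m)"

lemma psupp_subset_Sigma: "psupp F \<subseteq> (\<lambda>(j, i). (i, j)) ` (SIGMA j:{..degree F}. {..degree (coeff F j)})"
proof
  fix m assume m: "m \<in> psupp F"
  then have "coeff F (snd m) \<noteq> 0" "pco F m \<noteq> 0" by (auto simp: psupp_def)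
  then have "(snd m, fst m) \<in> (SIGMA j:{..degree F}. {..degree (coeff F j)})" by (auto intro: le_degree)
  then have "(\<lambda>(j, i). (i, j)) (snd m, fst m) \<in> (\<lambda>(j, i). (i, j)) ` (SIGMA j:{..degree F}. {..degree (coeff F j)})"
    by (rule imageI)
  then show "m \<in> (\<lambda>(j, i). (i, j)) ` (SIGMA j:{..degree F}. {..degree (coeff F j)})" by simp
qed

lemma finite_psupp: "finite (psupp F)"
  using psupp_subset_Sigma by (rule finite_subset) simp

lemma psupp_nonempty: "F \<noteq> 0 \<Longrightarrow> psupp F \<noteq> {}"
proof
  assume F: "F \<noteq> 0" and e: "psupp F = {}"
  have "coeff (coeff F j) i = 0" for i j using e by (force simp: psupp_def)
  then have "F = 0" by (intro poly_eqI) simp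
  then show False using F by simp
qed

lemma poly2_sum: "poly2 F x y = (\<Sum>m\<in>psupp F. pco F m * x ^ fst m * y ^ snd m)"
proof -
  have "poly2 F x y = (\<Sum>j\<le>degree F. poly (coeff F j) x * y ^ j)"
    unfolding poly2_def by (subst poly_altdef) (simp add: poly_sum)
  also have "\<dots> = (\<Sum>j\<le>degree F. \<Sum>i\<le>degree (coeff F j). coeff (coeff F j) i * x ^ i * y ^ j)"
    by (simp add: poly_altdef sum_distrib_right)
  also have "\<dots> = (\<Sum>(j, i)\<in>(SIGMA j:{..degree F}. {..degree (coeff F j)}). coeff (coeff F j) i * x ^ i * y ^ j)"
    by (rule sum.Sigma) auto
  also have "\<dots> = (\<Sum>m\<in>(\<lambda>(j, i). (i, j)) ` (SIGMA j:{..degree F}. {..degree (coeff F j)}). pco F m * x ^ fst m * y ^ snd m)"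
    by (subst sum.reindex) (auto simp: inj_on_def split_def)
  also have "\<dots> = (\<Sum>m\<in>psupp F. pco F m * x ^ fst m * y ^ snd m)"
    by (rule sum.mono_neutral_right) (use psupp_subset_Sigma in \<open>auto simp: psupp_def\<close>)
  finally show ?thesis .
qed

lemma poly2_mult: "poly2 (F * G) x y = poly2 F x y * poly2 G x y"
  by (simp add: poly2_def)

text \<open>The substitution \<open>x = z\<^sup>W\<close>, \<open>y = z\<^bsup>W+1\<^esup>\<close> turns the monomials into powers of \<open>z\<close>; for large
  \<open>W\<close> the total degree decides which power is the larger one.\<close>

definition wt :: "nat \<Rightarrow> nat \<times> nat \<Rightarrow> nat" where
  "wt W m = W * (fst m + snd m) + snd m"

definition powsub :: "nat \<Rightarrow> complex poly poly \<Rightarrow> complex poly" where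
  "powsub W F = (\<Sum>m\<in>psupp F. monom (pco F m) (wt W m))"

lemma poly_powsub: "poly (powsub W F) z = poly2 F (z ^ W) (z ^ (W + 1))"
proof -
  have "z ^ wt W m = (z ^ W) ^ fst m * (z ^ (W + 1)) ^ snd m" for m
    by (simp add: wt_def power_mult[symmetric] power_add[symmetric] algebra_simps)
  then show ?thesis by (simp add: powsub_def poly2_sum poly_sum poly_monom mult.assoc)
qed

lemma powsub_mult: "powsub W (F * G) = powsub W F * powsub W G"
  by (subst poly_eq_poly_eq_iff[symmetric]) (simp add: fun_eq_iff poly_powsub poly2_mult)

lemma wt_inj:
  assumes "wt W m = wt W m'" "snd m < W" "snd m' < W"
  shows "m = m'"
proof -
  have "snd m = wt W m mod W" "snd m' = wt W m' mod W" using assms(2,3) by (simp_all add: wt_def)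
  then have s: "snd m = snd m'" using assms(1) by simp
  then have "W * (fst m + snd m) = W * (fst m' + snd m')" using assms(1) by (simp add: wt_def)
  then show ?thesis using s assms(2) by (simp add: prod_eq_iff)
qed

lemma wt_le:
  assumes "fst m + snd m < fst m' + snd m' \<or> (fst m + snd m = fst m' + snd m' \<and> snd m \<le> snd m')" "snd m < W"
  shows "wt W m \<le> wt W m'"
proof (cases "fst m + snd m < fst m' + snd m'")
  case True
  then have "W * (fst m + snd m + 1) \<le> W * (fst m' + snd m')" by (intro mult_le_mono2) simp
  then show ?thesis using assms(2) by (simp add: wt_def algebra_simps)
next
  case False
  then show ?thesis using assms(1) by (auto simp: wt_def)
qed

lemma coeff_powsub:
  assumes "\<forall>m\<in>psupp F. snd m < W" "m \<in> psupp F"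
  shows "coeff (powsub W F) (wt W m) = pco F m"
proof -
  have "coeff (powsub W F) (wt W m) = (\<Sum>m'\<in>psupp F. if m' = m then pco F m' else 0)"
    unfolding powsub_def coeff_sum coeff_monom using assms wt_inj by (intro sum.cong) auto
  then show ?thesis using assms(2) finite_psupp by simp
qed

lemma leading_monomial:
  assumes "F \<noteq> 0" "\<forall>m\<in>psupp F. snd m < W"
  obtains m where "m \<in> psupp F" "degree (powsub W F) = wt W m" "powsub W F \<noteq> 0" "\<forall>m'\<in>psupp F. wt W m' \<le> wt W m"
proof -
  have fin: "finite (wt W ` psupp F)" "wt W ` psupp F \<noteq> {}" using finite_psupp psupp_nonempty assms(1) by auto
  obtain m where m: "m \<in> psupp F" "wt W m = Max (wt W ` psupp F)" using Max_in[OF fin] by auto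
  have mx: "\<forall>m'\<in>psupp F. wt W m' \<le> wt W m" using m(2) fin by simp
  have c: "coeff (powsub W F) (wt W m) \<noteq> 0"
    using coeff_powsub[OF assms(2) m(1)] m(1) by (simp add: psupp_def)
  have "degree (powsub W F) \<le> wt W m" unfolding powsub_def
    by (intro degree_sum_le finite_psupp) (use mx degree_monom_le le_trans in blast)
  then have "degree (powsub W F) = wt W m" using le_degree[OF c] by simp
  then show ?thesis using that m(1) mx c by fastforce
qed

text \<open>Under the substitution the degrees add up, and for large \<open>W\<close> a degree determines its monomial.\<close>

lemma leading_monomial_dvd:
  assumes F: "F \<noteq> 0" and dv: "\<phi> dvd F" and p: "p \<in> psupp \<phi>"
    and mx: "\<forall>m\<in>psupp \<phi>. fst m + snd m < fst p + snd p \<or> (fst m + snd m = fst p + snd p \<and> snd m \<le> snd p)"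
  shows "\<exists>m\<in>psupp F. fst p \<le> fst m \<and> snd p \<le> snd m"
proof -
  obtain G where FG: "F = \<phi> * G" using dv by (elim dvdE)
  have \<phi>: "\<phi> \<noteq> 0" and G: "G \<noteq> 0" using F FG by auto
  obtain w where w: "\<forall>m\<in>psupp F \<union> psupp \<phi> \<union> psupp G. snd m \<le> w"
    using finite_nat_set_iff_bounded_le[of "snd ` (psupp F \<union> psupp \<phi> \<union> psupp G)"] finite_psupp by auto
  define W where "W = 2 * w + 1"
  have W: "\<forall>m\<in>psupp F. snd m < W" "\<forall>m\<in>psupp \<phi>. snd m < W" "\<forall>m\<in>psupp G. snd m < W"
    using w by (force simp: W_def)+
  obtain mF where mF: "mF \<in> psupp F" "degree (powsub W F) = wt W mF"
    using leading_monomial[OF F W(1)] by blast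
  obtain mG where mG: "mG \<in> psupp G" "degree (powsub W G) = wt W mG" "powsub W G \<noteq> 0"
    using leading_monomial[OF G W(3)] by blast
  obtain m\<phi> where m\<phi>: "m\<phi> \<in> psupp \<phi>" "degree (powsub W \<phi>) = wt W m\<phi>" "powsub W \<phi> \<noteq> 0" "\<forall>m'\<in>psupp \<phi>. wt W m' \<le> wt W m\<phi>"
    using leading_monomial[OF \<phi> W(2)] by blast
  have "wt W m\<phi> = wt W p" using wt_le[of m\<phi> p W] mx m\<phi> W(2) p by (meson le_antisym)
  then have p\<phi>: "m\<phi> = p" using wt_inj W(2) p m\<phi>(1) by blast
  have "degree (powsub W F) = degree (powsub W \<phi>) + degree (powsub W G)"
    unfolding FG powsub_mult using m\<phi>(3) mG(3) by (rule degree_mult_eq)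
  then have "wt W mF = wt W p + wt W mG" using mF mG m\<phi> p\<phi> by simp
  also have "\<dots> = wt W (fst p + fst mG, snd p + snd mG)" by (simp add: wt_def algebra_simps)
  finally have e: "wt W mF = wt W (fst p + fst mG, snd p + snd mG)" .
  have "snd p \<le> w" "snd mG \<le> w" using w p mG(1) by blast+
  then have "snd p + snd mG < W" by (simp add: W_def)
  then have "mF = (fst p + fst mG, snd p + snd mG)" using wt_inj[OF e] W(1) mF(1) by simp
  then show ?thesis using mF(1) by (intro bexI[of _ mF]) auto
qed

text \<open>Gaussian elimination of one unknown with one equation.\<close>
lemma linear_system_nontrivial_solution:
  fixes M :: "'b \<Rightarrow> 'a \<Rightarrow> complex"
  assumes "finite Q" "finite A" "card Q < card A"
  shows "\<exists>z. (\<exists>a\<in>A. z a \<noteq> 0) \<and> (\<forall>b\<in>Q. (\<Sum>a\<in>A. M b a * z a) = 0)"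
  using assms
proof (induction Q arbitrary: A M rule: finite_induct)
  case empty
  then obtain a where "a \<in> A" by fastforce
  then show ?case by (intro exI[of _ "\<lambda>_. 1"]) auto
next
  case (insert b Q)
  show ?case
  proof (cases "\<forall>a\<in>A. M b a = 0")
    case True
    have "card Q < card A" using insert by simp
    then show ?thesis using insert.IH[OF insert.prems(1), of M] True by auto
  next
    case False
    then obtain a1 where a1: "a1 \<in> A" "M b a1 \<noteq> 0" by blast
    have "card Q < card (A - {a1})" using insert a1 by simp
    then obtain z where z: "\<exists>a\<in>A - {a1}. z a \<noteq> 0"
        "\<forall>c\<in>Q. (\<Sum>a\<in>A - {a1}. (M c a - M c a1 * M b a / M b a1) * z a) = 0"
      using insert.IH[of "A - {a1}" "\<lambda>c a. M c a - M c a1 * M b a / M b a1"] insert.prems by auto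
    define s where "s = (\<Sum>a\<in>A - {a1}. M b a * z a)"
    define y where "y = z(a1 := - s / M b a1)"
    have sm: "(\<Sum>a\<in>A. M c a * y a) = M c a1 * (- s / M b a1) + (\<Sum>a\<in>A - {a1}. M c a * z a)" for c
      unfolding sum.remove[OF insert.prems(1) a1(1)] by (simp add: y_def)
    have "(\<Sum>a\<in>A. M b a * y a) = 0" unfolding sm using a1(2) by (simp add: s_def)
    moreover have "(\<Sum>a\<in>A. M c a * y a) = 0" if "c \<in> Q" for c
    proof -
      have "0 = (\<Sum>a\<in>A - {a1}. M c a * z a) - (\<Sum>a\<in>A - {a1}. M c a1 / M b a1 * (M b a * z a))"
        unfolding sum_subtractf[symmetric] using bspec[OF z(2) that] by (simp add: algebra_simps)
      also have "(\<Sum>a\<in>A - {a1}. M c a1 / M b a1 * (M b a * z a)) = M c a1 / M b a1 * s"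
        by (simp add: s_def sum_distrib_left)
      finally show ?thesis unfolding sm by simp
    qed
    moreover have "\<exists>a\<in>A. y a \<noteq> 0" using z(1) by (auto simp: y_def)
    ultimately show ?thesis by blast
  qed
qed

text \<open>After multiplication with \<open>P\<^sub>2\<^sup>n\<close> the values on the curve become a polynomial in \<open>t\<close> of degree at most
  \<open>n u\<close>, and its \<open>n u + 1\<close> coefficients depend linearly on the coefficients of \<open>F\<close>.\<close>
lemma vanishing_polynomial_exists:
  assumes deg: "\<And>l. degree (P l) \<le> u" and A: "finite A" "\<forall>m\<in>A. fst m + snd m \<le> n" and card: "n * u + 1 < card A"
  obtains F where "F \<noteq> 0" "psupp F \<subseteq> A" "F \<in> vanishing_ideal P"
proof -
  define T where "T m = P 0 ^ fst m * P 1 ^ snd m * P 2 ^ (n - fst m - snd m)" for m :: "nat \<times> nat"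
  obtain z where z: "\<exists>m\<in>A. z m \<noteq> 0" "\<forall>d\<in>{..n * u}. (\<Sum>m\<in>A. coeff (T m) d * z m) = 0"
    using linear_system_nontrivial_solution[OF finite_atMost A(1), of "n * u" "\<lambda>d m. coeff (T m) d"] card by auto
  define F where "F = (\<Sum>m\<in>A. monom (monom (z m) (fst m)) (snd m))"
  have pF: "pco F m = (if m \<in> A then z m else 0)" for m
  proof -
    have "pco F m = (\<Sum>m'\<in>A. if m' = m then z m' else 0)"
      unfolding F_def coeff_sum by (intro sum.cong) (auto simp: prod_eq_iff)
    then show ?thesis using A(1) by simp
  qed
  show ?thesis
  proof (rule that)
    show "F \<noteq> 0" using z(1) pF by (metis coeff_0)
    show sub: "psupp F \<subseteq> A" using pF by (auto simp: psupp_def split: if_splits)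
    have degT: "degree (T m) \<le> n * u" if "m \<in> A" for m
    proof -
      have pw: "degree (P l ^ r) \<le> r * u" for l r
        by (rule order_trans[OF degree_power_le]) (subst mult.commute, rule mult_le_mono2[OF deg])
      have "degree (T m) \<le> fst m * u + snd m * u + (n - fst m - snd m) * u"
        unfolding T_def using pw by (meson add_mono degree_mult_le le_trans)
      also have "\<dots> = (fst m + snd m + (n - fst m - snd m)) * u" by (simp add: distrib_right)
      also have "\<dots> = n * u" using A(2) that by (simp add: le_diff_conv2)
      finally show ?thesis .
    qed
    have H: "(\<Sum>m\<in>A. smult (z m) (T m)) = 0"
    proof (rule poly_eqI)
      fix d
      show "coeff (\<Sum>m\<in>A. smult (z m) (T m)) d = coeff 0 d"
      proof (cases "d \<le> n * u")
        case True
        then show ?thesis using z(2) by (simp add: coeff_sum mult.commute)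
      next
        case False
        then have "coeff (T m) d = 0" if "m \<in> A" for m
          using degT[OF that] by (intro coeff_eq_0) simp
        then show ?thesis by (simp add: coeff_sum)
      qed
    qed
    show "F \<in> vanishing_ideal P"
      unfolding vanishing_ideal_def
    proof (intro CollectI allI impI)
      fix t assume t: "poly (P 2) t \<noteq> 0"
      let ?x = "fst (curve_point P t)" and ?y = "snd (curve_point P t)"
      have "poly2 F ?x ?y = (\<Sum>m\<in>A. pco F m * ?x ^ fst m * ?y ^ snd m)"
        unfolding poly2_sum using sub A(1) by (intro sum.mono_neutral_left) (auto simp: psupp_def)
      also have "\<dots> = (\<Sum>m\<in>A. z m * poly (T m) t / poly (P 2) t ^ n)"
      proof (rule sum.cong)
        fix m assume m: "m \<in> A"
        have "n = fst m + snd m + (n - fst m - snd m)" using A(2) m by simp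
        then have "poly (P 2) t ^ n = poly (P 2) t ^ fst m * poly (P 2) t ^ snd m * poly (P 2) t ^ (n - fst m - snd m)"
          by (metis power_add)
        then show "pco F m * ?x ^ fst m * ?y ^ snd m = z m * poly (T m) t / poly (P 2) t ^ n"
          using m t pF[of m] by (simp add: curve_point_def T_def power_divide)
      qed simp
      also have "\<dots> = poly (\<Sum>m\<in>A. smult (z m) (T m)) t / poly (P 2) t ^ n"
        by (simp add: poly_sum sum_divide_distrib)
      finally show "poly2 F ?x ?y = 0" unfolding H by simp
    qed
  qed
qed

definition tri :: "nat \<Rightarrow> (nat \<times> nat) set" where
  "tri n = {m. fst m + snd m \<le> n}"

lemma card_tri: "finite (tri n)" "2 * card (tri n) = (n + 1) * (n + 2)"
proof (induction n)
  case 0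
  have "tri 0 = {(0, 0)}" by (auto simp: tri_def)
  then show "finite (tri 0)" "2 * card (tri 0) = (0 + 1) * (0 + 2)" by simp_all
next
  case (Suc n)
  have e: "tri (Suc n) = tri n \<union> (\<lambda>i. (i, Suc n - i)) ` {..Suc n}"
    by (force simp: tri_def image_iff)
  have d: "tri n \<inter> (\<lambda>i. (i, Suc n - i)) ` {..Suc n} = {}" by (auto simp: tri_def)
  show "finite (tri (Suc n))" unfolding e using Suc by simp
  have "card (tri (Suc n)) = card (tri n) + card ((\<lambda>i. (i, Suc n - i)) ` {..Suc n})"
    unfolding e using Suc(1) d by (intro card_Un_disjoint) auto
  also have "card ((\<lambda>i. (i, Suc n - i)) ` {..Suc n}) = n + 2"
    by (subst card_image) (auto simp: inj_on_def)
  finally show "2 * card (tri (Suc n)) = (Suc n + 1) * (Suc n + 2)" using Suc(2) by simp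
qed

text \<open>There are \<open>n d + d (3 - d) / 2\<close> monomials of degree at most \<open>n\<close> that are not divisible by a
  given monomial of degree \<open>d\<close>, while vanishing on the curve imposes \<open>n u + 1\<close> linear conditions
  on the polynomials of degree at most \<open>n\<close>. If \<open>d > u\<close>, some polynomial vanishes on the curve
  although its leading monomial is not divisible by the one of \<open>\<phi>\<close>.\<close>

lemma implicit_equation_degree:
  assumes deg: "\<And>l. degree (P l) \<le> u" and \<phi>: "implicit_equation P \<phi>"
  shows "\<phi> \<noteq> 0" "\<forall>m\<in>psupp \<phi>. fst m + snd m \<le> u"
proof -
  have dv: "F \<in> vanishing_ideal P \<Longrightarrow> \<phi> dvd F" for F using \<phi> by (simp add: implicit_equation_def)
  show nz: "\<phi> \<noteq> 0"
  proof
    assume 0: "\<phi> = 0"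
    define n where "n = 2 * u + 1"
    have "2 * (n * u + 1) < 2 * card (tri n)" unfolding card_tri by (simp add: n_def algebra_simps)
    then have c: "n * u + 1 < card (tri n)" by simp
    obtain F where "F \<noteq> 0" "F \<in> vanishing_ideal P"
      by (rule vanishing_polynomial_exists[OF deg card_tri(1) _ c]) (auto simp: tri_def)
    then show False using dv 0 by auto
  qed
  show "\<forall>m\<in>psupp \<phi>. fst m + snd m \<le> u"
  proof (rule ccontr)
    assume "\<not> ?thesis"
    then obtain m0 where m0: "m0 \<in> psupp \<phi>" "u < fst m0 + snd m0" by force
    define d where "d = Max ((\<lambda>m. fst m + snd m) ` psupp \<phi>)"
    have fin: "finite ((\<lambda>m. fst m + snd m) ` psupp \<phi>)" using finite_psupp by simp
    have dle: "fst m + snd m \<le> d" if "m \<in> psupp \<phi>" for m using that fin by (simp add: d_def)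
    have "d \<in> (\<lambda>m. fst m + snd m) ` psupp \<phi>" unfolding d_def using fin m0 by (intro Max_in) auto
    then obtain p0 where p0: "p0 \<in> psupp \<phi>" "fst p0 + snd p0 = d" by auto
    obtain p where p: "p \<in> psupp \<phi> \<and> fst p + snd p = d"
        "\<forall>m. m \<in> psupp \<phi> \<and> fst m + snd m = d \<longrightarrow> snd m \<le> snd p"
      using arg_max_nat_lemma[of "\<lambda>m. m \<in> psupp \<phi> \<and> fst m + snd m = d" p0 snd "Suc d"] p0 by fastforce
    have du: "u < d" using m0 dle by fastforce
    (* large enough for the linear term n (d - u) of the count to outweigh d (d - 3) / 2 *)
    define n where "n = d * d + d"
    define A where "A = {m \<in> tri n. \<not> (fst p \<le> fst m \<and> snd p \<le> snd m)}"
    have finA: "finite A" using card_tri(1) by (simp add: A_def)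
    have e: "tri n = A \<union> (\<lambda>m. (fst m + fst p, snd m + snd p)) ` tri (n - d)"
    proof (intro set_eqI iffI)
      fix m assume m: "m \<in> tri n"
      show "m \<in> A \<union> (\<lambda>m. (fst m + fst p, snd m + snd p)) ` tri (n - d)"
      proof (cases "fst p \<le> fst m \<and> snd p \<le> snd m")
        case True
        then have "m = (\<lambda>m. (fst m + fst p, snd m + snd p)) (fst m - fst p, snd m - snd p)" by (simp add: prod_eq_iff)
        moreover have "(fst m - fst p, snd m - snd p) \<in> tri (n - d)" using m True p(1) by (auto simp: tri_def)
        ultimately show ?thesis by blast
      qed (use m in \<open>simp add: A_def\<close>)
    next
      fix m assume "m \<in> A \<union> (\<lambda>m. (fst m + fst p, snd m + snd p)) ` tri (n - d)"
      then show "m \<in> tri n" using p(1) by (auto simp: A_def tri_def n_def)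
    qed
    have "card (tri n) \<le> card A + card ((\<lambda>m. (fst m + fst p, snd m + snd p)) ` tri (n - d))"
      unfolding e by (rule card_Un_le)
    also have "\<dots> \<le> card A + card (tri (n - d))" using card_image_le[OF card_tri(1)] by simp
    finally have "2 * card (tri n) \<le> 2 * card A + 2 * card (tri (n - d))" by simp
    then have "(n + 1) * (n + 2) \<le> 2 * card A + (d * d + 1) * (d * d + 2)"
      unfolding card_tri by (simp add: n_def)
    moreover have "2 * (n * (d - 1) + 1) + (d * d + 1) * (d * d + 2) < (n + 1) * (n + 2)"
    proof -
      obtain d' where "d = Suc d'" using du by (cases d) auto
      then show ?thesis by (simp add: n_def algebra_simps)
    qed
    moreover have "n * u \<le> n * (d - 1)" using du by (intro mult_le_mono2) simp
    ultimately have "2 * (n * (d - 1) + 1) + (d * d + 1) * (d * d + 2) < 2 * card A + (d * d + 1) * (d * d + 2)"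
      and nu: "n * u \<le> n * (d - 1)" by (blast intro: less_le_trans)+
    then have "n * (d - 1) + 1 < card A" by (simp only: add_less_cancel_right) simp
    then have c: "n * u + 1 < card A" using nu by linarith
    obtain F where F: "F \<noteq> 0" "psupp F \<subseteq> A" "F \<in> vanishing_ideal P"
      by (rule vanishing_polynomial_exists[OF deg finA _ c]) (auto simp: A_def tri_def)
    have "\<exists>m\<in>psupp F. fst p \<le> fst m \<and> snd p \<le> snd m"
    proof (rule leading_monomial_dvd[OF F(1) dv[OF F(3)]])
      show "p \<in> psupp \<phi>" using p by blast
      show "\<forall>m\<in>psupp \<phi>. fst m + snd m < fst p + snd p \<or> (fst m + snd m = fst p + snd p \<and> snd m \<le> snd p)"
        using p dle by (metis le_neq_implies_less)
    qed
    then show False using F(2) by (auto simp: A_def)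
  qed
qed

section \<open>Exponents of the implicit equation\<close>

lemma prod_UNIV_3_distinct:
  fixes i j k :: 3 and f :: "3 \<Rightarrow> 'a::comm_monoid_mult"
  assumes "i \<noteq> j" "j \<noteq> k" "i \<noteq> k"
  shows "(\<Prod>l\<in>UNIV. f l) = f i * f j * f k"
  using assms by (subst distinct_3_cases(2)[OF assms]) (simp add: mult.assoc)

text \<open>The exponents after homogenization in degree \<open>u\<close> with a third variable.\<close>
definition expo :: "nat \<Rightarrow> nat \<times> nat \<Rightarrow> 3 \<Rightarrow> nat" where
  "expo u m l = (if l = 0 then fst m else if l = 1 then snd m else u - fst m - snd m)"

text \<open>The homogenized polynomial. It treats the three indices alike, while the affine equation singles out
  the denominator.\<close>
definition hform :: "complex poly poly \<Rightarrow> nat \<Rightarrow> (3 \<Rightarrow> complex) \<Rightarrow> complex" where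
  "hform \<phi> u X = (\<Sum>m\<in>psupp \<phi>. pco \<phi> m * (\<Prod>l\<in>UNIV. X l ^ expo u m l))"

lemma expo_simps: "expo u m 0 = fst m" "expo u m 1 = snd m" "expo u m 2 = u - fst m - snd m"
  by (simp_all add: expo_def)

lemma sum_expo:
  assumes "i \<noteq> j" "j \<noteq> k" "i \<noteq> k" "fst m + snd m \<le> u"
  shows "expo u m i + expo u m j + expo u m k = u"
proof -
  have "(\<Sum>l\<in>UNIV. expo u m l) = expo u m 0 + expo u m 1 + expo u m 2"
    by (rule sum_UNIV_3_distinct) auto
  then show ?thesis using assms(4) unfolding sum_UNIV_3_distinct[OF assms(1-3)] by (simp add: expo_simps)
qed

lemma hform_scale:
  assumes "\<forall>m\<in>psupp \<phi>. fst m + snd m \<le> u"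
  shows "hform \<phi> u (\<lambda>l. c * X l) = c ^ u * hform \<phi> u X"
proof -
  have "(\<Prod>l\<in>UNIV. (c * X l) ^ expo u m l) = c ^ u * (\<Prod>l\<in>UNIV. X l ^ expo u m l)" if "m \<in> psupp \<phi>" for m
  proof -
    have "(\<Prod>l\<in>UNIV. (c * X l) ^ expo u m l) = (\<Prod>l\<in>UNIV. c ^ expo u m l) * (\<Prod>l\<in>UNIV. X l ^ expo u m l)"
      by (simp add: power_mult_distrib prod.distrib)
    also have "(\<Prod>l\<in>UNIV. c ^ expo u m l) = c ^ (expo u m 0 + expo u m 1 + expo u m 2)"
      by (subst prod_UNIV_3_distinct[of 0 1 2]) (simp_all add: power_add)
    also have "expo u m 0 + expo u m 1 + expo u m 2 = u" using assms that by (intro sum_expo) auto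
    finally show ?thesis .
  qed
  then show ?thesis unfolding hform_def sum_distrib_left by (intro sum.cong) (simp_all add: mult_ac)
qed

text \<open>Outside the finite set \<open>E\<close> the parameter is determined by the point of the curve.\<close>
locale implicit_curve =
  fixes P :: "3 \<Rightarrow> complex poly" and \<phi> :: "complex poly poly" and u :: nat and E :: "complex set"
  assumes deg: "degree (P l) \<le> u" and nz: "P l \<noteq> 0" and phi: "implicit_equation P \<phi>" and finE: "finite E"
    and inj: "t \<notin> E \<Longrightarrow> poly (P 2) t \<noteq> 0 \<Longrightarrow> poly (P 2) s \<noteq> 0 \<Longrightarrow> curve_point P s = curve_point P t \<Longrightarrow> s = t"
begin

abbreviation e :: "nat \<times> nat \<Rightarrow> 3 \<Rightarrow> nat" where "e \<equiv> expo u"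

lemma supp_le: "m \<in> psupp \<phi> \<Longrightarrow> fst m + snd m \<le> u"
  using implicit_equation_degree[OF deg phi] by blast

lemma supp_ne: "psupp \<phi> \<noteq> {}"
  using implicit_equation_degree(1)[OF deg phi] by (rule psupp_nonempty)

lemma hform_vanishes:
  assumes t: "poly (P 2) t \<noteq> 0"
  shows "hform \<phi> u (\<lambda>l. poly (P l) t) = 0"
proof -
  have "\<phi> \<in> vanishing_ideal P" using phi by (simp add: implicit_equation_def)
  then have 0: "poly2 \<phi> (poly (P 0) t / poly (P 2) t) (poly (P 1) t / poly (P 2) t) = 0"
    using t by (simp add: vanishing_ideal_def curve_point_def)
  have "hform \<phi> u (\<lambda>l. poly (P l) t) = poly (P 2) t ^ u * poly2 \<phi> (poly (P 0) t / poly (P 2) t) (poly (P 1) t / poly (P 2) t)"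
    unfolding hform_def poly2_sum sum_distrib_left
  proof (rule sum.cong)
    fix m assume "m \<in> psupp \<phi>"
    then have "u = fst m + snd m + (u - fst m - snd m)" using supp_le by simp
    then have Q: "poly (P 2) t ^ u = poly (P 2) t ^ fst m * poly (P 2) t ^ snd m * poly (P 2) t ^ (u - fst m - snd m)"
      by (metis power_add)
    have "(\<Prod>l\<in>UNIV. poly (P l) t ^ e m l) = poly (P 0) t ^ fst m * poly (P 1) t ^ snd m * poly (P 2) t ^ (u - fst m - snd m)"
      by (subst prod_UNIV_3_distinct[of 0 1 2]) (simp_all add: expo_simps)
    then show "pco \<phi> m * (\<Prod>l\<in>UNIV. poly (P l) t ^ e m l) =
        poly (P 2) t ^ u * (pco \<phi> m * (poly (P 0) t / poly (P 2) t) ^ fst m * (poly (P 1) t / poly (P 2) t) ^ snd m)"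
      unfolding Q using t by (simp add: power_divide)
  qed simp
  then show ?thesis using 0 by simp
qed

lemma expo_determined:
  assumes "i \<noteq> j" "j \<noteq> k" "i \<noteq> k" "m \<in> psupp \<phi>" "m' \<in> psupp \<phi>" "e m i = e m' i" "e m j = e m' j"
  shows "m = m'"
proof -
  have "e m i + e m j + e m k = u" "e m' i + e m' j + e m' k = u"
    using sum_expo[OF assms(1-3)] supp_le assms(4,5) by blast+
  then have "e m k = e m' k" using assms(6,7) by simp
  then have "e m l = e m' l" for l using distinct_3_cases(1)[OF assms(1-3), of l] assms(6,7) by auto
  from this[of 0] this[of 1] show ?thesis by (simp add: expo_simps prod_eq_iff)
qed

text \<open>The curve \<open>x\<^sub>i / x\<^sub>k = \<xi> s\<^sup>a\<close>, \<open>x\<^sub>j / x\<^sub>k = \<eta> s\<^sup>b (1 + \<kappa> s\<^sup>a)\<close> meets the parameterized curve in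
  the points with \<open>f = \<gamma> g\<close>, and all these meetings are roots of the restriction of \<open>\<phi>\<close> to the test
  curve. For general \<open>\<xi>\<close> and \<open>\<eta>\<close> the restriction starts with the power of \<open>s\<close> that is the least
  weight \<open>a m\<^sub>i + b m\<^sub>j\<close> of an exponent of \<open>\<phi>\<close>. So many meetings force a small weight.\<close>

lemma test_curve:
  fixes \<kappa> :: complex
  assumes d: "i \<noteq> j" "j \<noteq> k" "i \<noteq> k" and a: "0 < a" and ab: "coprime a b" and finX: "finite Xb"
    and pen: "\<And>\<xi>. \<xi> \<notin> Xb \<Longrightarrow> \<xi> \<noteq> 0 \<Longrightarrow> \<exists>f g. f \<noteq> 0 \<and> g \<noteq> 0 \<and>
      (\<forall>r. r \<noteq> 0 \<longrightarrow> poly f r = 0 \<longrightarrow> poly g r \<noteq> 0) \<and>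
      N1 \<le> max (degree f) (degree g) \<and> min (order 0 f) (order 0 g) \<le> N0 \<and>
      (\<forall>t \<gamma>. poly f t = \<gamma> * poly g t \<longrightarrow>
        poly (P j) t ^ a * poly (P k) t ^ b = \<gamma> * poly (P i) t ^ b * (poly (P k) t + \<kappa> / \<xi> * poly (P i) t) ^ a)"
    and D: "\<And>m. m \<in> psupp \<phi> \<Longrightarrow> a * e m i + b * e m j + (if \<kappa> = 0 then 0 else a * e m j) \<le> D"
  shows "\<exists>m\<in>psupp \<phi>. a * e m i + b * e m j + N1 \<le> D + N0"
proof -
  define w where "w m = a * e m i + b * e m j" for m
  define \<mu> where "\<mu> = Min (w ` psupp \<phi>)"
  have \<mu>le: "\<mu> \<le> w m" if "m \<in> psupp \<phi>" for m using that finite_psupp[of \<phi>] by (simp add: \<mu>_def)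
  have "\<mu> \<in> w ` psupp \<phi>" unfolding \<mu>_def using finite_psupp supp_ne by (intro Min_in) auto
  then obtain m0 where m0: "m0 \<in> psupp \<phi>" "w m0 = \<mu>" by auto
  obtain \<xi> where \<xi>: "\<xi> \<notin> Xb" "\<xi> \<noteq> 0"
    using ex_new_if_finite[OF infinite_UNIV_char_0, of "insert 0 Xb"] finX by auto
  obtain f g where f: "f \<noteq> 0" and g: "g \<noteq> 0" and fg: "\<And>r. r \<noteq> 0 \<Longrightarrow> poly f r = 0 \<Longrightarrow> poly g r = 0 \<Longrightarrow> False"
    and N1: "N1 \<le> max (degree f) (degree g)" and N0: "min (order 0 f) (order 0 g) \<le> N0"
    and eq: "\<And>t \<gamma>. poly f t = \<gamma> * poly g t \<Longrightarrow>
        poly (P j) t ^ a * poly (P k) t ^ b = \<gamma> * poly (P i) t ^ b * (poly (P k) t + \<kappa> / \<xi> * poly (P i) t) ^ a"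
    using pen[OF \<xi>] by blast
  define F where "F = E \<union> (\<Union>l\<in>UNIV. {t. poly (P l) t = 0})"
  have finF: "finite F" using finE poly_roots_finite[OF nz] by (simp add: F_def)
  obtain G where finG: "finite G" and G: "\<And>\<gamma>. \<gamma> \<notin> G \<Longrightarrow>
    \<exists>N. finite N \<and> (\<forall>t\<in>N. t \<noteq> 0 \<and> t \<notin> F \<and> poly f t = \<gamma> * poly g t) \<and>
      max (degree f) (degree g) \<le> card N + min (order 0 f) (order 0 g)"
    by (rule pencil_roots[OF f g fg finF]) blast+
  define M where "M = {m \<in> psupp \<phi>. w m = \<mu>}"
  have finM: "finite M" using finite_psupp by (simp add: M_def)
  (* the coefficient of the lowest power of s in the restriction, as a polynomial in \<eta> *)
  define Low where "Low = (\<Sum>m\<in>M. monom (pco \<phi> m * \<xi> ^ e m i) (e m j))"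
  have Low: "Low \<noteq> 0"
  proof -
    have "e m j = e m0 j \<longleftrightarrow> m = m0" if m: "m \<in> M" for m
    proof
      assume j: "e m j = e m0 j"
      have "w m = w m0" using m m0 by (simp add: M_def)
      then have "e m i = e m0 i" using j a by (simp add: w_def)
      then show "m = m0" using expo_determined[OF d _ m0(1) _ j] m by (simp add: M_def)
    qed simp
    then have "coeff Low (e m0 j) = (\<Sum>m\<in>M. if m = m0 then pco \<phi> m * \<xi> ^ e m i else 0)"
      unfolding Low_def coeff_sum coeff_monom by (intro sum.cong) auto
    also have "\<dots> = pco \<phi> m0 * \<xi> ^ e m0 i" using finM m0 by (simp add: M_def)
    also have "\<dots> \<noteq> 0" using m0(1) \<xi>(2) by (simp add: psupp_def)
    finally show ?thesis by auto
  qed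
  have finR: "finite {\<eta>. \<eta> ^ a / \<xi> ^ b \<in> G}"
  proof (rule finite_subset)
    show "{\<eta>. \<eta> ^ a / \<xi> ^ b \<in> G} \<subseteq> (\<Union>\<gamma>\<in>G. {\<eta>. poly (monom 1 a - [:\<gamma> * \<xi> ^ b:]) \<eta> = 0})"
      using \<xi>(2) by (auto simp: poly_monom)
    have "monom 1 a - [:c:] \<noteq> 0" for c :: complex
    proof
      assume "monom 1 a - [:c:] = 0"
      then have "coeff (monom 1 a - [:c:]) a = 0" by simp
      then show False using a by (simp add: coeff_pCons split: nat.splits)
    qed
    then show "finite (\<Union>\<gamma>\<in>G. {\<eta>. poly (monom 1 a - [:\<gamma> * \<xi> ^ b:]) \<eta> = 0})"
      using finG poly_roots_finite by (intro finite_UN_I) blast+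
  qed
  obtain \<eta> where \<eta>: "\<eta> \<noteq> 0" "poly Low \<eta> \<noteq> 0" "\<eta> ^ a / \<xi> ^ b \<notin> G"
    using ex_new_if_finite[OF infinite_UNIV_char_0, of "{0} \<union> {\<eta>. poly Low \<eta> = 0} \<union> {\<eta>. \<eta> ^ a / \<xi> ^ b \<in> G}"]
      finR poly_roots_finite[OF Low] by auto
  define \<gamma> where "\<gamma> = \<eta> ^ a / \<xi> ^ b"
  obtain N where N: "finite N" "\<And>t. t \<in> N \<Longrightarrow> t \<notin> F" "\<And>t. t \<in> N \<Longrightarrow> poly f t = \<gamma> * poly g t"
      "max (degree f) (degree g) \<le> card N + min (order 0 f) (order 0 g)"
    using G[OF \<eta>(3)] unfolding \<gamma>_def by blast
  (* the restriction of \<phi> to the test curve, divided by the lowest power of s *)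
  define T where "T = (\<Sum>m\<in>psupp \<phi>. monom (pco \<phi> m * \<xi> ^ e m i * \<eta> ^ e m j) (w m - \<mu>) * (1 + monom \<kappa> a) ^ e m j)"
  have "poly T 0 = (\<Sum>m\<in>psupp \<phi>. if w m = \<mu> then pco \<phi> m * \<xi> ^ e m i * \<eta> ^ e m j else 0)"
    unfolding T_def poly_sum
  proof (rule sum.cong)
    fix m assume "m \<in> psupp \<phi>"
    then have "w m - \<mu> = 0 \<longleftrightarrow> w m = \<mu>" using \<mu>le[of m] by auto
    then show "poly (monom (pco \<phi> m * \<xi> ^ e m i * \<eta> ^ e m j) (w m - \<mu>) * (1 + monom \<kappa> a) ^ e m j) 0 =
        (if w m = \<mu> then pco \<phi> m * \<xi> ^ e m i * \<eta> ^ e m j else 0)"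
      using a by (simp add: poly_monom power_0_left)
  qed simp
  also have "\<dots> = (\<Sum>m\<in>M. pco \<phi> m * \<xi> ^ e m i * \<eta> ^ e m j)"
    unfolding M_def by (rule sum.inter_filter[symmetric]) (rule finite_psupp)
  also have "\<dots> = poly Low \<eta>" by (simp add: Low_def poly_sum poly_monom)
  finally have T0: "poly T 0 \<noteq> 0" using \<eta>(2) by simp
  then have Tnz: "T \<noteq> 0" by auto
  have degT: "degree T \<le> D - \<mu>"
    unfolding T_def
  proof (rule degree_sum_le[OF finite_psupp])
    fix m assume m: "m \<in> psupp \<phi>"
    have "degree ((1 + monom \<kappa> a) ^ e m j) \<le> degree (1 + monom \<kappa> a) * e m j" by (rule degree_power_le)
    also have "\<dots> \<le> (if \<kappa> = 0 then 0 else a) * e m j"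
      by (intro mult_le_mono1) (auto intro!: degree_add_le degree_monom_le)
    finally have 1: "degree ((1 + monom \<kappa> a) ^ e m j) \<le> (if \<kappa> = 0 then 0 else a * e m j)" by (simp split: if_splits)
    have "degree (monom (pco \<phi> m * \<xi> ^ e m i * \<eta> ^ e m j) (w m - \<mu>) * (1 + monom \<kappa> a) ^ e m j)
        \<le> (w m - \<mu>) + (if \<kappa> = 0 then 0 else a * e m j)"
      by (rule order_trans[OF degree_mult_le add_mono[OF degree_monom_le 1]])
    also have "\<dots> \<le> D - \<mu>" using D[OF m] \<mu>le[OF m] unfolding w_def by linarith
    finally show "degree (monom (pco \<phi> m * \<xi> ^ e m i * \<eta> ^ e m j) (w m - \<mu>) * (1 + monom \<kappa> a) ^ e m j) \<le> D - \<mu>" .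
  qed
  define X where "X s = (\<lambda>l. if l = i then \<xi> * s ^ a else if l = j then \<eta> * s ^ b * (1 + \<kappa> * s ^ a) else 1)" for s :: complex
  have X: "X s i = \<xi> * s ^ a" "X s j = \<eta> * s ^ b * (1 + \<kappa> * s ^ a)" "X s k = 1" for s
    using d by (auto simp: X_def)
  have hT: "hform \<phi> u (X s) = s ^ \<mu> * poly T s" for s
    unfolding hform_def T_def poly_sum sum_distrib_left
  proof (rule sum.cong)
    fix m assume m: "m \<in> psupp \<phi>"
    have "s ^ \<mu> * s ^ (w m - \<mu>) = s ^ w m" using \<mu>le[OF m] by (simp flip: power_add)
    also have "\<dots> = (s ^ a) ^ e m i * (s ^ b) ^ e m j" by (simp add: w_def power_add power_mult)
    finally have s: "s ^ \<mu> * s ^ (w m - \<mu>) = (s ^ a) ^ e m i * (s ^ b) ^ e m j" .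
    have "pco \<phi> m * (\<Prod>l\<in>UNIV. X s l ^ e m l) =
        pco \<phi> m * \<xi> ^ e m i * \<eta> ^ e m j * ((s ^ a) ^ e m i * (s ^ b) ^ e m j) * (1 + \<kappa> * s ^ a) ^ e m j"
      unfolding prod_UNIV_3_distinct[OF d] X by (simp add: power_mult_distrib)
    then show "pco \<phi> m * (\<Prod>l\<in>UNIV. X s l ^ e m l) =
        s ^ \<mu> * poly (monom (pco \<phi> m * \<xi> ^ e m i * \<eta> ^ e m j) (w m - \<mu>) * (1 + monom \<kappa> a) ^ e m j) s"
      unfolding s[symmetric] by (simp add: poly_monom mult_ac)
  qed simp
  have Pnz: "poly (P l) t \<noteq> 0" if "t \<in> N" for t l using N(2)[OF that] by (auto simp: F_def)
  have ex: "\<exists>s. s \<noteq> 0 \<and> (\<forall>l. poly (P l) t = poly (P k) t * X s l)" if t: "t \<in> N" for t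
  proof -
    define x y where "x = poly (P i) t / poly (P k) t" and "y = poly (P j) t / poly (P k) t"
    define c where "c = 1 + \<kappa> / \<xi> * x"
    have xy0: "x \<noteq> 0" "y \<noteq> 0" using Pnz[OF t] by (auto simp: x_def y_def)
    have Px: "poly (P i) t = poly (P k) t * x" "poly (P j) t = poly (P k) t * y" using Pnz[OF t] by (auto simp: x_def y_def)
    have Pc: "poly (P k) t + \<kappa> / \<xi> * (poly (P k) t * x) = poly (P k) t * c" by (simp add: c_def algebra_simps)
    have "(poly (P k) t ^ a * poly (P k) t ^ b) * y ^ a = (poly (P k) t * y) ^ a * poly (P k) t ^ b"
      by (simp add: power_mult_distrib mult_ac)
    also have "\<dots> = \<gamma> * (poly (P k) t * x) ^ b * (poly (P k) t * c) ^ a"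
      using eq[OF N(3)[OF t]] unfolding Px Pc .
    also have "\<dots> = (poly (P k) t ^ a * poly (P k) t ^ b) * (\<gamma> * x ^ b * c ^ a)"
      by (simp add: power_mult_distrib mult_ac)
    finally have ya: "y ^ a = \<gamma> * x ^ b * c ^ a" using Pnz[OF t, of k] by simp
    then have c0: "c \<noteq> 0" using xy0(2) a by (auto simp: power_0_left)
    have "(y / (\<eta> * c)) ^ a = (x / \<xi>) ^ b"
      using ya \<eta>(1) \<xi>(2) c0 by (simp add: \<gamma>_def power_divide power_mult_distrib field_simps)
    then obtain s where s: "s ^ a = x / \<xi>" "s ^ b = y / (\<eta> * c)"
      using common_root_of_powers[OF ab, of "x / \<xi>" "y / (\<eta> * c)"] xy0 \<xi>(2) \<eta>(1) c0 by auto
    have "s \<noteq> 0" using s(1) a xy0(1) \<xi>(2) by (auto simp: power_0_left)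
    moreover have "X s i = x" "X s j = y" using s \<xi>(2) \<eta>(1) c0 by (simp_all add: X c_def)
    then have "poly (P l) t = poly (P k) t * X s l" for l
      using distinct_3_cases(1)[OF d, of l] Px X(3)[of s] by auto
    ultimately show ?thesis by blast
  qed
  then obtain \<sigma> where \<sigma>: "\<And>t. t \<in> N \<Longrightarrow> \<sigma> t \<noteq> 0" "\<And>t l. t \<in> N \<Longrightarrow> poly (P l) t = poly (P k) t * X (\<sigma> t) l"
    by metis
  have "inj_on \<sigma> N"
  proof (rule inj_onI)
    fix t t' assume t: "t \<in> N" "t' \<in> N" and st: "\<sigma> t = \<sigma> t'"
    have "poly (P l) t / poly (P 2) t = X (\<sigma> t) l / X (\<sigma> t) 2" if "t \<in> N" for t l
      using \<sigma>(2)[OF that, of l] \<sigma>(2)[OF that, of 2] Pnz[OF that, of k] by simp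
    then have "curve_point P t = curve_point P t'" using t st by (simp add: curve_point_def)
    moreover have "t' \<notin> E" using N(2)[OF t(2)] by (simp add: F_def)
    ultimately show "t = t'" using inj Pnz t by blast
  qed
  then have "card N = card (\<sigma> ` N)" by (simp add: card_image)
  also have "\<dots> \<le> card {s. poly T s = 0}"
  proof (rule card_mono)
    show "finite {s. poly T s = 0}" using Tnz by (rule poly_roots_finite)
    show "\<sigma> ` N \<subseteq> {s. poly T s = 0}"
    proof (clarsimp)
      fix t assume t: "t \<in> N"
      have "0 = hform \<phi> u (\<lambda>l. poly (P l) t)" using hform_vanishes Pnz[OF t] by simp
      also have "(\<lambda>l. poly (P l) t) = (\<lambda>l. poly (P k) t * X (\<sigma> t) l)" using \<sigma>(2)[OF t] by blast
      also have "hform \<phi> u \<dots> = poly (P k) t ^ u * hform \<phi> u (X (\<sigma> t))" using supp_le by (intro hform_scale) blast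
      finally show "poly T (\<sigma> t) = 0" unfolding hT using Pnz[OF t, of k] \<sigma>(1)[OF t] by simp
    qed
  qed
  also have "\<dots> \<le> degree T" using Tnz by (rule card_poly_roots_bound)
  also have "\<dots> \<le> D - \<mu>" by (rule degT)
  finally have "card N \<le> D - \<mu>" .
  moreover have "\<mu> \<le> D" using D[OF m0(1)] m0(2) unfolding w_def by linarith
  ultimately have "w m0 + N1 \<le> D + N0" using N1 N0 N(4) m0(2) by linarith
  then show ?thesis using m0(1) unfolding w_def by blast
qed

text \<open>For \<open>a = b = 1\<close> and \<open>\<kappa> = 0\<close> the test curve is a general line through the point \<open>x\<^sub>i = x\<^sub>j = 0\<close>. It
  meets the curve in the roots of \<open>P\<^sub>j = \<gamma> P\<^sub>i\<close>.\<close>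

lemma corner_exponent:
  assumes d: "i \<noteq> j" "j \<noteq> k" "i \<noteq> k"
    and com: "\<forall>r. r \<noteq> 0 \<longrightarrow> poly (P i) r = 0 \<longrightarrow> poly (P j) r \<noteq> 0"
  shows "\<exists>m\<in>psupp \<phi>. e m i + e m j + max (degree (P i)) (degree (P j)) \<le> u + min (order 0 (P i)) (order 0 (P j))"
proof -
  have "\<exists>m\<in>psupp \<phi>. 1 * e m i + 1 * e m j + max (degree (P i)) (degree (P j)) \<le> u + min (order 0 (P i)) (order 0 (P j))"
  proof (rule test_curve[OF d, where \<kappa> = 0 and Xb = "{}"])
    fix \<xi> :: complex
    show "\<exists>f g. f \<noteq> 0 \<and> g \<noteq> 0 \<and> (\<forall>r. r \<noteq> 0 \<longrightarrow> poly f r = 0 \<longrightarrow> poly g r \<noteq> 0) \<and>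
      max (degree (P i)) (degree (P j)) \<le> max (degree f) (degree g) \<and> min (order 0 f) (order 0 g) \<le> min (order 0 (P i)) (order 0 (P j)) \<and>
      (\<forall>t \<gamma>. poly f t = \<gamma> * poly g t \<longrightarrow>
        poly (P j) t ^ 1 * poly (P k) t ^ 1 = \<gamma> * poly (P i) t ^ 1 * (poly (P k) t + 0 / \<xi> * poly (P i) t) ^ 1)"
      by (rule exI[of _ "P j"], rule exI[of _ "P i"]) (use nz com in \<open>auto simp: max.commute min.commute\<close>)
  next
    fix m assume "m \<in> psupp \<phi>"
    then show "1 * e m i + 1 * e m j + (if (0::complex) = 0 then 0 else 1 * e m j) \<le> u"
      using sum_expo[OF d supp_le, of m] by simp
  qed auto
  then show ?thesis by simp
qed

text \<open>For \<open>\<kappa> = 1\<close> the meetings are the roots of \<open>P\<^sub>j\<^sup>a P\<^sub>k\<^sup>b = \<gamma> P\<^sub>i\<^sup>b S\<^sup>a\<close> with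
  \<open>S = P\<^sub>k + P\<^sub>i / \<xi>\<close>. For general \<open>\<xi>\<close> the exponents of \<open>S\<close> span the union of the intervals of \<open>P\<^sub>k\<close> and
  \<open>P\<^sub>i\<close>, and \<open>S\<close> has no root in common with \<open>P\<^sub>j\<close> except possibly \<open>0\<close>.\<close>
lemma test_exponent:
  assumes d: "i \<noteq> j" "j \<noteq> k" "i \<noteq> k" and a: "0 < a" and ab: "coprime a b"
    and com: "\<forall>l l' r. l \<noteq> l' \<longrightarrow> r \<noteq> 0 \<longrightarrow> poly (P l) r = 0 \<longrightarrow> poly (P l') r \<noteq> 0"
  defines "N1 \<equiv> max (a * degree (P j) + b * degree (P k)) (b * degree (P i) + a * max (degree (P k)) (degree (P i)))"
    and "N0 \<equiv> min (a * order 0 (P j) + b * order 0 (P k)) (b * order 0 (P i) + a * min (order 0 (P k)) (order 0 (P i)))"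
  shows "\<exists>m\<in>psupp \<phi>. a * e m i + b * e m j + N1 \<le> (a + b) * u + N0"
proof -
  define I where "I = {degree (P k), degree (P i), order 0 (P k), order 0 (P i)}"
  define K where "K = (\<lambda>n. - coeff (P k) n / coeff (P i) n) ` I \<union> (\<lambda>r. - poly (P k) r / poly (P i) r) ` {r. poly (P j) r = 0}"
  have finK: "finite K" using poly_roots_finite[OF nz] by (simp add: K_def I_def)
  show ?thesis
  proof (rule test_curve[OF d a ab, where \<kappa> = 1 and Xb = "(\<lambda>z. 1 / z) ` K"])
    show "finite ((\<lambda>z. 1 / z) ` K)" using finK by simp
    fix \<xi> :: complex assume \<xi>: "\<xi> \<notin> (\<lambda>z. 1 / z) ` K" "\<xi> \<noteq> 0"
    define q where "q = 1 / \<xi>"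
    have q0: "q \<noteq> 0" using \<xi>(2) by (simp add: q_def)
    have q: "q \<notin> K"
    proof
      assume "q \<in> K"
      then have "1 / q \<in> (\<lambda>z. 1 / z) ` K" by (rule imageI)
      then show False using \<xi> by (simp add: q_def)
    qed
    define S where "S = P k + smult q (P i)"
    have cS: "coeff S n \<noteq> 0" if n: "n \<in> I" "coeff (P k) n \<noteq> 0 \<or> coeff (P i) n \<noteq> 0" for n
    proof
      assume 0: "coeff S n = 0"
      then have s: "coeff (P k) n = - q * coeff (P i) n" by (simp add: S_def eq_neg_iff_add_eq_0)
      then have "coeff (P i) n \<noteq> 0" using n(2) by auto
      then have "q = - coeff (P k) n / coeff (P i) n" using s by simp
      then show False using q n(1) unfolding K_def by blast
    qed
    have S1: "max (degree (P k)) (degree (P i)) \<le> degree S"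
      by (rule le_degree, rule cS) (use nz in \<open>auto simp: I_def max_def\<close>)
    have S0: "order 0 S \<le> min (order 0 (P k)) (order 0 (P i))"
      by (rule order_0_le, rule cS) (use coeff_order_0_nonzero[OF nz] in \<open>auto simp: I_def min_def\<close>)
    have Snz: "S \<noteq> 0" using cS[of "degree (P k)"] nz by (auto simp: I_def)
    define f g where "f = P j ^ a * P k ^ b" and "g = P i ^ b * S ^ a"
    have f0: "f \<noteq> 0" and g0: "g \<noteq> 0" using nz Snz by (simp_all add: f_def g_def)
    have df: "degree f = a * degree (P j) + b * degree (P k)" "order 0 f = a * order 0 (P j) + b * order 0 (P k)"
      using f0 nz by (simp_all add: f_def degree_mult_eq degree_power_eq order_mult order_power)
    have dg: "degree g = b * degree (P i) + a * degree S" "order 0 g = b * order 0 (P i) + a * order 0 S"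
      using g0 nz Snz by (simp_all add: g_def degree_mult_eq degree_power_eq order_mult order_power)
    have com': "poly g r \<noteq> 0" if r: "r \<noteq> 0" "poly f r = 0" for r
    proof
      assume "poly g r = 0"
      then have g: "poly (P i) r = 0 \<and> 0 < b \<or> poly S r = 0" by (auto simp: g_def)
      have f: "poly (P j) r = 0 \<or> poly (P k) r = 0 \<and> 0 < b" using r(2) by (auto simp: f_def)
      have jk: "poly (P k) r \<noteq> 0" if "poly (P i) r = 0" using com d r(1) that by blast
      have ji: "poly (P j) r \<noteq> 0" if "poly (P i) r = 0" using com d r(1) that by blast
      have Pi: "poly (P i) r \<noteq> 0" using f jk ji by blast
      then have "poly S r = 0" using g by blast
      then have Sr: "poly (P k) r = - q * poly (P i) r" by (simp add: S_def eq_neg_iff_add_eq_0)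
      then have "poly (P k) r \<noteq> 0" using Pi q0 by simp
      then have "poly (P j) r = 0" using f by blast
      moreover have "q = - poly (P k) r / poly (P i) r" using Sr Pi by simp
      ultimately show False using q unfolding K_def by blast
    qed
    show "\<exists>f g. f \<noteq> 0 \<and> g \<noteq> 0 \<and> (\<forall>r. r \<noteq> 0 \<longrightarrow> poly f r = 0 \<longrightarrow> poly g r \<noteq> 0) \<and>
      N1 \<le> max (degree f) (degree g) \<and> min (order 0 f) (order 0 g) \<le> N0 \<and>
      (\<forall>t \<gamma>. poly f t = \<gamma> * poly g t \<longrightarrow>
        poly (P j) t ^ a * poly (P k) t ^ b = \<gamma> * poly (P i) t ^ b * (poly (P k) t + 1 / \<xi> * poly (P i) t) ^ a)"
    proof (rule exI[of _ f], rule exI[of _ g], intro conjI allI impI)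
      show "N1 \<le> max (degree f) (degree g)"
        unfolding N1_def df dg using S1 by (intro max.mono add_mono mult_le_mono) simp_all
      show "min (order 0 f) (order 0 g) \<le> N0"
        unfolding N0_def df dg using S0 by (intro min.mono add_mono mult_le_mono) simp_all
      fix t \<gamma> assume "poly f t = \<gamma> * poly g t"
      then show "poly (P j) t ^ a * poly (P k) t ^ b = \<gamma> * poly (P i) t ^ b * (poly (P k) t + 1 / \<xi> * poly (P i) t) ^ a"
        by (simp add: f_def g_def S_def q_def mult.assoc)
    qed (use f0 g0 com' in auto)
  next
    fix m assume "m \<in> psupp \<phi>"
    then have s: "e m i + e m j \<le> u" using sum_expo[OF d supp_le, of m] by simp
    have "a * e m i + b * e m j + a * e m j = a * (e m i + e m j) + b * e m j" by (simp add: algebra_simps)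
    also have "\<dots> \<le> a * u + b * u" using s by (intro add_mono mult_le_mono) auto
    finally show "a * e m i + b * e m j + (if (1::complex) = 0 then 0 else a * e m j) \<le> (a + b) * u"
      by (simp add: algebra_simps)
  qed
qed

text \<open>The left side is what the test curve gives at one end of the exponent intervals, the right side is the
  wanted bound; \<open>x\<close>, \<open>y\<close> and \<open>z\<close> are the gaps of \<open>i\<close>, \<open>j\<close> and \<open>k\<close> there. The bound is too weak if the
  gap of \<open>j\<close> is the only one that vanishes.\<close>

lemma test_bound_min:
  fixes x y z :: nat
  assumes "x = 0 \<or> y = 0 \<or> z = 0" "b = 0 \<or> \<not> (y = 0 \<and> 0 < x \<and> 0 < z)"
  shows "min (a * y + b * z) (b * x + a * min z x) \<le> min (a * y) (b * x)"
  using assms by (cases "z = 0"; cases "x = 0") auto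

text \<open>At each end at most one of the three gaps is the only vanishing one, so at most two indices are bad for
  the test curve. If \<open>j\<close> is good, the test curve gives the bound, if \<open>i\<close> is good, the test curve with
  exchanged roles does. Otherwise \<open>k\<close> is good, the corner support of \<open>i\<close> and \<open>j\<close> vanishes, and a line
  through the corner produces the exponent \<open>m\<^sub>i = m\<^sub>j = 0\<close>.\<close>
lemma exponent_bound_coprime:
  fixes w :: "3 \<Rightarrow> nat"
  assumes d: "i \<noteq> j" "j \<noteq> k" "i \<noteq> k" and ab: "coprime a b"
    and com: "\<forall>l l' r. l \<noteq> l' \<longrightarrow> r \<noteq> 0 \<longrightarrow> poly (P l) r = 0 \<longrightarrow> poly (P l') r \<noteq> 0"
    and v: "\<And>l. order 0 (P l) = v l" and w: "\<And>l. degree (P l) + w l = u"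
    and v0: "v l0 = 0" and w0: "w l1 = 0"
  shows "\<exists>m\<in>psupp \<phi>. a * e m i + b * e m j \<le> min (a * v j) (b * v i) + min (a * w j) (b * w i)"
proof -
  define bad where "bad i j k \<longleftrightarrow> (v j = 0 \<and> 0 < v i \<and> 0 < v k) \<or> (w j = 0 \<and> 0 < w i \<and> 0 < w k)" for i j k
  have vz: "v i = 0 \<or> v j = 0 \<or> v k = 0" using v0 distinct_3_cases(1)[OF d, of l0] by auto
  have wz: "w i = 0 \<or> w j = 0 \<or> w k = 0" using w0 distinct_3_cases(1)[OF d, of l1] by auto
  have main: "\<exists>m\<in>psupp \<phi>. a * e m i + b * e m j \<le> min (a * v j) (b * v i) + min (a * w j) (b * w i)"
    if d: "i \<noteq> j" "j \<noteq> k" "i \<noteq> k" and a: "0 < a" and ab: "coprime a b" and g: "b = 0 \<or> \<not> bad i j k"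
      and vz: "v i = 0 \<or> v j = 0 \<or> v k = 0" and wz: "w i = 0 \<or> w j = 0 \<or> w k = 0" for i j k a b
  proof -
    obtain m where m: "m \<in> psupp \<phi>" "a * e m i + b * e m j +
        max (a * degree (P j) + b * degree (P k)) (b * degree (P i) + a * max (degree (P k)) (degree (P i)))
        \<le> (a + b) * u + min (a * v j + b * v k) (b * v i + a * min (v k) (v i))"
      using test_exponent[OF d a ab com] unfolding v by blast
    have D: "degree (P l) = u - w l" "w l \<le> u" for l using w[of l] by simp_all
    have "(a + b) * u = a * degree (P j) + b * degree (P k) + (a * w j + b * w k)"
      unfolding w[of j, symmetric] by (metis (no_types, lifting) add.assoc add.left_commute distrib_left distrib_right w)
    moreover have "(a + b) * u = b * degree (P i) + a * max (degree (P k)) (degree (P i)) + (b * w i + a * min (w k) (w i))"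
    proof -
      have "max (degree (P k)) (degree (P i)) + min (w k) (w i) = u" using w[of k] w[of i] by (simp add: max_def min_def)
      then have "(a + b) * u = b * (degree (P i) + w i) + a * (max (degree (P k)) (degree (P i)) + min (w k) (w i))"
        using w[of i] by (simp add: algebra_simps)
      then show ?thesis by (simp only: distrib_left add.assoc add.commute add.left_commute)
    qed
    ultimately have "a * e m i + b * e m j \<le> min (a * w j + b * w k) (b * w i + a * min (w k) (w i))
        + min (a * v j + b * v k) (b * v i + a * min (v k) (v i))"
      using m(2) by linarith
    also have "\<dots> \<le> min (a * w j) (b * w i) + min (a * v j) (b * v i)"
      using g vz wz by (intro add_mono test_bound_min) (auto simp: bad_def)
    finally show ?thesis using m(1) by (auto simp: add.commute)
  qed
  have swapped: "\<exists>m\<in>psupp \<phi>. a * e m i + b * e m j \<le> min (a * v j) (b * v i) + min (a * w j) (b * w i)"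
    if b: "0 < b" and g: "a = 0 \<or> \<not> bad j i k"
    using main[of j i k b a] d b g vz wz ab by (auto simp: add.commute min.commute coprime_commute)
  consider "a = 0" | "b = 0" | "0 < a" "0 < b" "\<not> bad i j k" | "0 < b" "\<not> bad j i k" | "\<not> bad i k j"
    using vz wz unfolding bad_def by fastforce
  then show ?thesis
  proof cases
    case 1
    then show ?thesis using swapped ab by simp
  next
    case 2
    then show ?thesis using main[OF d _ ab] vz wz ab by simp
  next
    case 3
    then show ?thesis using main[OF d _ ab] vz wz by blast
  next
    case 4
    then show ?thesis using swapped by blast
  next
    case 5
    have cij: "\<forall>r. r \<noteq> 0 \<longrightarrow> poly (P i) r = 0 \<longrightarrow> poly (P j) r \<noteq> 0" using com d(1) by blast
    obtain m where m: "m \<in> psupp \<phi>" "e m i + e m j + max (degree (P i)) (degree (P j)) \<le> u + min (v i) (v j)"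
      by (rule bexE[OF corner_exponent[OF d cij, unfolded v]]) (rule that)
    have "max (degree (P i)) (degree (P j)) + min (w i) (w j) = u" using w[of i] w[of j] by (simp add: max_def min_def)
    moreover have "min (w i) (w j) = 0" "min (v i) (v j) = 0" using 5 vz wz by (auto simp: bad_def)
    ultimately have "e m i = 0" "e m j = 0" using m(2) by linarith+
    then show ?thesis using m(1) by (intro bexI[of _ m]) simp_all
  qed
qed

lemma exponent_bound_nat:
  fixes w :: "3 \<Rightarrow> nat"
  assumes d: "i \<noteq> j" "j \<noteq> k" "i \<noteq> k"
    and com: "\<forall>l l' r. l \<noteq> l' \<longrightarrow> r \<noteq> 0 \<longrightarrow> poly (P l) r = 0 \<longrightarrow> poly (P l') r \<noteq> 0"
    and v: "\<And>l. order 0 (P l) = v l" and w: "\<And>l. degree (P l) + w l = u"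
    and v0: "v l0 = 0" and w0: "w l1 = 0"
  shows "\<exists>m\<in>psupp \<phi>. a * e m i + b * e m j \<le> min (a * v j) (b * v i) + min (a * w j) (b * w i)"
proof (cases "gcd a b = 0")
  case True
  then show ?thesis using supp_ne by auto
next
  case False
  define g a' b' where "g = gcd a b" "a' = a div gcd a b" "b' = b div gcd a b"
  note defs = this
  have ab: "a = g * a'" "b = g * b'" by (simp_all add: defs)
  have "coprime a' b'" unfolding defs using False by (intro div_gcd_coprime) auto
  then obtain m where m: "m \<in> psupp \<phi>" "a' * e m i + b' * e m j \<le> min (a' * v j) (b' * v i) + min (a' * w j) (b' * w i)"
    using exponent_bound_coprime[OF d _ com v w v0 w0] by blast
  have mn: "min (g * x) (g * y) = g * min x y" for x y by (auto simp: min_def)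
  have "g * (a' * e m i + b' * e m j) \<le> g * (min (a' * v j) (b' * v i) + min (a' * w j) (b' * w i))"
    using m(2) by (rule mult_le_mono2)
  then show ?thesis using m(1) unfolding ab by (intro bexI[of _ m]) (simp_all add: distrib_left mult.assoc mn)
qed

text \<open>The weights are replaced by \<open>\<lceil>n a\<rceil>\<close> and \<open>\<lceil>n b\<rceil>\<close> for large \<open>n\<close>; the rounding costs at most
  \<open>C / n\<close>.\<close>
lemma exponent_bound:
  fixes w :: "3 \<Rightarrow> nat" and a b \<epsilon> :: real
  assumes d: "i \<noteq> j" "j \<noteq> k" "i \<noteq> k"
    and com: "\<forall>l l' r. l \<noteq> l' \<longrightarrow> r \<noteq> 0 \<longrightarrow> poly (P l) r = 0 \<longrightarrow> poly (P l') r \<noteq> 0"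
    and v: "\<And>l. order 0 (P l) = v l" and w: "\<And>l. degree (P l) + w l = u"
    and v0: "v l0 = 0" and w0: "w l1 = 0" and a: "0 \<le> a" and b: "0 \<le> b" and \<epsilon>: "0 < \<epsilon>"
  shows "\<exists>m\<in>psupp \<phi>. a * e m i + b * e m j \<le> min (a * v j) (b * v i) + min (a * w j) (b * w i) + \<epsilon>"
proof -
  define C where "C = real (v i) + real (v j) + real (w i) + real (w j)"
  obtain n :: nat where n: "C / \<epsilon> < real n" using reals_Archimedean2 by blast
  have C0: "0 \<le> C" by (simp add: C_def)
  have n0: "0 < real n" using n C0 \<epsilon> by (smt (verit) divide_nonneg_pos)
  define a' b' where "a' = nat \<lceil>n * a\<rceil>" "b' = nat \<lceil>n * b\<rceil>"
  note defs = this
  have "0 \<le> n * a" "0 \<le> n * b" using n0 a b by simp_all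
  then have A: "n * a \<le> real a'" "real a' \<le> n * a + 1" "n * b \<le> real b'" "real b' \<le> n * b + 1"
    unfolding defs by linarith+
  have A0: "0 \<le> real a'" "0 \<le> real b'" by simp_all
  obtain m where m: "m \<in> psupp \<phi>" "a' * e m i + b' * e m j \<le> min (a' * v j) (b' * v i) + min (a' * w j) (b' * w i)"
    using exponent_bound_nat[OF d com v w v0 w0] by blast
  have mn: "real (min (a' * x) (b' * y)) \<le> n * min (a * x) (b * y) + (real x + real y)" for x y :: nat
  proof -
    have "real a' * x \<le> (n * a + 1) * x" "real b' * y \<le> (n * b + 1) * y" using A by (auto intro: mult_right_mono)
    then have "real (a' * x) \<le> n * (a * x) + x" "real (b' * y) \<le> n * (b * y) + y" by (simp_all add: algebra_simps)
    then have "real (a' * x) \<le> n * (a * x) + (real x + real y)" "real (b' * y) \<le> n * (b * y) + (real x + real y)" by simp_all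
    moreover have "real (min (a' * x) (b' * y)) \<le> real (a' * x)" "real (min (a' * x) (b' * y)) \<le> real (b' * y)"
      by (simp_all only: of_nat_le_iff min.cobounded1 min.cobounded2)
    ultimately show ?thesis by (cases "a * x \<le> b * y") (simp_all add: min_absorb1 min_absorb2)
  qed
  have "n * (a * e m i + b * e m j) = (n * a) * e m i + (n * b) * e m j" by (simp add: algebra_simps)
  also have "\<dots> \<le> real a' * e m i + real b' * e m j" using A by (intro add_mono mult_right_mono) simp_all
  also have "\<dots> = real (a' * e m i + b' * e m j)" by simp
  also have "\<dots> \<le> real (min (a' * v j) (b' * v i) + min (a' * w j) (b' * w i))" using m(2) by (rule of_nat_mono)
  also have "\<dots> = real (min (a' * v j) (b' * v i)) + real (min (a' * w j) (b' * w i))" by (rule of_nat_add)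
  also have "\<dots> \<le> n * min (a * v j) (b * v i) + (real (v j) + real (v i)) + (n * min (a * w j) (b * w i) + (real (w j) + real (w i)))"
    by (intro add_mono mn)
  also have "\<dots> = n * (min (a * v j) (b * v i) + min (a * w j) (b * w i)) + C" by (simp add: C_def algebra_simps)
  also have "C \<le> n * \<epsilon>" using n \<epsilon> by (simp add: pos_divide_less_eq less_imp_le)
  finally have "n * (a * e m i + b * e m j) \<le> n * (min (a * v j) (b * v i) + min (a * w j) (b * w i) + \<epsilon>)"
    by (simp add: algebra_simps)
  then have "a * e m i + b * e m j \<le> min (a * v j) (b * v i) + min (a * w j) (b * w i) + \<epsilon>"
    using n0 by (simp only: mult_le_cancel_left_pos)
  then show ?thesis using m(1) by blast
qed

end

section \<open>Generic coefficients\<close>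

lemma poly_param_poly:
  "poly (param_poly B c i) r = (\<Sum>b\<in>B i. c i b * r ^ b)"
  by (simp add: param_poly_def poly_sum poly_monom)

text \<open>The two charts of the projective line: the lowest power of \<open>t\<close> is divided out at \<open>0\<close>, the highest
  one at infinity.\<close>

definition low_chart :: "(3 \<Rightarrow> nat set) \<Rightarrow> (3 \<Rightarrow> nat \<Rightarrow> complex) \<Rightarrow> 3 \<Rightarrow> complex \<Rightarrow> complex" where
  "low_chart B c i r = (\<Sum>b\<in>B i. c i b * r ^ (b - Min (B i)))"

definition high_chart :: "(3 \<Rightarrow> nat set) \<Rightarrow> (3 \<Rightarrow> nat \<Rightarrow> complex) \<Rightarrow> 3 \<Rightarrow> complex \<Rightarrow> complex" where
  "high_chart B c i r = (\<Sum>b\<in>B i. c i b * r ^ (Max (B i) - b))"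

lemma param_poly_charts:
  assumes "finite (B i)"
  shows "poly (param_poly B c i) r = r ^ Min (B i) * low_chart B c i r"
    "r \<noteq> 0 \<Longrightarrow> poly (param_poly B c i) r = r ^ Max (B i) * high_chart B c i (1 / r)"
proof -
  have "r ^ b = r ^ Min (B i) * r ^ (b - Min (B i))" if "b \<in> B i" for b
    using Min_le[OF assms that] by (simp flip: power_add)
  then show "poly (param_poly B c i) r = r ^ Min (B i) * low_chart B c i r"
    unfolding poly_param_poly low_chart_def sum_distrib_left by (intro sum.cong) simp_all
  assume r: "r \<noteq> 0"
  have "r ^ b = r ^ Max (B i) * (1 / r) ^ (Max (B i) - b)" if "b \<in> B i" for b
  proof -
    define n where "n = Max (B i) - b"
    have "b + n = Max (B i)" using Max_ge[OF assms that] by (simp add: n_def)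
    then have e: "r ^ Max (B i) = r ^ b * r ^ n" by (metis power_add)
    have "r ^ n * (1 / r) ^ n = 1" using r by (simp add: power_mult_distrib[symmetric])
    then show ?thesis unfolding n_def[symmetric] e by (simp add: mult.assoc)
  qed
  then show "poly (param_poly B c i) r = r ^ Max (B i) * high_chart B c i (1 / r)"
    unfolding poly_param_poly high_chart_def sum_distrib_left by (intro sum.cong) simp_all
qed

lemma continuous_coefficient: "continuous_on UNIV (\<lambda>p :: (3 \<Rightarrow> nat \<Rightarrow> complex) \<times> complex. fst p i b)"
proof -
  have "continuous_on UNIV (fst :: (3 \<Rightarrow> nat \<Rightarrow> complex) \<times> complex \<Rightarrow> _)"
    by (rule continuous_on_fst[OF continuous_on_id])
  from continuous_on_product_then_coordinatewise[OF this, of i]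
  show ?thesis by (rule continuous_on_product_then_coordinatewise)
qed

text \<open>A projection along a compact factor is closed.\<close>
lemma closed_compact_fibres:
  fixes h :: "'a::topological_space \<times> complex \<Rightarrow> complex \<times> complex"
  assumes "continuous_on UNIV h"
  shows "closed {c. \<exists>r\<in>cball 0 1. h (c, r) = 0}"
proof -
  let ?K = "cball (0::complex) 1"
  have "closed_map (prod_topology (euclidean :: 'a topology) (top_of_set ?K)) euclidean fst"
    by (rule Abstract_Topological_Spaces.closed_map_fst) (simp add: compact_space_subtopology compactin_euclidean_iff)
  then have cm: "closed_map (top_of_set (UNIV \<times> ?K)) (euclidean :: 'a topology) fst"
    using prod_topology_subtopology_eu[of "UNIV :: 'a set" ?K] by (simp only: subtopology_UNIV)
  have "closed (h -` {0})" using assms by (intro closed_vimage) (auto simp: continuous_on_eq_continuous_at)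
  then have "closedin (top_of_set (UNIV \<times> ?K)) ((UNIV \<times> ?K) \<inter> h -` {0})" by (rule closedin_closed_Int)
  then have "closed (fst ` ((UNIV \<times> ?K) \<inter> h -` {0}))" using cm by (simp add: closed_map_def)
  moreover have "fst ` ((UNIV \<times> ?K) \<inter> h -` {0}) = {c. \<exists>r\<in>?K. h (c, r) = 0}" by (force simp: image_iff)
  ultimately show ?thesis by simp
qed

text \<open>The coefficients for which \<open>P\<^sub>0\<close> and \<open>P\<^sub>1\<close>, regarded as sections over the projective line with the
  forced zeros at \<open>0\<close> and infinity removed, have a common zero.\<close>
definition common_zero :: "(3 \<Rightarrow> nat set) \<Rightarrow> (3 \<Rightarrow> nat \<Rightarrow> complex) set" where
  "common_zero B = {c. \<exists>r\<in>cball 0 1. (low_chart B c 0 r, low_chart B c 1 r) = 0} \<union>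
     {c. \<exists>r\<in>cball 0 1. (high_chart B c 0 r, high_chart B c 1 r) = 0}"

lemma closed_common_zero: "closed (common_zero B)"
proof -
  have "closed {c. \<exists>r\<in>cball 0 1. (\<lambda>p. (low_chart B (fst p) 0 (snd p), low_chart B (fst p) 1 (snd p))) (c, r) = 0}"
    unfolding low_chart_def
    by (intro closed_compact_fibres continuous_on_Pair continuous_on_sum continuous_on_mult
        continuous_coefficient continuous_on_power continuous_on_snd continuous_on_id)
  moreover have "closed {c. \<exists>r\<in>cball 0 1. (\<lambda>p. (high_chart B (fst p) 0 (snd p), high_chart B (fst p) 1 (snd p))) (c, r) = 0}"
    unfolding high_chart_def
    by (intro closed_compact_fibres continuous_on_Pair continuous_on_sum continuous_on_mult
        continuous_coefficient continuous_on_power continuous_on_snd continuous_on_id)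
  ultimately show ?thesis unfolding common_zero_def by (intro closed_Un) simp_all
qed

lemma no_common_root_outside:
  assumes fin: "\<And>i. finite (B i)" and c: "c \<notin> common_zero B" and r: "r \<noteq> 0" "poly (param_poly B c 0) r = 0"
  shows "poly (param_poly B c 1) r \<noteq> 0"
proof
  assume r1: "poly (param_poly B c 1) r = 0"
  show False
  proof (cases "norm r \<le> 1")
    case True
    have "low_chart B c 0 r = 0" "low_chart B c 1 r = 0"
      using r r1 param_poly_charts(1)[of B 0 c r, OF fin] param_poly_charts(1)[of B 1 c r, OF fin] by auto
    then show False using c True by (auto simp: common_zero_def zero_prod_def)
  next
    case False
    have "high_chart B c 0 (1 / r) = 0" "high_chart B c 1 (1 / r) = 0"
      using r r1 param_poly_charts(2)[of B 0 r c, OF fin r(1)] param_poly_charts(2)[of B 1 r c, OF fin r(1)] by auto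
    moreover have "1 / r \<in> cball 0 1" using False r(1) by (auto simp: norm_divide divide_le_eq_1)
    ultimately show False using c by (auto simp: common_zero_def zero_prod_def)
  qed
qed

text \<open>Only finitely many members of a complex line through \<open>c\<close> are allowed to be outside of \<open>U\<close>.\<close>
lemma perturbed_in_closure:
  fixes c :: "3 \<Rightarrow> nat \<Rightarrow> complex" and D :: "3 \<Rightarrow> nat \<Rightarrow> complex"
  assumes fin: "finite Bad" and U: "\<And>s. s \<notin> Bad \<Longrightarrow> (\<lambda>i n. c i n + s * D i n) \<in> U"
  shows "c \<in> closure U"
proof (rule Lim_in_closed_set[where F = "at (0::complex)" and f = "\<lambda>s i n. c i n + s * D i n"])
  show "closed (closure U)" "at (0::complex) \<noteq> bot" by simp_all
  have "eventually (\<lambda>s. s \<notin> Bad) (at 0)"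
    using islimpt_finite[OF fin, of 0] islimpt_iff_eventually by blast
  then show "eventually (\<lambda>s. (\<lambda>i n. c i n + s * D i n) \<in> closure U) (at 0)"
    by (rule eventually_mono) (use U closure_subset in blast)
  have "continuous_on UNIV (\<lambda>s i n. c i n + s * D i n)"
    by (intro continuous_on_coordinatewise_then_product continuous_intros)
  then have "isCont (\<lambda>s i n. c i n + s * D i n) 0" by (simp add: continuous_on_eq_continuous_at)
  then show "(\<lambda>s i n. c i n + s * D i n) \<midarrow>0\<rightarrow> c" by (simp add: isCont_def)
qed

lemma low_chart_as_poly:
  assumes "finite (B i)" "B i \<noteq> {}" "c i (Min (B i)) \<noteq> 0"
  shows "finite {r. low_chart B c i r = 0}" "low_chart B c i 0 \<noteq> 0"
proof -
  define p where "p = (\<Sum>b\<in>B i. monom (c i b) (b - Min (B i)))"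
  have p: "poly p r = low_chart B c i r" for r by (simp add: p_def low_chart_def poly_sum poly_monom)
  have "low_chart B c i 0 = (\<Sum>b\<in>B i. if b = Min (B i) then c i b else 0)"
    unfolding low_chart_def
  proof (rule sum.cong)
    fix b assume "b \<in> B i"
    then have "Min (B i) \<le> b" by (rule Min_le[OF assms(1)])
    then show "c i b * 0 ^ (b - Min (B i)) = (if b = Min (B i) then c i b else 0)" by (simp add: power_0_left)
  qed simp
  also have "\<dots> = c i (Min (B i))" using assms by simp
  finally show "low_chart B c i 0 \<noteq> 0" using assms(3) by simp
  then have "p \<noteq> 0" using p[of 0] by auto
  then show "finite {r. low_chart B c i r = 0}" using poly_roots_finite[of p] p by simp
qed

lemma high_chart_as_poly:
  assumes "finite (B i)" "B i \<noteq> {}" "c i (Max (B i)) \<noteq> 0"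
  shows "finite {r. high_chart B c i r = 0}" "high_chart B c i 0 \<noteq> 0"
proof -
  define p where "p = (\<Sum>b\<in>B i. monom (c i b) (Max (B i) - b))"
  have p: "poly p r = high_chart B c i r" for r by (simp add: p_def high_chart_def poly_sum poly_monom)
  have "high_chart B c i 0 = (\<Sum>b\<in>B i. if b = Max (B i) then c i b else 0)"
    unfolding high_chart_def using Max_ge[OF assms(1)] by (intro sum.cong) (auto simp: power_0_left le_antisym)
  also have "\<dots> = c i (Max (B i))" using assms by simp
  finally show "high_chart B c i 0 \<noteq> 0" using assms(3) by simp
  then have "p \<noteq> 0" using p[of 0] by auto
  then show "finite {r. high_chart B c i r = 0}" using poly_roots_finite[of p] p by simp
qed

text \<open>Two perturbations are enough: the first one makes the two extreme coefficients of \<open>P\<^sub>0\<close> nonzero, so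
  that the charts of \<open>P\<^sub>0\<close> have finitely many roots, none of them at \<open>0\<close>; the second one moves the values of
  the charts of \<open>P\<^sub>1\<close> at these roots away from zero.\<close>

lemma common_zero_complement_dense:
  assumes fin: "\<And>i. finite (B i)" and ne: "\<And>i. B i \<noteq> {}"
  shows "coeff_space B \<subseteq> closure (coeff_space B - common_zero B)"
proof -
  have Mn: "Min (B i) \<in> B i" and Mx: "Max (B i) \<in> B i" for i using fin ne by simp_all
  define V where "V = {c \<in> coeff_space B. c 0 (Min (B 0)) \<noteq> 0 \<and> c 0 (Max (B 0)) \<noteq> 0}"
  have 1: "coeff_space B \<subseteq> closure V"
  proof
    fix c assume c: "c \<in> coeff_space B"
    let ?D = "\<lambda>i n. if i = 0 \<and> (n = Min (B 0) \<or> n = Max (B 0)) then 1 else (0::complex)"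
    show "c \<in> closure V"
    proof (rule perturbed_in_closure)
      show "finite {- c 0 (Min (B 0)), - c 0 (Max (B 0))}" by simp
      fix s assume s: "s \<notin> {- c 0 (Min (B 0)), - c 0 (Max (B 0))}"
      then have "c 0 (Min (B 0)) + s \<noteq> 0" "c 0 (Max (B 0)) + s \<noteq> 0" by (auto simp: add_eq_0_iff)
      then show "(\<lambda>i n. c i n + s * ?D i n) \<in> V"
        using c Mn Mx by (auto simp: V_def coeff_space_def)
    qed
  qed
  have 2: "V \<subseteq> closure (coeff_space B - common_zero B)"
  proof
    fix c assume cV: "c \<in> V"
    then have c: "c \<in> coeff_space B" "c 0 (Min (B 0)) \<noteq> 0" "c 0 (Max (B 0)) \<noteq> 0" by (auto simp: V_def)
    let ?m = "Min (B 1)"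
    let ?D = "\<lambda>i n. if i = 1 \<and> n = ?m then 1 else (0::complex)"
    define d where "d s = (\<lambda>i n. c i n + s * ?D i n)" for s
    have L0: "low_chart B (d s) 0 r = low_chart B c 0 r" "high_chart B (d s) 0 r = high_chart B c 0 r" for s r
      by (simp_all add: low_chart_def high_chart_def d_def)
    have ite: "(\<Sum>b\<in>B 1. (c 1 b + s * ?D 1 b) * g b) = (\<Sum>b\<in>B 1. c 1 b * g b) + s * g ?m" for s and g :: "nat \<Rightarrow> complex"
    proof -
      have "(\<Sum>b\<in>B 1. (c 1 b + s * ?D 1 b) * g b) = (\<Sum>b\<in>B 1. c 1 b * g b + (if b = ?m then s * g b else 0))"
        by (intro sum.cong) (auto simp: algebra_simps)
      then show ?thesis using fin Mn by (simp add: sum.distrib)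
    qed
    have L1: "low_chart B (d s) 1 r = low_chart B c 1 r + s" for s r
      unfolding low_chart_def d_def ite by simp
    have H1: "high_chart B (d s) 1 r = high_chart B c 1 r + s * r ^ (Max (B 1) - ?m)" for s r
      unfolding high_chart_def d_def ite by simp
    define Bad where "Bad = (\<lambda>r. - low_chart B c 1 r) ` {r. low_chart B c 0 r = 0} \<union>
      (\<lambda>r. - high_chart B c 1 r / r ^ (Max (B 1) - ?m)) ` {r. high_chart B c 0 r = 0}"
    show "c \<in> closure (coeff_space B - common_zero B)"
    proof (rule perturbed_in_closure)
      show "finite Bad" unfolding Bad_def
        using low_chart_as_poly(1)[of B 0 c, OF fin ne c(2)] high_chart_as_poly(1)[of B 0 c, OF fin ne c(3)] by simp
      fix s assume s: "s \<notin> Bad"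
      have "d s \<notin> common_zero B"
      proof
        assume "d s \<in> common_zero B"
        then consider r where "low_chart B (d s) 0 r = 0" "low_chart B (d s) 1 r = 0"
          | r where "high_chart B (d s) 0 r = 0" "high_chart B (d s) 1 r = 0"
          by (auto simp: common_zero_def zero_prod_def)
        then show False
        proof cases
          case (1 r)
          then have "low_chart B c 0 r = 0" "s = - low_chart B c 1 r" unfolding L0 L1 by (simp_all add: eq_neg_iff_add_eq_0 add.commute)
          then show False using s unfolding Bad_def by blast
        next
          case (2 r)
          then have r: "high_chart B c 0 r = 0" "s * r ^ (Max (B 1) - ?m) = - high_chart B c 1 r"
            unfolding L0 H1 by (simp_all add: eq_neg_iff_add_eq_0 add.commute)
          then have "r \<noteq> 0" using high_chart_as_poly(2)[of B 0 c, OF fin ne c(3)] by auto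
          then have "s = - high_chart B c 1 r / r ^ (Max (B 1) - ?m)" by (simp add: r(2)[symmetric])
          then show False using s r(1) unfolding Bad_def by blast
        qed
      qed
      moreover have "d s \<in> coeff_space B" using c(1) Mn by (auto simp: coeff_space_def d_def)
      ultimately show "(\<lambda>i n. c i n + s * ?D i n) \<in> coeff_space B - common_zero B" by (simp add: d_def)
    qed
  qed
  have "closure V \<subseteq> closure (coeff_space B - common_zero B)" using 2 by (intro closure_minimal) simp_all
  then show ?thesis using 1 by blast
qed

lemma generically_no_common_root:
  assumes fin: "\<And>i. finite (B i)" and ne: "\<And>i. B i \<noteq> {}"
    and Q: "\<And>c. (\<forall>r. r \<noteq> 0 \<longrightarrow> poly (param_poly B c 0) r = 0 \<longrightarrow> poly (param_poly B c 1) r \<noteq> 0) \<Longrightarrow> Q c"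
  shows "generically B Q"
  unfolding generically_def
proof (intro exI conjI ballI)
  show "openin (top_of_set (coeff_space B)) (coeff_space B - common_zero B)"
    unfolding Diff_eq using closed_common_zero by (intro openin_open_Int) (rule open_Compl)
  show "coeff_space B \<subseteq> closure (coeff_space B - common_zero B)"
    using fin ne by (rule common_zero_complement_dense)
  fix c assume "c \<in> coeff_space B - common_zero B"
  then show "Q c" using no_common_root_outside[of B c, OF fin] by (intro Q) blast
qed

section \<open>Convex hulls from support bounds\<close>

text \<open>The third coordinate is the one that makes the sum \<open>u\<close>.\<close>
definition barycentric :: "real \<Rightarrow> real \<times> real \<Rightarrow> 3 \<Rightarrow> real" where
  "barycentric u z l = (if l = 0 then fst z else if l = 1 then snd z else u - fst z - snd z)"

lemma sum_barycentric: "(\<Sum>l\<in>UNIV. barycentric u z l) = u"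
  by (subst sum_UNIV_3_distinct[of 0 1 2]) (simp_all add: barycentric_def)

text \<open>In barycentric coordinates \<open>z\<^sub>0 + z\<^sub>1 + z\<^sub>2 = u\<close> every linear functional can be written with nonnegative
  weights of which one is zero.\<close>

lemma in_hull_of_support_bounds:
  fixes e :: "real \<times> real"
  assumes fin: "finite Z"
    and up: "\<And>i j k a b \<epsilon>. i \<noteq> j \<Longrightarrow> j \<noteq> k \<Longrightarrow> i \<noteq> k \<Longrightarrow> 0 \<le> a \<Longrightarrow> 0 \<le> b \<Longrightarrow> 0 < \<epsilon> \<Longrightarrow>
      \<exists>z\<in>Z. a * barycentric u z i + b * barycentric u z j \<le> h i j a b + \<epsilon>"
    and lo: "\<And>i j k a b. i \<noteq> j \<Longrightarrow> j \<noteq> k \<Longrightarrow> i \<noteq> k \<Longrightarrow> 0 \<le> a \<Longrightarrow> 0 \<le> b \<Longrightarrow>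
      h i j a b \<le> a * barycentric u e i + b * barycentric u e j"
  shows "e \<in> convex hull Z"
proof (rule ccontr)
  assume "e \<notin> convex hull Z"
  moreover have "closed (convex hull Z)" using fin by (intro compact_imp_closed finite_imp_compact_convex_hull)
  ultimately obtain n c where n: "inner n e < c" "\<forall>x\<in>convex hull Z. c < inner n x"
    using separating_hyperplane_closed_point[OF convex_convex_hull] by blast
  define N where "N l = (if l = 0 then fst n else if l = 1 then snd n else 0)" for l :: 3
  obtain k where k: "\<forall>l. N k \<le> N l"
    using arg_min_if_finite(2)[of "UNIV :: 3 set" N] by (metis UNIV_I UNIV_not_empty finite linorder_not_less)
  obtain i j where d: "i \<noteq> j" "j \<noteq> k" "i \<noteq> k"
  proof -
    obtain i :: 3 where "i \<noteq> k" by (metis zero_neq_one)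
    moreover obtain j where "j \<noteq> i" "i \<noteq> k" "j \<noteq> k" using third_index_exists[OF \<open>i \<noteq> k\<close>] by blast
    ultimately show ?thesis using that by blast
  qed
  have inn: "inner n z = (N i - N k) * barycentric u z i + (N j - N k) * barycentric u z j + N k * u" for z
  proof -
    have "inner n z = (\<Sum>l\<in>UNIV. N l * barycentric u z l)"
      by (subst sum_UNIV_3_distinct[of 0 1 2]) (simp_all add: N_def barycentric_def inner_prod_def)
    also have "\<dots> = N i * barycentric u z i + N j * barycentric u z j + N k * barycentric u z k" by (rule sum_UNIV_3_distinct[OF d])
    also have "barycentric u z k = u - barycentric u z i - barycentric u z j" using sum_barycentric[of u z] unfolding sum_UNIV_3_distinct[OF d] by simp
    finally show ?thesis by (simp add: algebra_simps)
  qed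
  have ab: "0 \<le> N i - N k" "0 \<le> N j - N k" using k by simp_all
  obtain z where z: "z \<in> Z" "(N i - N k) * barycentric u z i + (N j - N k) * barycentric u z j \<le> h i j (N i - N k) (N j - N k) + (c - inner n e)"
    using up[OF d ab, of "c - inner n e"] n(1) by auto
  have "inner n z \<le> h i j (N i - N k) (N j - N k) + (c - inner n e) + N k * u" using z(2) inn[of z] by simp
  also have "\<dots> \<le> inner n e + (c - inner n e)" using lo[OF d ab] inn[of e] by simp
  finally have "inner n z \<le> c" by simp
  then show False using n(2) hull_inc[OF z(1)] by fastforce
qed

lemma not_extreme_of_hull:
  assumes "e \<in> convex hull I" "I \<subseteq> N" "convex N" "e \<notin> I"
  shows "\<not> e extreme_point_of N"
proof
  assume e: "e extreme_point_of N"
  have "convex hull I \<subseteq> N" using assms(2,3) by (rule hull_minimal)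
  then have "e extreme_point_of (convex hull I)" using e assms(1) by (auto simp: extreme_point_of_def)
  then show False using extreme_point_of_convex_hull assms(4) by blast
qed

section \<open>Points obtained by mixed subdivisions\<close>

lemma mixed_subdivision_interior:
  assumes S: "mixed_subdivision B S" and ne: "S \<noteq> {}"
  shows "interior (bigC B) \<noteq> {}"
proof -
  obtain R where R: "R \<in> S" using ne by blast
  then have m: "minkowski_cell B R" and sub: "msum R \<subseteq> bigC B" using S by (auto simp: mixed_subdivision_def)
  have "convex (R l)" for l using m unfolding minkowski_cell_def by (metis convex_convex_hull)
  then have cv: "convex (msum R)" by (rule convex_msum)
  have dim: "aff_dim (msum R) = 2" using m by (simp add: minkowski_cell_def)
  then have "affine hull (msum R) = UNIV" using aff_dim_eq_full[of "msum R"] by simp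
  then have "rel_interior (msum R) = interior (msum R)" by (rule rel_interior_interior)
  moreover have "msum R \<noteq> {}" using dim by auto
  ultimately have "interior (msum R) \<noteq> {}" using rel_interior_eq_empty[OF cv] by simp
  then show ?thesis using interior_mono[OF sub] by blast
qed

definition end_subdivisions :: "(3 \<Rightarrow> nat set) \<Rightarrow> (3 \<Rightarrow> (real \<times> real) set) set set" where
  "end_subdivisions B = {S. mixed_subdivision B S \<and>
     (\<forall>l b'. used_point S l b' \<longrightarrow> b' = Min (B l) \<or> b' = Max (B l))}"

context
  fixes B :: "3 \<Rightarrow> nat set" and k0 :: 3
  assumes fin: "\<And>l. finite (B l)" and ne: "\<And>l. B l \<noteq> {}" and zero: "0 \<in> B k0"
begin

lemma barycentric_obtained_point:
  assumes S: "mixed_subdivision B S"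
  shows "barycentric (real (Max (\<Union>l. B l))) (obtained_point B S) l = mixed_area B S l"
proof -
  have "mixed_area B S 0 + mixed_area B S 1 + mixed_area B S 2 = real (Max (\<Union>l. B l))"
    using mixed_area_total(1)[OF S fin ne zero] by (subst (asm) sum_UNIV_3_distinct[of 0 1 2]) simp_all
  then show ?thesis using distinct_3_cases(1)[of 0 1 2 l] by (auto simp: barycentric_def obtained_point_def)
qed

text \<open>Mixed areas are integers between \<open>0\<close> and \<open>u\<close>.\<close>
lemma finite_obtained_points:
  assumes "\<And>S. S \<in> T \<Longrightarrow> mixed_subdivision B S"
  shows "finite (obtained_point B ` T)"
proof -
  let ?u = "Max (\<Union>l. B l)"
  have A: "mixed_area B S l \<in> real ` {..?u}" if "mixed_subdivision B S" for S l
  proof -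
    note t = mixed_area_total[OF that fin ne zero]
    obtain n where n: "mixed_area B S l = of_int n" using t(2)[of l] by (elim Ints_cases)
    have "mixed_area B S l \<le> sum (mixed_area B S) UNIV" using t(3) by (intro member_le_sum) auto
    then have "of_int n \<le> real ?u" using t(1) n by simp
    moreover have "0 \<le> n" using t(3)[of l] n by simp
    ultimately have "nat n \<le> ?u" "mixed_area B S l = real (nat n)" using n by linarith+
    then show ?thesis by blast
  qed
  have "obtained_point B ` T \<subseteq> real ` {..?u} \<times> real ` {..?u}"
    using A assms by (auto simp: obtained_point_def)
  then show ?thesis by (rule finite_subset) simp
qed

lemma obtained_in_hull_of_ends:
  assumes S: "mixed_subdivision B S" and int: "interior (bigC B) \<noteq> {}"
  shows "obtained_point B S \<in> convex hull (obtained_point B ` end_subdivisions B)"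
proof (rule in_hull_of_support_bounds[where u = "real (Max (\<Union>l. B l))" and h = "corner_support B"])
  show "finite (obtained_point B ` end_subdivisions B)"
    by (rule finite_obtained_points) (simp add: end_subdivisions_def)
next
  fix i j k :: 3 and a b :: real
  assume d: "i \<noteq> j" "j \<noteq> k" "i \<noteq> k" and ab: "0 \<le> a" "0 \<le> b"
  show "corner_support B i j a b \<le> a * barycentric (real (Max (\<Union>l. B l))) (obtained_point B S) i
      + b * barycentric (real (Max (\<Union>l. B l))) (obtained_point B S) j"
    unfolding barycentric_obtained_point[OF S] using mixed_area_lower_bound[OF S fin ne zero d ab] .
  fix \<epsilon> :: real assume \<epsilon>: "0 < \<epsilon>"
  obtain S' where S': "mixed_subdivision B S'" "\<And>l b'. used_point S' l b' \<Longrightarrow> b' = Min (B l) \<or> b' = Max (B l)"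
    "a * mixed_area B S' i + b * mixed_area B S' j \<le> corner_support B i j a b + \<epsilon>"
    using end_subdivision_bound[OF fin ne zero d ab \<epsilon> int] by blast
  show "\<exists>z\<in>obtained_point B ` end_subdivisions B. a * barycentric (real (Max (\<Union>l. B l))) z i
      + b * barycentric (real (Max (\<Union>l. B l))) z j \<le> corner_support B i j a b + \<epsilon>"
  proof (rule bexI[of _ "obtained_point B S'"])
    show "obtained_point B S' \<in> obtained_point B ` end_subdivisions B"
      using S'(1,2) by (auto simp: end_subdivisions_def)
  qed (unfold barycentric_obtained_point[OF S'(1)], rule S'(3))
qed

lemma obtained_in_newton_polygon:
  assumes supp: "\<And>l. {n. coeff (P l) n \<noteq> 0} = B l" and \<phi>: "implicit_equation P \<phi>" and one: "param_degree_one P"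
    and com: "\<forall>l l' r. l \<noteq> l' \<longrightarrow> r \<noteq> 0 \<longrightarrow> poly (P l) r = 0 \<longrightarrow> poly (P l') r \<noteq> 0"
    and S: "mixed_subdivision B S"
  shows "obtained_point B S \<in> newton_polygon \<phi>"
proof -
  define u where "u = Max (\<Union>l. B l)"
  have c: "coeff (P l) n \<noteq> 0 \<longleftrightarrow> n \<in> B l" for l n using supp[of l] by blast
  have nz: "P l \<noteq> 0" for l using c[of l] ne[of l] by fastforce
  have dg: "degree (P l) = Max (B l)" for l
  proof (rule antisym)
    show "degree (P l) \<le> Max (B l)" using c[of l "degree (P l)"] nz fin by (intro Max_ge) simp_all
    show "Max (B l) \<le> degree (P l)" using c[of l] fin ne by (intro le_degree) simp
  qed
  have od: "order 0 (P l) = Min (B l)" for l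
  proof (rule antisym)
    show "order 0 (P l) \<le> Min (B l)" using c[of l] fin ne by (intro order_0_le) simp
    show "Min (B l) \<le> order 0 (P l)" using c[of l "order 0 (P l)"] coeff_order_0_nonzero[OF nz] fin by (intro Min_le) simp_all
  qed
  have finU: "finite (\<Union>l. B l)" and neU: "(\<Union>l. B l) \<noteq> {}" using fin ne by auto
  have mu: "Max (B l) \<le> u" for l
    unfolding u_def using finU fin ne by (intro Max_mono) auto
  define E where "E = {t. poly (P 2) t \<noteq> 0 \<and> card {s. poly (P 2) s \<noteq> 0 \<and> curve_point P s = curve_point P t} \<noteq> 1}"
  interpret implicit_curve P \<phi> u E
  proof
    show "degree (P l) \<le> u" for l using mu dg by simp
    show "P l \<noteq> 0" for l by (rule nz)
    show "implicit_equation P \<phi>" by (rule \<phi>)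
    show "finite E" using one by (simp add: E_def param_degree_one_def)
    fix t s assume t: "t \<notin> E" "poly (P 2) t \<noteq> 0" and s: "poly (P 2) s \<noteq> 0" "curve_point P s = curve_point P t"
    have "card {s. poly (P 2) s \<noteq> 0 \<and> curve_point P s = curve_point P t} = 1" using t by (simp add: E_def)
    then obtain x where "{s. poly (P 2) s \<noteq> 0 \<and> curve_point P s = curve_point P t} = {x}" by (elim card_1_singletonE)
    moreover have "s \<in> {s. poly (P 2) s \<noteq> 0 \<and> curve_point P s = curve_point P t}"
      "t \<in> {s. poly (P 2) s \<noteq> 0 \<and> curve_point P s = curve_point P t}" using s t(2) by simp_all
    ultimately show "s = t" by simp
  qed
  define w where "w l = u - Max (B l)" for l
  define Z where "Z = (\<lambda>m. (real (fst m), real (snd m))) ` psupp \<phi>"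
  have N: "newton_polygon \<phi> = convex hull Z"
    unfolding newton_polygon_def Z_def psupp_def by (rule arg_cong[of _ _ "\<lambda>X. convex hull X"]) (auto simp: image_iff)
  have u: "u \<in> (\<Union>l. B l)" unfolding u_def using finU neU by (rule Max_in)
  then obtain l1 where "u \<in> B l1" by blast
  then have l1: "w l1 = 0" using fin by (simp add: w_def)
  have v0: "Min (B k0) = 0" using Min_le[OF fin zero] by simp
  have dw: "degree (P l) + w l = u" for l using mu[of l] by (simp add: dg w_def)
  have th: "barycentric (real u) (real (fst m), real (snd m)) l = real (expo u m l)" if "m \<in> psupp \<phi>" for m l
    using supp_le[OF that] by (auto simp: barycentric_def expo_def of_nat_diff)
  have "obtained_point B S \<in> convex hull Z"
  proof (rule in_hull_of_support_bounds[where u = "real u" and h = "corner_support B"])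
    show "finite Z" using finite_psupp by (simp add: Z_def)
  next
    fix i j k :: 3 and a b :: real
    assume d: "i \<noteq> j" "j \<noteq> k" "i \<noteq> k" and ab: "0 \<le> a" "0 \<le> b"
    show "corner_support B i j a b \<le> a * barycentric (real u) (obtained_point B S) i + b * barycentric (real u) (obtained_point B S) j"
      unfolding u_def barycentric_obtained_point[OF S] using mixed_area_lower_bound[OF S fin ne zero d ab] .
    fix \<epsilon> :: real assume \<epsilon>: "0 < \<epsilon>"
    obtain m where m: "m \<in> psupp \<phi>" "a * expo u m i + b * expo u m j \<le>
        min (a * Min (B j)) (b * Min (B i)) + min (a * w j) (b * w i) + \<epsilon>"
      using exponent_bound[OF d com od dw v0 l1 ab \<epsilon>] by blast
    have "topgap B l = real (w l)" for l using mu[of l] by (simp add: topgap_def w_def u_def of_nat_diff)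
    then have "min (a * Min (B j)) (b * Min (B i)) + min (a * w j) (b * w i) = corner_support B i j a b"
      by (simp add: corner_support_def lowgap_def)
    then show "\<exists>z\<in>Z. a * barycentric (real u) z i + b * barycentric (real u) z j \<le> corner_support B i j a b + \<epsilon>"
      using m th[OF m(1)] unfolding Z_def by (intro bexI[of _ "(real (fst m), real (snd m))"]) auto
  qed
  then show ?thesis unfolding N .
qed

text \<open>A vertex of a cell on the top edge at \<open>b\<close> means that \<open>b\<close> is used, and end point subdivisions do not
  use an internal point; in particular they differ from \<open>S\<close>.\<close>
lemma end_subdivisions_other:
  assumes b: "internal_point B i b" and f: "defines_face_on_L B S i b"
  shows "end_subdivisions B \<subseteq> other_subdivisions B S i b" "S \<noteq> {}"
proof -
  obtain R where R: "R \<in> S" "\<forall>j. {((\<lambda>_. apex)(i := (real b, 0))) j} face_of R j"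
    using f unfolding defines_face_on_L_def vertex_face_def by blast
  then show "S \<noteq> {}" by blast
  have "(real b, 0) extreme_point_of R i" using R(2)[rule_format, of i] by (simp add: face_of_singleton)
  then have "used_point S i b" using R(1) unfolding used_point_def by blast
  moreover have "b \<noteq> Min (B i)" "b \<noteq> Max (B i)" using b by (auto simp: internal_point_def)
  ultimately show "end_subdivisions B \<subseteq> other_subdivisions B S i b"
    unfolding end_subdivisions_def other_subdivisions_def by blast
qed

end

section \<open>Internal points on the top edge\<close>
theorem theorem10:
  fixes B :: "3 \<Rightarrow> nat set"
  assumes "\<forall>i. finite (B i) \<and> B i \<noteq> {}"
  shows "generically B (\<lambda>c.
    (\<forall>i. {n. coeff (param_poly B c i) n \<noteq> 0} = B i) \<longrightarrow>
    coprime (param_poly B c 0) (param_poly B c 2) \<longrightarrow>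
    coprime (param_poly B c 1) (param_poly B c 2) \<longrightarrow>
    param_degree_one (param_poly B c) \<longrightarrow>
    (\<forall>\<phi> S i b.
      implicit_equation (param_poly B c) \<phi> \<longrightarrow>
      mixed_subdivision B S \<longrightarrow>
      internal_point B i b \<longrightarrow>
      defines_face_on_L B S i b \<longrightarrow>
      obtained_point B S \<in> newton_polygon \<phi> \<and>
      obtained_point B S \<in> convex hull (obtained_point B ` other_subdivisions B S i b) \<and>
      (obtained_point B S \<notin> obtained_point B ` other_subdivisions B S i b \<longrightarrow>
        \<not> obtained_point B S extreme_point_of newton_polygon \<phi>)))"
proof -
  have fin: "\<And>l. finite (B l)" and ne: "\<And>l. B l \<noteq> {}" using assms by blast+
  show ?thesis
  proof (rule generically_no_common_root[OF fin ne], intro impI allI)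
    fix c \<phi> S i b
    let ?P = "param_poly B c"
    assume c01: "\<forall>r. r \<noteq> 0 \<longrightarrow> poly (?P 0) r = 0 \<longrightarrow> poly (?P 1) r \<noteq> 0"
      and supp: "\<forall>l. {n. coeff (?P l) n \<noteq> 0} = B l"
      and cop: "coprime (?P 0) (?P 2)" "coprime (?P 1) (?P 2)" and one: "param_degree_one ?P"
      and \<phi>: "implicit_equation ?P \<phi>" and S: "mixed_subdivision B S"
      and b: "internal_point B i b" and f: "defines_face_on_L B S i b"
    have c2: "poly (?P 0) r \<noteq> 0 \<or> poly (?P 2) r \<noteq> 0" "poly (?P 1) r \<noteq> 0 \<or> poly (?P 2) r \<noteq> 0" for r
      using coprime_poly_0[OF cop(1), of r] coprime_poly_0[OF cop(2), of r] by blast+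
    have com: "\<forall>l l' r. l \<noteq> l' \<longrightarrow> r \<noteq> 0 \<longrightarrow> poly (?P l) r = 0 \<longrightarrow> poly (?P l') r \<noteq> 0"
    proof (intro allI impI)
      fix l l' :: 3 and r assume l: "l \<noteq> l'" and r: "r \<noteq> 0" "poly (?P l) r = 0"
      have "l = 0 \<or> l = 1 \<or> l = 2" "l' = 0 \<or> l' = 1 \<or> l' = 2" by (rule distinct_3_cases(1); simp)+
      then show "poly (?P l') r \<noteq> 0" using l r c01 c2[of r] by auto
    qed
    obtain k0 where "poly (?P k0) 0 \<noteq> 0" using c2[of 0] by blast
    then have "coeff (?P k0) 0 \<noteq> 0" by (simp add: poly_0_coeff_0)
    then have zero: "0 \<in> B k0" using supp by blast
    have newton: "obtained_point B S' \<in> newton_polygon \<phi>" if "mixed_subdivision B S'" for S'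
      using obtained_in_newton_polygon[OF fin ne zero _ \<phi> one com that] supp by blast
    have int: "interior (bigC B) \<noteq> {}"
      using mixed_subdivision_interior[OF S] end_subdivisions_other(2)[OF fin ne zero b f] by blast
    have "obtained_point B ` end_subdivisions B \<subseteq> obtained_point B ` other_subdivisions B S i b"
      by (intro image_mono end_subdivisions_other(1)[OF fin ne zero b f])
    then have hull: "obtained_point B S \<in> convex hull (obtained_point B ` other_subdivisions B S i b)"
      using obtained_in_hull_of_ends[OF fin ne zero S int] hull_mono by blast
    have sub: "obtained_point B ` other_subdivisions B S i b \<subseteq> newton_polygon \<phi>"
      using newton by (auto simp: other_subdivisions_def)
    have cv: "convex (newton_polygon \<phi>)" by (simp add: newton_polygon_def)
    show "obtained_point B S \<in> newton_polygon \<phi> \<and>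
      obtained_point B S \<in> convex hull (obtained_point B ` other_subdivisions B S i b) \<and>
      (obtained_point B S \<notin> obtained_point B ` other_subdivisions B S i b \<longrightarrow>
        \<not> obtained_point B S extreme_point_of newton_polygon \<phi>)"
      using newton[OF S] hull not_extreme_of_hull[OF hull sub cv] by blast
  qed
qed

end
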